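(* Let $w_0\in L^2(\Omega)$, and let $w$ be the solution of the closed-loop problem described in the context. Let $0\le \alpha<\frac{1}{C_F}\min\{\nu,\,c_0+w_d\}$ and set $\beta=2\min\{\nu-\alpha C_F,\;c_0+w_d-\alpha C_F\}>0$. Then for all $t>0$ $$\|w(t)\|^2+\beta e^{-2\alpha t}\int_0^t e^{2\alpha s}\Big(\|\nabla w(s)\|^2+\|w(s)\|_{L^2(\partial\Omega)}^2+\frac{1}{3\beta c_0}\|w(s)\|_{L^4(\partial\Omega)}^4\Big)\,ds\le e^{-2\alpha t}\|w_0\|^2 .$$
   Context: $\Omega\subset\mathbb{R}^2$ is a bounded domain with smooth boundary $\partial\Omega$ and outward unit normal $n$; $\nu>0$, $c_0>0$ and $w_d\ge 0$ are constants; $\mathbf 1=(1,1)$, so $\nabla w\cdot\mathbf 1=w_{x_1}+w_{x_2}$. $\|\cdot\|$ is the $L^2(\Omega)$ norm and $\|\cdot\|_m$ the $H^m(\Omega)$ norm. $C_F>0$ is a constant for which Friedrichs' inequality $\|y\|^2\le C_F(\|\nabla y\|^2+\|y\|^2_{L^2(\partial\Omega)})$ holds for all $y\in H^1(\Omega)$. Closed-loop problem (Burgers' equation for $w=u-w_d$, the deviation from the constant steady state $w_d$, with nonlinear Neumann feedback control $v_2$): $$w_t-\nu\Delta w+w_d(\nabla w\cdot\mathbf 1)+w(\nabla w\cdot\mathbf 1)=0\ \text{ in }\Omega\times(0,\infty),\qquad \frac{\partial w}{\partial n}=v_2:=-\frac1\nu\Big(2(c_0+w_d)w+\frac{2}{9c_0}w^3\Big)\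 \text{ on }\partial\Omega\times(0,\infty),$$ $w(0)=w_0$ in $\Omega$. Weak form: for all $v\in H^1(\Omega)$, $$(w_t,v)+\nu(\nabla w,\nabla v)+w_d(\nabla w\cdot\mathbf 1,v)+(w(\nabla w\cdot\mathbf 1),v)+\int_{\partial\Omega}\Big(2(c_0+w_d)w+\frac{2}{9c_0}w^3\Big)v\,d\Gamma=0 .$$ Standing assumption: there is a unique weak solution $w$, with the regularity $\|w(t)\|_2^2+\|w_t(t)\|_1^2+\int_0^t\|w_t(s)\|_2^2\,ds\le C$ (for some finite constant $C$). *)

theory Defs
  imports "HOL-Analysis.Analysis"
begin

section \<open>Classical derivatives and smooth functions\<close>

definition pd :: "'a::euclidean_space \<Rightarrow> ('a \<Rightarrow> real) \<Rightarrow> 'a \<Rightarrow> real" where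
  "pd b f x = frechet_derivative f (at x) b"

text \<open>Every iterated partial derivative is (Frechet) differentiable everywhere, i.e. f is of
  class C-infinity on the whole space.\<close>
definition smooth :: "('a::euclidean_space \<Rightarrow> real) \<Rightarrow> bool" where
  "smooth f \<longleftrightarrow> (\<forall>bs x. set bs \<subseteq> Basis \<longrightarrow> foldr pd bs f differentiable (at x))"

definition grad :: "(real^2 \<Rightarrow> real) \<Rightarrow> real^2 \<Rightarrow> real^2" where
  "grad f x = (\<chi> i. pd (axis i 1) f x)"

definition multi_pd :: "nat \<Rightarrow> nat \<Rightarrow> (real^2 \<Rightarrow> real) \<Rightarrow> real^2 \<Rightarrow> real" where
  "multi_pd a b f = (pd (axis 1 1) ^^ a) ((pd (axis 2 1) ^^ b) f)"

definition test_function :: "(real^2) set \<Rightarrow> (real^2 \<Rightarrow> real) \<Rightarrow> bool" where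
  "test_function \<Omega> \<phi> \<longleftrightarrow>
     smooth \<phi> \<and> compact (closure {x. \<phi> x \<noteq> 0}) \<and> closure {x. \<phi> x \<noteq> 0} \<subseteq> \<Omega>"


section \<open>Bounded planar domains with smooth boundary\<close>

text \<open>After a rigid change of the coordinate axes, the domain is near each boundary point the
  region strictly above the graph of a smooth function.\<close>
definition smooth_bounded_domain :: "(real^2) set \<Rightarrow> bool" where
  "smooth_bounded_domain \<Omega> \<longleftrightarrow>
     open \<Omega> \<and> connected \<Omega> \<and> bounded \<Omega> \<and> \<Omega> \<noteq> {} \<and>
     (\<forall>p \<in> frontier \<Omega>. \<exists>T r \<gamma>.
        orthogonal_transformation (T :: real^2 \<Rightarrow> real^2) \<and> 0 < r \<and> smooth (\<gamma> :: real \<Rightarrow> real) \<and>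
        \<Omega> \<inter> ball p r = {x \<in> ball p r. \<gamma> (T x $ 1) < T x $ 2})"

text \<open>The arc-length measure on a curve (or finite union of curves) S in the plane: it is carried
  by S and gives each injectively parametrised C1 piece of S its length.  For the boundary of
  a smooth bounded domain there is exactly one such measure (the restriction of
  one-dimensional Hausdorff measure).\<close>
definition arclength_measure :: "(real^2) set \<Rightarrow> (real^2) measure \<Rightarrow> bool" where
  "arclength_measure S \<Gamma> \<longleftrightarrow>
     sets \<Gamma> = sets borel \<and> emeasure \<Gamma> (- S) = 0 \<and>
     (\<forall>c a b. c C1_differentiable_on {a..b} \<and> inj_on c {a..b} \<and> c ` {a..b} \<subseteq> S \<longrightarrow>
        emeasure \<Gamma> (c ` {a..b}) =
          ennreal (integral {a..b} (\<lambda>t. norm (vector_derivative c (at t)))))"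


section \<open>Lebesgue and Sobolev spaces\<close>

definition Lp_space :: "nat \<Rightarrow> 'a measure \<Rightarrow> ('a \<Rightarrow> 'b::euclidean_space) set" where
  "Lp_space p M = {f \<in> borel_measurable M. integrable M (\<lambda>x. norm (f x) ^ p)}"

definition Lp_norm :: "nat \<Rightarrow> 'a measure \<Rightarrow> ('a \<Rightarrow> 'b::euclidean_space) \<Rightarrow> real" where
  "Lp_norm p M f = root p (\<integral>x. norm (f x) ^ p \<partial>M)"

definition inner_L2 :: "'a measure \<Rightarrow> ('a \<Rightarrow> 'b::euclidean_space) \<Rightarrow> ('a \<Rightarrow> 'b) \<Rightarrow> real" where
  "inner_L2 M f g = (\<integral>x. f x \<bullet> g x \<partial>M)"

text \<open>g is the weak derivative of u with multi-index (a, b).\<close>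
definition weak_deriv ::
  "(real^2) set \<Rightarrow> nat \<Rightarrow> nat \<Rightarrow> (real^2 \<Rightarrow> real) \<Rightarrow> (real^2 \<Rightarrow> real) \<Rightarrow> bool" where
  "weak_deriv \<Omega> a b u g \<longleftrightarrow>
     (\<forall>K. compact K \<and> K \<subseteq> \<Omega> \<longrightarrow> set_integrable lebesgue K u \<and> set_integrable lebesgue K g) \<and>
     (\<forall>\<phi>. test_function \<Omega> \<phi> \<longrightarrow>
        (\<integral>x. u x * multi_pd a b \<phi> x \<partial>lebesgue_on \<Omega>) =
          (-1) ^ (a + b) * (\<integral>x. g x * \<phi> x \<partial>lebesgue_on \<Omega>))"

definition sobolev :: "nat \<Rightarrow> (real^2) set \<Rightarrow> (real^2 \<Rightarrow> real) set" where
  "sobolev m \<Omega> = {u \<in> Lp_space 2 (lebesgue_on \<Omega>).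
     \<forall>a b. 1 \<le> a + b \<and> a + b \<le> m \<longrightarrow>
       (\<exists>g \<in> Lp_space 2 (lebesgue_on \<Omega>). weak_deriv \<Omega> a b u g)}"

text \<open>A square-integrable representative of the weak derivative, which is unique up to null
  sets; the value is arbitrary if there is no such derivative.\<close>
definition wderiv :: "(real^2) set \<Rightarrow> nat \<Rightarrow> nat \<Rightarrow> (real^2 \<Rightarrow> real) \<Rightarrow> real^2 \<Rightarrow> real" where
  "wderiv \<Omega> a b u = (SOME g. g \<in> Lp_space 2 (lebesgue_on \<Omega>) \<and> weak_deriv \<Omega> a b u g)"

definition wgrad :: "(real^2) set \<Rightarrow> (real^2 \<Rightarrow> real) \<Rightarrow> real^2 \<Rightarrow> real^2" where
  "wgrad \<Omega> u x = vector [wderiv \<Omega> 1 0 u x, wderiv \<Omega> 0 1 u x]"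

definition sobolev_norm :: "nat \<Rightarrow> (real^2) set \<Rightarrow> (real^2 \<Rightarrow> real) \<Rightarrow> real" where
  "sobolev_norm m \<Omega> u = sqrt ((Lp_norm 2 (lebesgue_on \<Omega>) u)\<^sup>2 +
     (\<Sum>(a, b) \<in> {(a, b). 1 \<le> a + b \<and> a + b \<le> m}.
        (Lp_norm 2 (lebesgue_on \<Omega>) (wderiv \<Omega> a b u))\<^sup>2))"

text \<open>The trace operator is the continuous extension to H1 of the restriction of functions that
  are smooth up to the boundary.\<close>
definition is_trace ::
  "(real^2) set \<Rightarrow> (real^2) measure \<Rightarrow> (real^2 \<Rightarrow> real) \<Rightarrow> (real^2 \<Rightarrow> real) \<Rightarrow> bool" where
  "is_trace \<Omega> \<Gamma> u g \<longleftrightarrow>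
     u \<in> sobolev 1 \<Omega> \<and> g \<in> Lp_space 2 \<Gamma> \<and>
     (\<exists>\<phi> :: nat \<Rightarrow> real^2 \<Rightarrow> real.
        (\<forall>k. smooth (\<phi> k)) \<and>
        (\<lambda>k. Lp_norm 2 (lebesgue_on \<Omega>) (\<lambda>x. \<phi> k x - u x)) \<longlonglongrightarrow> 0 \<and>
        (\<lambda>k. Lp_norm 2 (lebesgue_on \<Omega>) (\<lambda>x. grad (\<phi> k) x - wgrad \<Omega> u x)) \<longlonglongrightarrow> 0 \<and>
        (\<lambda>k. Lp_norm 2 \<Gamma> (\<lambda>x. \<phi> k x - g x)) \<longlonglongrightarrow> 0)"

definition btrace ::
  "(real^2) set \<Rightarrow> (real^2) measure \<Rightarrow> (real^2 \<Rightarrow> real) \<Rightarrow> real^2 \<Rightarrow> real" where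
  "btrace \<Omega> \<Gamma> u = (SOME g. is_trace \<Omega> \<Gamma> u g)"

definition friedrichs_constant :: "(real^2) set \<Rightarrow> (real^2) measure \<Rightarrow> real \<Rightarrow> bool" where
  "friedrichs_constant \<Omega> \<Gamma> CF \<longleftrightarrow>
     0 < CF \<and>
     (\<forall>y \<in> sobolev 1 \<Omega>.
        (Lp_norm 2 (lebesgue_on \<Omega>) y)\<^sup>2 \<le>
          CF * ((Lp_norm 2 (lebesgue_on \<Omega>) (wgrad \<Omega> y))\<^sup>2 + (Lp_norm 2 \<Gamma> (btrace \<Omega> \<Gamma> y))\<^sup>2))"


section \<open>The closed-loop problem\<close>

text \<open>The function wt is the time derivative of w, as functions of time with values in L2: the
  identity w(t) - w(s) = integral of wt over [s, t] holds after pairing with every element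
  of L2.\<close>
definition time_derivative ::
  "(real^2) set \<Rightarrow> (real \<Rightarrow> real^2 \<Rightarrow> real) \<Rightarrow> (real \<Rightarrow> real^2 \<Rightarrow> real) \<Rightarrow> bool" where
  "time_derivative \<Omega> w wt \<longleftrightarrow>
     (\<forall>v \<in> Lp_space 2 (lebesgue_on \<Omega>). \<forall>s t. 0 \<le> s \<and> s \<le> t \<longrightarrow>
        set_integrable lebesgue {s..t} (\<lambda>\<tau>. inner_L2 (lebesgue_on \<Omega>) (wt \<tau>) v) \<and>
        inner_L2 (lebesgue_on \<Omega>) (w t) v - inner_L2 (lebesgue_on \<Omega>) (w s) v =
          (LINT \<tau>:{s..t}|lebesgue. inner_L2 (lebesgue_on \<Omega>) (wt \<tau>) v))"

text \<open>The weak form at a fixed time, for the value w and the time derivative wt at that time.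
  The vector 1 is (1, 1).  The integrability conditions say that the two nonlinear terms are
  defined; they hold automatically if w is in H2.\<close>
definition weak_form ::
  "(real^2) set \<Rightarrow> (real^2) measure \<Rightarrow> real \<Rightarrow> real \<Rightarrow> real \<Rightarrow>
     (real^2 \<Rightarrow> real) \<Rightarrow> (real^2 \<Rightarrow> real) \<Rightarrow> bool" where
  "weak_form \<Omega> \<Gamma> \<nu> c0 wd w wt \<longleftrightarrow>
     (\<forall>v \<in> sobolev 1 \<Omega>.
        integrable (lebesgue_on \<Omega>) (\<lambda>x. w x * (wgrad \<Omega> w x \<bullet> 1) * v x) \<and>
        integrable \<Gamma> (\<lambda>x. (btrace \<Omega> \<Gamma> w x) ^ 3 * btrace \<Omega> \<Gamma> v x) \<and>
        inner_L2 (lebesgue_on \<Omega>) wt v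
        + \<nu> * inner_L2 (lebesgue_on \<Omega>) (wgrad \<Omega> w) (wgrad \<Omega> v)
        + wd * inner_L2 (lebesgue_on \<Omega>) (\<lambda>x. wgrad \<Omega> w x \<bullet> 1) v
        + inner_L2 (lebesgue_on \<Omega>) (\<lambda>x. w x * (wgrad \<Omega> w x \<bullet> 1)) v
        + (\<integral>x. (2 * (c0 + wd) * btrace \<Omega> \<Gamma> w x + 2 / (9 * c0) * (btrace \<Omega> \<Gamma> w x) ^ 3)
                * btrace \<Omega> \<Gamma> v x \<partial>\<Gamma>) = 0)"

text \<open>Weak solutions with the regularity of the existence theory.  The requirement that w(t) have
  a trace is no restriction, by the trace theorem; it makes the boundary values of w(t)
  available through btrace.  Equation and regularity are required for almost every time.\<close>
definition closed_loop_solution ::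
  "(real^2) set \<Rightarrow> (real^2) measure \<Rightarrow> real \<Rightarrow> real \<Rightarrow> real \<Rightarrow>
     (real^2 \<Rightarrow> real) \<Rightarrow> (real \<Rightarrow> real^2 \<Rightarrow> real) \<Rightarrow> bool" where
  "closed_loop_solution \<Omega> \<Gamma> \<nu> c0 wd w0 w \<longleftrightarrow>
     (AE x in lebesgue_on \<Omega>. w 0 x = w0 x) \<and>
     (\<forall>t\<ge>0. w t \<in> Lp_space 2 (lebesgue_on \<Omega>)) \<and>
     (\<exists>wt C. time_derivative \<Omega> w wt \<and>
        (AE t in lebesgue_on {0<..}.
           w t \<in> sobolev 2 \<Omega> \<and> wt t \<in> sobolev 2 \<Omega> \<and>
           (\<exists>g. is_trace \<Omega> \<Gamma> (w t) g) \<and>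
           weak_form \<Omega> \<Gamma> \<nu> c0 wd (w t) (wt t) \<and>
           set_integrable lebesgue {0..t} (\<lambda>s. (sobolev_norm 2 \<Omega> (wt s))\<^sup>2) \<and>
           (sobolev_norm 2 \<Omega> (w t))\<^sup>2 + (sobolev_norm 1 \<Omega> (wt t))\<^sup>2
             + (LINT s:{0..t}|lebesgue. (sobolev_norm 2 \<Omega> (wt s))\<^sup>2) \<le> C))"

end

theory Submission
  imports Defs
begin

text \<open>Testing the weak form with the solution itself gives an identity for the derivative of the
  squared norm, in which the two convection terms are, by the divergence theorem, boundary
  integrals of the square and the cube of the trace weighted with n . (1, 1), hence with at most
  the square root of 2.  The cubic term is absorbed by the quadratic and quartic feedback terms,
  Friedrichs' inequality provides the exponential rate, and one integrates in time.

  Of the divergence theorem only an inequality is needed: the integral of e . grad f over the domain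
  is at most |e| times the boundary integral of |f|.  For C1 functions f it follows by a partition
  of unity from an explicit computation in graph coordinates; for powers of H1 functions it
  follows by approximation, with s replaced by the bounded function sin (h s) / h.  In time, the
  solution is Lipschitz with values in L2, so the energy identity only needs a quadratic bound for
  the error on short intervals.\<close>

section \<open>Lebesgue measure in graph coordinates\<close>

text \<open>Three notions describe their objects only indirectly, and this shapes the proof.
  \<open>arclength_measure\<close> prescribes lengths of C1 arcs, so boundary integrals must be
  recovered in parameter form; the normal itself never appears. \<open>is_trace\<close> offers L2
  convergence, which controls neither the cube of the trace nor w^2 times the gradient, so the
  functions applied to w need bounded, Lipschitz derivatives. \<open>time_derivative\<close> pairs
  with one fixed function at a time, so even measurability of the pairing of wt t with w t has to be
  proved.

  The constants are a budget. Completing a square bounds the cubic convection term by c0 s^2 + s^4 /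
  (18 c0) on the boundary, and the linear one costs at most wd s^2. The feedback supplies 2 (c0 +
  wd) s^2 and 2 / (9 c0) s^4 = 4 s^4 / (18 c0), so c0 + wd and 3 / (18 c0) remain. In the equation
  for the squared norm everything is doubled, giving 2 \<nu>, 2 (c0 + wd) and 1 / (3 c0).
  Friedrichs' inequality spends 2 \<alpha> CF on the first two; \<beta> is the smaller
  remainder.\<close>

lemma real2_orthonormal_expand:
  fixes B1 B2 :: "real^2"
  assumes "norm B1 = 1" "norm B2 = 1" "B1 \<bullet> B2 = 0"
  shows "x = (B1 \<bullet> x) *\<^sub>R B1 + (B2 \<bullet> x) *\<^sub>R B2"
proof -
  have n: "B1 \<bullet> B1 = 1" "B2 \<bullet> B2 = 1"
    using assms(1,2) by (simp_all add: norm_eq_1)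
  have "independent {B1, B2}"
    using assms n by (intro pairwise_orthogonal_independent)
      (auto simp: pairwise_def orthogonal_def inner_commute)
  moreover have "B1 \<noteq> B2"
    using assms n by auto
  ultimately have "UNIV \<subseteq> span {B1, B2}"
    by (intro card_ge_dim_independent) auto
  then have "x \<in> span {B1, B2}" by auto
  then obtain a b where "x = a *\<^sub>R B1 + b *\<^sub>R B2"
    by (auto simp: span_insert span_singleton algebra_simps)
  then show ?thesis
    using n assms(3) by (simp add: inner_add_right inner_commute)
qed

text \<open>A Borel measure that gives every box its volume is \<open>lborel\<close>, so only
  preimages of boxes matter. Such a preimage is the image of the box under the inverse isometry,
  which preserves Lebesgue measure.\<close>

lemma distr_lborel_orthogonal_transformation:
  fixes T :: "real^2 \<Rightarrow> real^2"
  assumes T: "orthogonal_transformation T"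
  shows "distr lborel borel T = lborel"
proof (rule sym, rule lborel_eqI)
  fix l u :: "real^2"
  assume le: "\<And>b. b \<in> Basis \<Longrightarrow> l \<bullet> b \<le> u \<bullet> b"
  have inv: "orthogonal_transformation (inv T)"
    using T by (rule orthogonal_transformation_inv)
  have vim: "T -` box l u = inv T ` box l u"
    using orthogonal_transformation_bij[OF T] by (rule bij_vimage_eq_inv_image)
  have m[measurable]: "T \<in> borel_measurable borel"
    using T by (intro borel_measurable_continuous_onI linear_continuous_on)
      (auto simp: orthogonal_transformation_linear linear_conv_bounded_linear[symmetric])
  have box: "box l u \<in> lmeasurable" by (rule lmeasurable_box)
  have "emeasure (distr lborel borel T) (box l u) = emeasure lborel (inv T ` box l u)"
    by (subst emeasure_distr) (auto simp: vim)
  also have "\<dots> = emeasure lebesgue (inv T ` box l u)"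
  proof -
    have "T -` box l u \<in> sets borel" using m by (rule measurable_sets_borel) auto
    then show ?thesis by (simp add: vim)
  qed
  also have "\<dots> = measure lebesgue (box l u)"
    using measurable_orthogonal_image[OF inv box] measure_orthogonal_image[OF inv box]
    by (metis emeasure_eq_measure2)
  also have "\<dots> = emeasure lborel (box l u)"
    using emeasure_eq_measure2[OF box] by simp
  finally show "emeasure (distr lborel borel T) (box l u) = (\<Prod>b\<in>Basis. (u - l) \<bullet> b)"
    using le by simp
qed simp

text \<open>Fubini's theorem is used on \<open>real \<times> real\<close>, while the domain lives in
  \<open>real^2\<close>; this identifies the two Lebesgue measures.\<close>

lemma distr_lborel_axis:
  "distr (lborel :: (real \<times> real) measure) borel (\<lambda>(x, y). x *\<^sub>R axis 1 1 + y *\<^sub>R axis 2 1 :: real^2) = lborel"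
proof (rule sym, rule lborel_eqI)
  fix l u :: "real^2"
  assume le: "\<And>b. b \<in> Basis \<Longrightarrow> l \<bullet> b \<le> u \<bullet> b"
  have m[measurable]: "(\<lambda>(x, y). x *\<^sub>R axis 1 1 + y *\<^sub>R axis 2 1 :: real^2) \<in> borel_measurable borel"
    unfolding case_prod_beta by (intro borel_measurable_continuous_onI continuous_intros)
  have vim: "(\<lambda>(x, y). x *\<^sub>R axis 1 1 + y *\<^sub>R axis 2 1 :: real^2) -` box l u = box (l $ 1, l $ 2) (u $ 1, u $ 2)"
    by (auto simp: mem_box_cart forall_2 box_prod axis_def)
  have B: "(Basis :: (real^2) set) = {axis 1 1, axis 2 1}"
    by (auto simp: Basis_vec_def UNIV_2)
  have ne: "axis 1 1 \<noteq> (axis 2 1 :: real^2)" by (simp add: axis_eq_axis)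
  have c: "l $ 1 \<le> u $ 1" "l $ 2 \<le> u $ 2"
    using le[of "axis 1 1"] le[of "axis 2 1"] by (auto simp: B inner_axis)
  have "emeasure (distr lborel borel (\<lambda>(x, y). x *\<^sub>R axis 1 1 + y *\<^sub>R axis 2 1 :: real^2)) (box l u) =
     emeasure (lborel :: (real \<times> real) measure) (box (l $ 1, l $ 2) (u $ 1, u $ 2))"
    by (subst emeasure_distr) (auto simp: vim)
  also have "\<dots> = (\<Prod>b\<in>Basis. ((u $ 1, u $ 2) - (l $ 1, l $ 2)) \<bullet> b)"
    using c by (intro emeasure_lborel_box) (auto simp: Basis_prod_def)
  also have "\<dots> = (\<Prod>b\<in>Basis. (u - l) \<bullet> b)"
    by (simp add: B ne inner_axis Basis_prod_def mult.commute)
  finally show "emeasure (distr lborel borel (\<lambda>(x, y). x *\<^sub>R axis 1 1 + y *\<^sub>R axis 2 1 :: real^2)) (box l u)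
     = (\<Prod>b\<in>Basis. (u - l) \<bullet> b)" .
qed simp

text \<open>By Fubini it is enough to look at one vertical line, which the map translates by the
  constant \<open>\<gamma> x\<close>.\<close>

lemma distr_lborel_shear:
  fixes \<gamma> :: "real \<Rightarrow> real"
  assumes [measurable]: "\<gamma> \<in> borel_measurable borel"
  shows "distr lborel borel (\<lambda>(x, s). (x, \<gamma> x + s)) = lborel"
proof (rule measure_eqI)
  fix A :: "(real \<times> real) set"
  assume "A \<in> sets (distr lborel borel (\<lambda>(x, s). (x, \<gamma> x + s)))"
  then have [measurable]: "A \<in> sets borel" by simp
  have A2[measurable]: "A \<in> sets (borel \<Otimes>\<^sub>M borel)"
    using \<open>A \<in> sets borel\<close> unfolding borel_prod .
  have g[measurable]: "(\<lambda>(x, s). (x, \<gamma> x + s)) \<in> borel_measurable (borel :: (real \<times> real) measure)"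
    by (simp add: borel_prod[symmetric])
  have "emeasure (distr lborel borel (\<lambda>(x, s). (x, \<gamma> x + s))) A
     = (\<integral>\<^sup>+p. indicator A p \<partial>distr lborel borel (\<lambda>(x, s). (x, \<gamma> x + s)))"
    by simp
  also have "\<dots> = (\<integral>\<^sup>+p. indicator A (case p of (x, s) \<Rightarrow> (x, \<gamma> x + s)) \<partial>lborel)"
    by (subst nn_integral_distr) auto
  also have "\<dots> = (\<integral>\<^sup>+x. (\<integral>\<^sup>+s. indicator A (x, \<gamma> x + s) \<partial>lborel) \<partial>lborel)"
    unfolding lborel_prod[symmetric]
    by (subst lborel.nn_integral_fst[symmetric]) (auto simp: borel_prod)
  also have "\<dots> = (\<integral>\<^sup>+x. (\<integral>\<^sup>+s. indicator A (x, s) \<partial>lborel) \<partial>lborel)"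
  proof (rule nn_integral_cong)
    fix x
    have [measurable]: "(\<lambda>s. indicator A (x, s) :: ennreal) \<in> borel_measurable borel"
      by (simp add: borel_prod[symmetric])
    show "(\<integral>\<^sup>+s. indicator A (x, \<gamma> x + s) \<partial>lborel) = (\<integral>\<^sup>+s. indicator A (x, s) \<partial>(lborel :: real measure))"
      using nn_integral_real_affine[of "\<lambda>s. indicator A (x, s)" 1 "\<gamma> x"] by simp
  qed
  also have "\<dots> = (\<integral>\<^sup>+p. indicator A p \<partial>lborel)"
    unfolding lborel_prod[symmetric] by (rule lborel.nn_integral_fst) simp
  finally show "emeasure (distr lborel borel (\<lambda>(x, s). (x, \<gamma> x + s))) A = emeasure lborel A"
    by simp
qed simp

text \<open>The map is a shear, followed by the identification of pairs with vectors and by the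
  isometry taking the axes to B1 and B2. Each factor preserves Lebesgue measure, so no Jacobian has
  to be computed.\<close>

lemma distr_lborel_graph_coordinates:
  fixes \<gamma> :: "real \<Rightarrow> real" and B1 B2 :: "real^2"
  assumes \<gamma>: "\<gamma> \<in> borel_measurable borel"
    and B: "norm B1 = 1" "norm B2 = 1" "B1 \<bullet> B2 = 0"
  shows "distr lborel borel (\<lambda>(x, s). x *\<^sub>R B1 + (\<gamma> x + s) *\<^sub>R B2) = lborel"
proof -
  define T where "T v = v $ 1 *\<^sub>R B1 + v $ 2 *\<^sub>R B2" for v :: "real^2"
  have n: "B1 \<bullet> B1 = 1" "B2 \<bullet> B2 = 1"
    using B(1,2) by (simp_all add: norm_eq_1)
  have "linear T"
    by (rule linearI) (auto simp: T_def algebra_simps)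
  then have T: "orthogonal_transformation T"
    using n B(3) unfolding orthogonal_transformation_def
    by (simp add: T_def inner_add_left inner_add_right inner_commute[of B2 B1])
       (simp add: inner_vec_def sum_2)
  have [measurable]: "T \<in> borel_measurable borel"
    using T by (intro borel_measurable_continuous_onI linear_continuous_on)
      (auto simp: orthogonal_transformation_linear linear_conv_bounded_linear[symmetric])
  have [measurable]: "(\<lambda>(x, y). x *\<^sub>R axis 1 1 + y *\<^sub>R axis 2 1 :: real^2) \<in> borel_measurable borel"
    unfolding case_prod_beta by (intro borel_measurable_continuous_onI continuous_intros)
  have [measurable]: "(\<lambda>(x, s). (x, \<gamma> x + s)) \<in> borel_measurable (borel :: (real \<times> real) measure)"
    using \<gamma> by (simp add: borel_prod[symmetric])
  have "lborel = distr (distr (distr lborel borel (\<lambda>(x, s). (x, \<gamma> x + s))) borel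
      (\<lambda>(x, y). x *\<^sub>R axis 1 1 + y *\<^sub>R axis 2 1 :: real^2)) borel T"
    by (simp only: distr_lborel_shear[OF \<gamma>] distr_lborel_axis distr_lborel_orthogonal_transformation[OF T])
  also have "\<dots> = distr lborel borel (\<lambda>(x, s). x *\<^sub>R B1 + (\<gamma> x + s) *\<^sub>R B2)"
    by (subst distr_distr, simp, simp, subst distr_distr, simp, simp)
       (auto intro!: distr_cong simp: T_def axis_def)
  finally show ?thesis ..
qed

section \<open>C1 functions above a graph and the arc-length measure\<close>

text \<open>The gradient is carried along as an explicit function, so that the rules of calculus
  compute it and its continuity at once. Everything is defined on the whole space, as the
  approximating functions in \<open>is_trace\<close> are.\<close>

definition C1_grad :: "('a::euclidean_space \<Rightarrow> real) \<Rightarrow> ('a \<Rightarrow> 'a) \<Rightarrow> bool" where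
  "C1_grad f G \<longleftrightarrow> (\<forall>x. (f has_derivative (\<lambda>h. G x \<bullet> h)) (at x)) \<and> continuous_on UNIV G"

lemma C1_gradD: "C1_grad f G \<Longrightarrow> (f has_derivative (\<lambda>h. G x \<bullet> h)) (at x)"
  by (simp add: C1_grad_def)

lemma C1_grad_continuous_on: "C1_grad f G \<Longrightarrow> continuous_on A f"
  by (meson C1_gradD continuous_at_imp_continuous_on has_derivative_continuous)

text \<open>The complement of the closed ball is open, so f is locally zero there. On the bounding
  sphere itself nothing is claimed, which is why closed balls are used below whenever the gradient
  is involved.\<close>

lemma C1_grad_zero_outside:
  assumes f: "C1_grad f G" and z: "\<And>x. x \<notin> ball q \<delta> \<Longrightarrow> f x = 0" and x: "x \<notin> cball q \<delta>"
  shows "G x = 0"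
proof -
  have "((\<lambda>x. 0) has_derivative (\<lambda>h. G x \<bullet> h)) (at x)"
    by (rule has_derivative_transform_within_open[OF C1_gradD[OF f], of "- cball q \<delta>"])
       (use x z in \<open>auto simp: open_Compl\<close>)
  then have "(\<lambda>h. G x \<bullet> h) = (\<lambda>h. 0)"
    using has_derivative_unique has_derivative_const by blast
  then show ?thesis by (metis inner_eq_zero_iff)
qed

text \<open>In coordinates (x, s), with s the height above the graph, e . G is (e . B1) times the
  x-derivative of f plus (e . B2 - (e . B1) \<gamma>') times its s-derivative. The first part
  integrates to zero along horizontal lines by compact support; the second, integrated over s > 0,
  leaves minus the value of f on the graph.\<close>

lemma divergence_above_graph:
  fixes f :: "real^2 \<Rightarrow> real" and \<gamma> \<gamma>' :: "real \<Rightarrow> real"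
  assumes f: "C1_grad f G"
    and B: "norm B1 = 1" "norm B2 = 1" "B1 \<bullet> B2 = 0"
    and \<gamma>: "\<And>x. (\<gamma> has_real_derivative \<gamma>' x) (at x)" and \<gamma>': "continuous_on UNIV \<gamma>'"
    and z: "\<And>x. x \<notin> ball q \<delta> \<Longrightarrow> f x = 0"
  shows "(\<integral>x. indicator {x. \<gamma> (B1 \<bullet> x) < B2 \<bullet> x} x * (e \<bullet> G x) \<partial>lborel)
     = (\<integral>x. ((e \<bullet> B1) * \<gamma>' x - e \<bullet> B2) * f (x *\<^sub>R B1 + \<gamma> x *\<^sub>R B2) \<partial>lborel)"
proof -
  define P where "P = (\<lambda>(x, s). x *\<^sub>R B1 + (\<gamma> x + s) *\<^sub>R B2)"
  define a where "a = (\<lambda>(x, s). G (P (x, s)) \<bullet> (B1 + \<gamma>' x *\<^sub>R B2))"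
  define b where "b = (\<lambda>(x, s). G (P (x, s)) \<bullet> B2)"
  define I where "I = (\<lambda>s::real. if 0 < s then 1 else 0 :: real)"
  have n: "B1 \<bullet> B1 = 1" "B2 \<bullet> B2 = 1"
    using B(1,2) by (simp_all add: norm_eq_1)
  have \<gamma>c: "continuous_on A \<gamma>" for A
    using \<gamma> by (meson DERIV_isCont continuous_at_imp_continuous_on)
  have [measurable]: "\<gamma> \<in> borel_measurable borel" "\<gamma>' \<in> borel_measurable borel"
    using \<gamma>c \<gamma>' by (auto intro: borel_measurable_continuous_onI)
  have cP: "continuous_on UNIV P"
    unfolding P_def case_prod_beta
    by (intro continuous_intros continuous_on_compose2[OF \<gamma>c[of UNIV]]) auto
  then have [measurable]: "P \<in> borel_measurable borel"
    by (rule borel_measurable_continuous_onI)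
  have cG: "continuous_on UNIV G" using f by (simp add: C1_grad_def)
  then have [measurable]: "G \<in> borel_measurable borel"
    by (rule borel_measurable_continuous_onI)
  have cGP: "continuous_on UNIV (\<lambda>p. G (P p))"
    using cG cP by (rule continuous_on_compose2) auto
  have ca: "continuous_on UNIV a" unfolding a_def case_prod_beta
    using cGP by (intro continuous_intros continuous_on_compose2[OF \<gamma>']) auto
  have cb: "continuous_on UNIV b" unfolding b_def case_prod_beta
    using cGP by (intro continuous_intros) auto
  define N where "N = norm q + \<bar>\<delta>\<bar>"
  have out: "f x = 0 \<and> G x = 0" if "N < norm x" for x
  proof -
    have "norm q + \<bar>\<delta>\<bar> < norm x" using that by (simp add: N_def)
    moreover have "norm x \<le> norm q + dist q x"
      by (metis dist_0_norm dist_triangle)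
    ultimately have "\<bar>\<delta>\<bar> < dist q x" by linarith
    then have "x \<notin> cball q \<delta>" by auto
    then show ?thesis using C1_grad_zero_outside[OF f z] z[of x] by auto
  qed
  have "compact (\<gamma> ` {-N..N})" by (intro compact_continuous_image \<gamma>c) auto
  then obtain m where m: "\<And>x. x \<in> {-N..N} \<Longrightarrow> \<bar>\<gamma> x\<bar> \<le> m"
    by (metis bounded_real compact_imp_bounded imageI)
  \<comment> \<open>N bounds the support of f in the plane and m bounds \<gamma> over [-N, N]. If a
    coordinate x or s has absolute value at least R, the corresponding point has norm above N; the 1
    makes this strict and R positive.\<close>
  define R where "R = N + \<bar>m\<bar> + 1"
  have R: "0 < R" by (simp add: R_def N_def add_nonneg_pos)
  have big: "N < norm (P (x, s))" if "R \<le> \<bar>x\<bar> \<or> R \<le> \<bar>s\<bar>" for x s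
  proof -
    have 1: "\<bar>x\<bar> \<le> norm (P (x, s))"
      using Cauchy_Schwarz_ineq2[of B1 "P (x, s)"] n B by (simp add: P_def inner_add_right)
    have 2: "\<bar>\<gamma> x + s\<bar> \<le> norm (P (x, s))"
      using Cauchy_Schwarz_ineq2[of B2 "P (x, s)"] n B by (simp add: P_def inner_add_right inner_commute)
    show ?thesis
    proof (cases "x \<in> {-N..N}")
      case True
      then have "R \<le> \<bar>s\<bar>" using that by (auto simp: R_def)
      then show ?thesis using m[OF True] 2 by (auto simp: R_def)
    next
      case False
      then show ?thesis using 1 by auto
    qed
  qed
  have supp: "integrable lborel g" if "continuous_on UNIV g"
    "\<And>x s. R \<le> \<bar>x\<bar> \<or> R \<le> \<bar>s\<bar> \<Longrightarrow> g (x, s) = 0" for g :: "real \<times> real \<Rightarrow> real"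
  proof -
    have "integrable lborel (\<lambda>p. indicator ({-R..R} \<times> {-R..R}) p *\<^sub>R g p)"
      using that(1) by (intro borel_integrable_compact compact_Times) (auto intro: continuous_on_subset)
    moreover have "(\<lambda>p. indicator ({-R..R} \<times> {-R..R}) p *\<^sub>R g p) = g"
    proof (rule ext, clarify)
      fix x s
      show "indicator ({-R..R} \<times> {-R..R}) (x, s) *\<^sub>R g (x, s) = g (x, s)"
        using that(2)[of x s] by (cases "R \<le> \<bar>x\<bar> \<or> R \<le> \<bar>s\<bar>") (auto simp: indicator_def)
    qed
    ultimately show ?thesis by simp
  qed
  have suppI: "integrable (lborel \<Otimes>\<^sub>M lborel) (\<lambda>(x, s). I s * g (x, s))" if "continuous_on UNIV g"
    "\<And>x s. R \<le> \<bar>x\<bar> \<or> R \<le> \<bar>s\<bar> \<Longrightarrow> g (x, s) = 0" for g :: "real \<times> real \<Rightarrow> real"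
  proof -
    have [measurable]: "g \<in> borel_measurable borel" using that(1) by (rule borel_measurable_continuous_onI)
    have [measurable]: "I \<in> borel_measurable borel" by (simp add: I_def)
    have "integrable lborel (\<lambda>(x, s). I s * g (x, s))"
    proof (rule Bochner_Integration.integrable_bound[OF supp[of g]])
      show "(\<lambda>(x, s). I s * g (x, s)) \<in> borel_measurable lborel"
      proof -
        have [measurable]: "snd \<in> borel_measurable (borel :: (real \<times> real) measure)"
          by (intro borel_measurable_continuous_onI continuous_intros)
        have "(\<lambda>p. I (snd p) * g p) \<in> borel_measurable borel" by measurable
        then show ?thesis by (simp add: case_prod_beta')
      qed
    qed (use that in \<open>auto simp: I_def\<close>)
    then show ?thesis by (simp only: lborel_prod)
  qed
  define F where "F x s = f (P (x, s))" for x s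
  have dF1: "((\<lambda>x. F x s) has_real_derivative a (x, s)) (at x)" for x s
  proof -
    have "((\<lambda>x. x *\<^sub>R B1 + (\<gamma> x + s) *\<^sub>R B2) has_derivative
        (\<lambda>h. h *\<^sub>R B1 + (\<gamma>' x * h) *\<^sub>R B2)) (at x)"
      by (auto intro!: derivative_eq_intros \<gamma>[unfolded has_field_derivative_def])
    from has_derivative_compose[OF this C1_gradD[OF f]] show ?thesis
      unfolding F_def a_def P_def has_field_derivative_def case_prod_conv
      by (rule has_derivative_eq_rhs) (simp add: fun_eq_iff algebra_simps)
  qed
  have dF2: "((\<lambda>s. F x s) has_real_derivative b (x, s)) (at s)" for x s
  proof -
    have "((\<lambda>s. x *\<^sub>R B1 + (\<gamma> x + s) *\<^sub>R B2) has_derivative (\<lambda>h. h *\<^sub>R B2)) (at s)"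
      by (auto intro!: derivative_eq_intros)
    from has_derivative_compose[OF this C1_gradD[OF f]] show ?thesis
      unfolding F_def b_def P_def has_field_derivative_def case_prod_conv
      by (rule has_derivative_eq_rhs) (simp add: fun_eq_iff algebra_simps)
  qed
  have F0: "F x s = 0" "a (x, s) = 0" "b (x, s) = 0" if "R \<le> \<bar>x\<bar> \<or> R \<le> \<bar>s\<bar>" for x s
    using out[OF big[OF that]] by (auto simp: F_def a_def b_def)
  have Ia: "(\<integral>x. a (x, s) \<partial>lborel) = 0" for s
  proof -
    have "(\<integral>x. a (x, s) \<partial>lborel) = (\<integral>x. a (x, s) * indicator {-R..R} x \<partial>lborel)"
    proof (rule Bochner_Integration.integral_cong[OF refl])
      fix x show "a (x, s) = a (x, s) * indicator {-R..R} x"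
        using F0(2)[of x s] by (cases "R \<le> \<bar>x\<bar>") (auto simp: indicator_def)
    qed
    also have "\<dots> = F R s - F (-R) s"
      by (rule integral_FTC_Icc_real[OF _ dF1])
         (use R ca in \<open>auto intro!: continuous_on_interior[of UNIV] continuous_on_compose2[OF ca] continuous_intros\<close>)
    finally show ?thesis using F0(1) R by auto
  qed
  have Ib: "(\<integral>s. I s * b (x, s) \<partial>lborel) = - F x 0" for x
  proof -
    have "(\<integral>s. I s * b (x, s) \<partial>lborel) = (\<integral>s. b (x, s) * indicator {0..R} s \<partial>lborel)"
    proof (rule integral_cong_AE)
      \<comment> \<open>\<open>I\<close> is 0 at s = 0, whereas the closed interval contains this
        point; the integrands differ only on a null set.\<close>
      show "AE s in lborel. I s * b (x, s) = b (x, s) * indicator {0..R} s"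
        using AE_lborel_singleton[of 0] by eventually_elim (auto simp: I_def indicator_def F0(3))
      have "(\<lambda>s. b (x, s)) \<in> borel_measurable borel"
        by (auto intro!: borel_measurable_continuous_onI continuous_on_compose2[OF cb] continuous_intros)
      then show "(\<lambda>s. I s * b (x, s)) \<in> borel_measurable lborel"
        "(\<lambda>s. b (x, s) * indicator {0..R} s) \<in> borel_measurable lborel"
        by (simp_all add: I_def)
    qed
    also have "\<dots> = F x R - F x 0"
      by (rule integral_FTC_Icc_real[OF _ dF2])
         (use R in \<open>auto intro!: continuous_on_interior[of UNIV] continuous_on_compose2[OF cb] continuous_intros\<close>)
    finally show ?thesis using F0(1)[of x R] R by auto
  qed
  have iD: "integrable (lborel \<Otimes>\<^sub>M lborel) (\<lambda>(x, s). I s * ((e \<bullet> B2 - (e \<bullet> B1) * \<gamma>' x) * b (x, s)))"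
  proof -
    have "continuous_on UNIV (\<lambda>p. (e \<bullet> B2 - (e \<bullet> B1) * \<gamma>' (fst p)) * b p)"
      using cb by (intro continuous_intros continuous_on_compose2[OF \<gamma>']) auto
    from suppI[OF this] show ?thesis using F0(3) by auto
  qed
  have "(\<integral>x. indicator {x. \<gamma> (B1 \<bullet> x) < B2 \<bullet> x} x * (e \<bullet> G x) \<partial>lborel)
      = (\<integral>x. indicator {x. \<gamma> (B1 \<bullet> x) < B2 \<bullet> x} x * (e \<bullet> G x) \<partial>distr lborel borel P)"
    using distr_lborel_graph_coordinates[of \<gamma>, OF _ B] by (simp add: P_def)
  also have "\<dots> = (\<integral>p. indicator {x. \<gamma> (B1 \<bullet> x) < B2 \<bullet> x} (P p) * (e \<bullet> G (P p)) \<partial>lborel)"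
    by (rule integral_distr) auto
  also have "\<dots> = (\<integral>p. (e \<bullet> B1) * (case p of (x, s) \<Rightarrow> I s * a (x, s))
       + (case p of (x, s) \<Rightarrow> I s * ((e \<bullet> B2 - (e \<bullet> B1) * \<gamma>' x) * b (x, s))) \<partial>lborel)"
  proof (rule Bochner_Integration.integral_cong[OF refl], clarify)
    fix x s
    have "indicator {x. \<gamma> (B1 \<bullet> x) < B2 \<bullet> x} (P (x, s)) = I s"
      using n B(3) by (simp add: I_def P_def indicator_def inner_add_right inner_commute)
    \<comment> \<open>Both a and b contain the B2 component of the gradient, since the x-lines of
      the graph coordinates are tilted; the correction by \<gamma>' in the coefficient of b
      compensates for this.\<close>
    moreover have "e \<bullet> G (P (x, s)) = (e \<bullet> B1) * a (x, s) + (e \<bullet> B2 - (e \<bullet> B1) * \<gamma>' x) * b (x, s)"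
      by (subst real2_orthonormal_expand[OF B, of e])
         (simp add: a_def b_def algebra_simps inner_commute)
    ultimately show "indicator {x. \<gamma> (B1 \<bullet> x) < B2 \<bullet> x} (P (x, s)) * (e \<bullet> G (P (x, s)))
      = (e \<bullet> B1) * (I s * a (x, s)) + I s * ((e \<bullet> B2 - (e \<bullet> B1) * \<gamma>' x) * b (x, s))"
      by (simp only: distrib_left mult.left_commute)
  qed
  also have "\<dots> = (e \<bullet> B1) * (\<integral>p. (case p of (x, s) \<Rightarrow> I s * a (x, s)) \<partial>(lborel \<Otimes>\<^sub>M lborel))
     + (\<integral>p. (case p of (x, s) \<Rightarrow> I s * ((e \<bullet> B2 - (e \<bullet> B1) * \<gamma>' x) * b (x, s))) \<partial>(lborel \<Otimes>\<^sub>M lborel))"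
    unfolding lborel_prod
    by (subst Bochner_Integration.integral_add)
       (use suppI[OF ca F0(2)] iD in \<open>auto simp: lborel_prod\<close>)
  also have "(\<integral>p. (case p of (x, s) \<Rightarrow> I s * a (x, s)) \<partial>(lborel \<Otimes>\<^sub>M lborel))
     = (\<integral>s. (\<integral>x. I s * a (x, s) \<partial>lborel) \<partial>lborel)"
    by (rule lborel_pair.integral_snd[symmetric]) (use suppI[OF ca F0(2)] in auto)
  also have "\<dots> = 0" by (simp add: Ia)
  also have "(\<integral>p. (case p of (x, s) \<Rightarrow> I s * ((e \<bullet> B2 - (e \<bullet> B1) * \<gamma>' x) * b (x, s))) \<partial>(lborel \<Otimes>\<^sub>M lborel))
     = (\<integral>x. (\<integral>s. I s * ((e \<bullet> B2 - (e \<bullet> B1) * \<gamma>' x) * b (x, s)) \<partial>lborel) \<partial>lborel)"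
    by (rule lborel_pair.integral_fst[symmetric]) (rule iD)
  also have "\<dots> = (\<integral>x. ((e \<bullet> B1) * \<gamma>' x - e \<bullet> B2) * f (x *\<^sub>R B1 + \<gamma> x *\<^sub>R B2) \<partial>lborel)"
  proof (rule Bochner_Integration.integral_cong[OF refl])
    fix x
    have "(\<integral>s. I s * ((e \<bullet> B2 - (e \<bullet> B1) * \<gamma>' x) * b (x, s)) \<partial>lborel)
      = (\<integral>s. (e \<bullet> B2 - (e \<bullet> B1) * \<gamma>' x) * (I s * b (x, s)) \<partial>lborel)"
      by (simp add: mult_ac)
    also have "\<dots> = (e \<bullet> B2 - (e \<bullet> B1) * \<gamma>' x) * - F x 0"
      by (simp only: integral_mult_right_zero Ib)
    finally show "(\<integral>s. I s * ((e \<bullet> B2 - (e \<bullet> B1) * \<gamma>' x) * b (x, s)) \<partial>lborel)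
      = ((e \<bullet> B1) * \<gamma>' x - e \<bullet> B2) * f (x *\<^sub>R B1 + \<gamma> x *\<^sub>R B2)"
      by (simp add: F_def P_def algebra_simps)
  qed
  finally show ?thesis by simp
qed

text \<open>Connects the axiomatic measure with the line integral that results from Fubini:
  \<open>arclength_measure\<close> speaks of arcs only, and this extends it to Borel integrands.
  Extended nonnegative integrals spare any integrability condition at a stage where finiteness of
  the measure is not yet known.\<close>

lemma nn_integral_arclength_graph:
  fixes \<gamma> \<gamma>' :: "real \<Rightarrow> real"
  assumes \<Gamma>: "arclength_measure S \<Gamma>"
    and B: "norm B1 = 1" "norm B2 = 1" "B1 \<bullet> B2 = 0"
    and \<gamma>: "\<And>x. (\<gamma> has_real_derivative \<gamma>' x) (at x)" and \<gamma>': "continuous_on UNIV \<gamma>'"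
    and S: "\<And>x. x \<in> {a..b} \<Longrightarrow> x *\<^sub>R B1 + \<gamma> x *\<^sub>R B2 \<in> S"
    and h[measurable]: "h \<in> borel_measurable borel"
  shows "(\<integral>\<^sup>+p. h p * indicator ((\<lambda>x. x *\<^sub>R B1 + \<gamma> x *\<^sub>R B2) ` {a..b}) p \<partial>\<Gamma>)
     = (\<integral>\<^sup>+x. h (x *\<^sub>R B1 + \<gamma> x *\<^sub>R B2) * ennreal (norm (B1 + \<gamma>' x *\<^sub>R B2)) * indicator {a..b} x \<partial>lborel)"
proof -
  define c where "c x = x *\<^sub>R B1 + \<gamma> x *\<^sub>R B2" for x
  define k where "k x = norm (B1 + \<gamma>' x *\<^sub>R B2)" for x
  have n: "B1 \<bullet> B1 = 1" "B2 \<bullet> B2 = 1"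
    using B(1,2) by (simp_all add: norm_eq_1)
  have \<gamma>c: "continuous_on A \<gamma>" for A
    using \<gamma> by (meson DERIV_isCont continuous_at_imp_continuous_on)
  have inv: "B1 \<bullet> c x = x" for x
    using n B by (simp add: c_def inner_add_right)
  have dc: "(c has_vector_derivative (B1 + \<gamma>' x *\<^sub>R B2)) (at x)" for x
    unfolding c_def by (auto intro!: derivative_eq_intros \<gamma>[unfolded has_real_derivative_iff_has_vector_derivative] \<gamma>)
  have cc: "continuous_on A c" for A
    unfolding c_def by (intro continuous_intros \<gamma>c)
  have ck: "continuous_on A k" for A
    unfolding k_def by (intro continuous_intros continuous_on_subset[OF \<gamma>']) auto
  have [measurable]: "c \<in> borel_measurable borel" "k \<in> borel_measurable borel"
    using cc ck by (auto intro: borel_measurable_continuous_onI)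
  have C1: "c C1_differentiable_on A" for A
    unfolding C1_differentiable_on_def
    by (intro exI[of _ "\<lambda>x. B1 + \<gamma>' x *\<^sub>R B2"] conjI ballI dc continuous_intros continuous_on_subset[OF \<gamma>']) auto
  have inj: "inj_on c A" for A
    by (metis inj_onI inv)
  have sets\<Gamma>[measurable_cong]: "sets \<Gamma> = sets borel" using \<Gamma> by (simp add: arclength_measure_def)
  have cS: "c ` {a..b} \<subseteq> S" using S by (auto simp: c_def)
  have arc: "emeasure \<Gamma> (c ` {u..v}) = (\<integral>\<^sup>+x. ennreal (k x) * indicator {u..v} x \<partial>lborel)"
    if "{u..v} \<subseteq> {a..b}" for u v
  proof -
    have "emeasure \<Gamma> (c ` {u..v}) = ennreal (integral {u..v} (\<lambda>t. norm (vector_derivative c (at t))))"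
      using \<Gamma> C1[of "{u..v}"] inj[of "{u..v}"] cS that unfolding arclength_measure_def by blast
    also have "(\<lambda>t. norm (vector_derivative c (at t))) = k"
      using vector_derivative_at[OF dc] by (simp add: k_def fun_eq_iff)
    also have "ennreal (integral {u..v} k) = (\<integral>\<^sup>+x. ennreal (indicator {u..v} x * k x) \<partial>lborel)"
    proof -
      have "(k has_integral integral {u..v} k) {u..v}"
        by (intro integrable_integral integrable_continuous_interval ck)
      then have "((\<lambda>x. indicator {u..v} x * k x) has_integral integral {u..v} k) UNIV"
        using has_integral_restrict_UNIV[of "{u..v}" k]
        by (simp add: indicator_def of_bool_def if_distrib if_distribR cong: if_cong)
      then show ?thesis
        by (intro nn_integral_has_integral_lborel[symmetric]) (simp_all, simp add: k_def)
    qed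
    also have "\<dots> = (\<integral>\<^sup>+x. ennreal (k x) * indicator {u..v} x \<partial>lborel)"
      by (intro nn_integral_cong) (auto simp: indicator_def)
    finally show ?thesis .
  qed
  have K: "c ` {a..b} \<in> sets borel"
    by (intro borel_compact compact_continuous_image cc) auto
  define M1 where "M1 = distr (density \<Gamma> (indicator (c ` {a..b}))) borel (\<lambda>p. B1 \<bullet> p)"
  define M2 where "M2 = density lborel (\<lambda>x. ennreal (k x) * indicator {a..b} x)"
  have vB1: "(\<lambda>p. B1 \<bullet> p) -` A \<in> sets borel" if "A \<in> sets borel" for A :: "real set"
    using that by (intro measurable_sets_borel[of _ borel]) auto
  have M1e: "emeasure M1 A = (\<integral>\<^sup>+p. indicator (c ` (A \<inter> {a..b})) p \<partial>\<Gamma>)" if [measurable]: "A \<in> sets borel" for A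
  proof -
    have "emeasure M1 A = (\<integral>\<^sup>+p. indicator (c ` {a..b}) p * indicator ((\<lambda>p. B1 \<bullet> p) -` A) p \<partial>\<Gamma>)"
      unfolding M1_def using K
      by (subst emeasure_distr, simp, simp, subst emeasure_density)
         (auto simp: space_borel sets_eq_imp_space_eq[OF sets\<Gamma>] sets\<Gamma> vB1)
    also have "\<dots> = (\<integral>\<^sup>+p. indicator (c ` (A \<inter> {a..b})) p \<partial>\<Gamma>)"
      by (intro nn_integral_cong) (auto simp: indicator_def inv)
    finally show ?thesis .
  qed
  \<comment> \<open>The projection onto B1 inverts the parametrisation of the graph, so arc length becomes a measure on
    the line, which is determined by closed intervals.\<close>
  have "M1 = M2"
  proof (rule measure_eqI_generator_eq[where E = "range (\<lambda>(u, v). {u..v})" and \<Omega> = UNIV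
        and A = "\<lambda>n::nat. {- real n..real n}"])
    show "Int_stable (range (\<lambda>(u, v). {u..v::real}))"
      by (auto simp: Int_stable_def image_iff)
    have e: "emeasure M1 {u..v} = (\<integral>\<^sup>+x. ennreal (k x) * indicator {max u a..min v b} x \<partial>lborel)" for u v
    proof -
      have i: "{u..v} \<inter> {a..b} = {max u a..min v b}" by auto
      have "c ` {max u a..min v b} \<in> sets borel"
        by (intro borel_compact compact_continuous_image cc) auto
      then have "emeasure M1 {u..v} = emeasure \<Gamma> (c ` {max u a..min v b})"
        by (subst M1e) (auto simp: i)
      then show ?thesis by (subst (asm) arc) auto
    qed
    fix X :: "real set" assume "X \<in> range (\<lambda>(u, v). {u..v})"
    then obtain u v where X: "X = {u..v}" by auto
    have "emeasure M2 X = (\<integral>\<^sup>+x. ennreal (k x) * indicator {max u a..min v b} x \<partial>lborel)"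
      unfolding M2_def X
      by (subst emeasure_density) (auto intro!: nn_integral_cong simp: indicator_def)
    then show "emeasure M1 X = emeasure M2 X" by (simp add: X e)
  next
    have "sigma_sets UNIV (range (\<lambda>(u, v). {u..v::real})) = sets borel"
      by (simp add: borel_eq_atLeastAtMost)
    then show "sets M1 = sigma_sets UNIV (range (\<lambda>(u, v). {u..v}))"
      "sets M2 = sigma_sets UNIV (range (\<lambda>(u, v). {u..v}))"
      by (simp_all add: M1_def M2_def)
    fix i :: nat
    have "emeasure M1 {- real i..real i} \<le> (\<integral>\<^sup>+p. indicator (c ` {a..b}) p \<partial>\<Gamma>)"
      by (subst M1e) (auto intro!: nn_integral_mono simp: indicator_def)
    also have "\<dots> = emeasure \<Gamma> (c ` {a..b})" using K by simp
    also have "\<dots> < \<infinity>"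
      using \<Gamma> C1[of "{a..b}"] inj[of "{a..b}"] cS unfolding arclength_measure_def
      by (metis ennreal_less_top infinity_ennreal_def)
    finally show "emeasure M1 {- real i..real i} \<noteq> \<infinity>" by simp
    show "range (\<lambda>i::nat. {- real i..real i}) \<subseteq> range (\<lambda>(u, v). {u..v})" by auto
    show "(\<Union>i::nat. {- real i..real i}) = UNIV"
    proof -
      have "\<exists>i::nat. x \<in> {- real i..real i}" for x
        using real_arch_simple[of "\<bar>x\<bar>"] by (auto simp: abs_le_iff minus_le_iff)
      then show ?thesis by blast
    qed
  qed simp
  have "(\<integral>\<^sup>+p. h p * indicator (c ` {a..b}) p \<partial>\<Gamma>) = (\<integral>\<^sup>+p. indicator (c ` {a..b}) p * h (c (B1 \<bullet> p)) \<partial>\<Gamma>)"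
    by (intro nn_integral_cong) (auto simp: indicator_def inv)
  also have "\<dots> = (\<integral>\<^sup>+x. h (c x) \<partial>M1)"
    unfolding M1_def using K
    by (subst nn_integral_distr, simp, simp, subst nn_integral_density) auto
  also have "\<dots> = (\<integral>\<^sup>+x. ennreal (k x) * indicator {a..b} x * h (c x) \<partial>lborel)"
    unfolding \<open>M1 = M2\<close> M2_def by (subst nn_integral_density) auto
  finally show ?thesis unfolding c_def k_def by (simp add: mult_ac)
qed

section \<open>Calculus of C1 functions and cutoffs\<close>

lemma C1_grad_const: "C1_grad (\<lambda>x. c) (\<lambda>x. 0)"
  by (simp add: C1_grad_def)

lemma C1_grad_add:
  assumes "C1_grad f F" "C1_grad g G"
  shows "C1_grad (\<lambda>x. f x + g x) (\<lambda>x. F x + G x)"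
  using assms unfolding C1_grad_def
  by (auto intro!: continuous_intros derivative_eq_intros simp: algebra_simps)

lemma C1_grad_sum:
  assumes "\<And>i. i \<in> I \<Longrightarrow> C1_grad (f i) (F i)"
  shows "C1_grad (\<lambda>x. \<Sum>i\<in>I. f i x) (\<lambda>x. \<Sum>i\<in>I. F i x)"
  using assms by (induction I rule: infinite_finite_induct) (auto intro: C1_grad_const C1_grad_add)

lemma C1_grad_mult:
  assumes f: "C1_grad f F" and g: "C1_grad g G"
  shows "C1_grad (\<lambda>x. f x * g x) (\<lambda>x. f x *\<^sub>R G x + g x *\<^sub>R F x)"
proof -
  have "((\<lambda>x. f x * g x) has_derivative (\<lambda>h. (f x *\<^sub>R G x + g x *\<^sub>R F x) \<bullet> h)) (at x)" for x
    by (rule has_derivative_eq_rhs[OF has_derivative_mult[OF C1_gradD[OF f] C1_gradD[OF g]]])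
       (simp add: fun_eq_iff algebra_simps)
  then show ?thesis
    using f g C1_grad_continuous_on[OF f] C1_grad_continuous_on[OF g]
    by (auto simp: C1_grad_def intro!: continuous_intros)
qed

text \<open>Continuity of p' is asked on the range of f only, so that the rule covers the reciprocal
  of a positive function.\<close>

lemma C1_grad_compose:
  assumes f: "C1_grad f G" and p: "\<And>x. (p has_real_derivative p' (f x)) (at (f x))"
    and p': "continuous_on (range f) p'"
  shows "C1_grad (\<lambda>x. p (f x)) (\<lambda>x. p' (f x) *\<^sub>R G x)"
proof -
  have "((\<lambda>x. p (f x)) has_derivative (\<lambda>h. (p' (f x) *\<^sub>R G x) \<bullet> h)) (at x)" for x
    by (rule has_derivative_eq_rhs[OF has_derivative_compose[OF C1_gradD[OF f] p[unfolded has_field_derivative_def]]])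
       (simp add: fun_eq_iff)
  moreover have "continuous_on UNIV (\<lambda>x. p' (f x))"
    using p' C1_grad_continuous_on[OF f] by (rule continuous_on_compose2) auto
  ultimately show ?thesis
    using f by (auto simp: C1_grad_def intro!: continuous_intros)
qed

text \<open>The square of the positive part is a C1 cutoff with an elementary derivative. It
  produces both the bump functions and the positive denominator of the partition of unity; C1
  regularity is all that the divergence formula asks for.\<close>

lemma has_real_derivative_max_0_squared:
  "((\<lambda>s::real. (max 0 s)\<^sup>2) has_real_derivative 2 * max 0 s) (at s)"
proof (cases s "0::real" rule: linorder_cases)
  case less
  have "((\<lambda>s. 0) has_real_derivative 0) (at s)" by simp
  then have "((\<lambda>s::real. (max 0 s)\<^sup>2) has_real_derivative 0) (at s)"
    by (rule has_field_derivative_transform_within_open[of _ _ _ "{..<0}"]) (use less in auto)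
  then show ?thesis using less by simp
next
  case equal
  \<comment> \<open>At the junction the difference quotient is h for h > 0 and 0 for h < 0, hence
    bounded by |h|.\<close>
  have "((\<lambda>h. ((max 0 (0 + h))\<^sup>2 - (max 0 0)\<^sup>2) / h) \<longlongrightarrow> (0::real)) (at 0)"
  proof (rule tendsto_rabs_zero_cancel, rule tendsto_sandwich[of "\<lambda>_. 0" _ _ "\<lambda>h. \<bar>h\<bar>"])
    show "\<forall>\<^sub>F h::real in at 0. \<bar>((max 0 (0 + h))\<^sup>2 - (max 0 0)\<^sup>2) / h\<bar> \<le> \<bar>h\<bar>"
      by (rule eventuallyI) (auto simp: max_def power2_eq_square)
    show "((\<lambda>h. \<bar>h\<bar>) \<longlongrightarrow> (0::real)) (at 0)"
      by (auto intro!: tendsto_eq_intros)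
  qed auto
  then show ?thesis using equal by (simp add: DERIV_def)
next
  case greater
  have "((\<lambda>s. s\<^sup>2) has_real_derivative 2 * s) (at s)" by (auto intro!: derivative_eq_intros)
  then have "((\<lambda>s::real. (max 0 s)\<^sup>2) has_real_derivative 2 * s) (at s)"
    by (rule has_field_derivative_transform_within_open[of _ _ _ "{0<..}"]) (use greater in auto)
  then show ?thesis using greater by simp
qed

lemma C1_grad_bump:
  "C1_grad (\<lambda>x. (max 0 (r\<^sup>2 - (norm (x - q))\<^sup>2))\<^sup>2)
     (\<lambda>x. (2 * max 0 (r\<^sup>2 - (norm (x - q))\<^sup>2)) *\<^sub>R (- 2 *\<^sub>R (x - q)))"
proof (rule C1_grad_compose[where p = "\<lambda>s. (max 0 s)\<^sup>2" and p' = "\<lambda>s. 2 * max 0 s"])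
  have "((\<lambda>x. r\<^sup>2 - (norm (x - q))\<^sup>2) has_derivative (\<lambda>h. (- 2 *\<^sub>R (x - q)) \<bullet> h)) (at x)" for x
    unfolding power2_norm_eq_inner
    by (auto intro!: derivative_eq_intros simp: inner_commute algebra_simps)
  then show "C1_grad (\<lambda>x. r\<^sup>2 - (norm (x - q))\<^sup>2) (\<lambda>x. - 2 *\<^sub>R (x - q))"
    by (auto simp: C1_grad_def intro!: continuous_intros)
qed (auto intro: has_real_derivative_max_0_squared intro!: continuous_intros)

text \<open>In \<open>smooth\<close> the empty list of directions gives differentiability of the
  function, and a one-element list gives differentiability, hence continuity, of its
  derivative.\<close>

lemma smooth_has_real_derivative:
  assumes "smooth (\<gamma> :: real \<Rightarrow> real)"
  obtains \<gamma>' where "\<And>x. (\<gamma> has_real_derivative \<gamma>' x) (at x)" "continuous_on UNIV \<gamma>'"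
proof
  have "foldr pd [] \<gamma> differentiable (at x)" for x
    using assms unfolding smooth_def by (metis empty_subsetI list.set(1))
  then have d: "\<gamma> differentiable (at x)" for x by simp
  show "(\<gamma> has_real_derivative pd 1 \<gamma> x) (at x)" for x
  proof -
    have "(\<gamma> has_derivative frechet_derivative \<gamma> (at x)) (at x)"
      using d frechet_derivative_works by blast
    moreover from this have "frechet_derivative \<gamma> (at x) = (*) (frechet_derivative \<gamma> (at x) 1)"
      by (metis has_derivative_bounded_linear real_bounded_linear mult.commute mult.left_neutral ext)
    ultimately show ?thesis by (simp add: has_field_derivative_def pd_def)
  qed
  have "foldr pd [1] \<gamma> differentiable (at x)" for x
    using assms unfolding smooth_def by (metis Basis_real_def list.set(1) list.set(2) order_refl)
  then show "continuous_on UNIV (pd 1 \<gamma>)"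
    by (auto intro!: continuous_at_imp_continuous_on differentiable_imp_continuous_within)
qed

lemma smooth_C1_grad:
  assumes "smooth \<phi>"
  shows "C1_grad \<phi> (grad \<phi>)"
  unfolding C1_grad_def
proof (intro conjI allI)
  fix x
  have "foldr pd [] \<phi> differentiable (at x)"
    using assms unfolding smooth_def by (metis empty_subsetI list.set(1))
  then have D: "(\<phi> has_derivative frechet_derivative \<phi> (at x)) (at x)"
    by (simp add: frechet_derivative_works)
  then have lin: "linear (frechet_derivative \<phi> (at x))"
    by (rule has_derivative_linear)
  have "frechet_derivative \<phi> (at x) h = grad \<phi> x \<bullet> h" for h
  proof -
    have "h = h $ 1 *\<^sub>R axis 1 1 + h $ 2 *\<^sub>R axis 2 1"
      by (simp add: vec_eq_iff forall_2 axis_def)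
    then have "frechet_derivative \<phi> (at x) h = frechet_derivative \<phi> (at x) (h $ 1 *\<^sub>R axis 1 1 + h $ 2 *\<^sub>R axis 2 1)"
      by simp
    then show ?thesis
      by (simp add: linear_add[OF lin] linear_scale[OF lin] grad_def pd_def inner_vec_def sum_2)
  qed
  then have "frechet_derivative \<phi> (at x) = (\<lambda>h. grad \<phi> x \<bullet> h)" by (rule ext)
  then show "(\<phi> has_derivative (\<lambda>h. grad \<phi> x \<bullet> h)) (at x)" using D by simp
next
  have "continuous_on UNIV (pd (axis i 1) \<phi>)" for i
  proof -
    have "set [axis i (1::real)] \<subseteq> Basis" by (auto simp: Basis_vec_def)
    then have "foldr pd [axis i 1] \<phi> differentiable (at x)" for x
      using assms unfolding smooth_def by blast
    then show ?thesis
      by (auto intro!: continuous_at_imp_continuous_on differentiable_imp_continuous_within)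
  qed
  then show "continuous_on UNIV (grad \<phi>)"
    unfolding grad_def by (intro continuous_on_vec_lambda) auto
qed

section \<open>Charts of a smooth domain\<close>

text \<open>Besides expressing the chart in an orthonormal basis, this shrinks the ball so that the
  graph over one closed interval lies entirely in the frontier and the ball projects into that
  interval. Both are needed to use the arc-length measure, which applies to arcs contained in the
  frontier.\<close>

lemma smooth_domain_chart:
  assumes \<Omega>: "smooth_bounded_domain \<Omega>" and p: "p \<in> frontier \<Omega>"
  obtains \<delta> B1 B2 \<gamma> \<gamma>' a b where "0 < \<delta>"
    "norm B1 = 1" "norm B2 = 1" "B1 \<bullet> B2 = 0"
    "\<And>x. (\<gamma> has_real_derivative \<gamma>' x) (at x)" "continuous_on UNIV \<gamma>'"
    "\<Omega> \<inter> ball p \<delta> = {x \<in> ball p \<delta>. \<gamma> (B1 \<bullet> x) < B2 \<bullet> x}"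
    "\<And>x. x \<in> {a..b} \<Longrightarrow> x *\<^sub>R B1 + \<gamma> x *\<^sub>R B2 \<in> frontier \<Omega>"
    "\<And>x. x \<in> ball p \<delta> \<Longrightarrow> B1 \<bullet> x \<in> {a..b}"
    "frontier \<Omega> \<inter> ball p \<delta> \<subseteq> (\<lambda>x. x *\<^sub>R B1 + \<gamma> x *\<^sub>R B2) ` {a..b}"
proof -
  obtain T r \<gamma> where T: "orthogonal_transformation (T :: real^2 \<Rightarrow> real^2)" and r: "0 < r"
    and sm: "smooth (\<gamma> :: real \<Rightarrow> real)"
    and eq: "\<Omega> \<inter> ball p r = {x \<in> ball p r. \<gamma> (T x $ 1) < T x $ 2}"
    using \<Omega> p unfolding smooth_bounded_domain_def by blast
  have op: "open \<Omega>" using \<Omega> by (simp add: smooth_bounded_domain_def)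
  obtain \<gamma>' where \<gamma>: "\<And>x. (\<gamma> has_real_derivative \<gamma>' x) (at x)" and \<gamma>': "continuous_on UNIV \<gamma>'"
    using smooth_has_real_derivative[OF sm] by blast
  have \<gamma>c: "continuous_on A \<gamma>" for A
    using \<gamma> by (meson DERIV_isCont continuous_at_imp_continuous_on)
  \<comment> \<open>Pulling the axes back along T turns the two components of T x into the
    coordinates of x with respect to B1 and B2.\<close>
  define B1 where "B1 = inv T (axis 1 1)"
  define B2 where "B2 = inv T (axis 2 1)"
  have TB: "T B1 = axis 1 1" "T B2 = axis 2 1"
    using orthogonal_transformation_surj[OF T] by (simp_all add: B1_def B2_def surj_f_inv_f)
  have Tin: "T x \<bullet> T y = x \<bullet> y" for x y using T by (simp add: orthogonal_transformation_def)
  have T1: "T x $ 1 = B1 \<bullet> x" for x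
    by (metis TB(1) Tin cart_eq_inner_axis inner_commute)
  have T2: "T x $ 2 = B2 \<bullet> x" for x
    by (metis TB(2) Tin cart_eq_inner_axis inner_commute)
  have B: "norm B1 = 1" "norm B2 = 1" "B1 \<bullet> B2 = 0"
    using Tin[of B1 B1, unfolded TB] Tin[of B2 B2, unfolded TB] Tin[of B1 B2, unfolded TB]
    by (simp_all add: inner_axis_axis norm_eq_1)
  have n: "B1 \<bullet> B1 = 1" "B2 \<bullet> B2 = 1" "B2 \<bullet> B1 = 0"
    using B by (simp_all add: norm_eq_1 inner_commute)
  have mem: "x \<in> \<Omega> \<longleftrightarrow> \<gamma> (B1 \<bullet> x) < B2 \<bullet> x" if "x \<in> ball p r" for x
    using that eqset_imp_iff[OF eq, of x] by (simp add: T1 T2)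
  \<comment> \<open>A point strictly below the graph has a neighbourhood that misses the domain, and
    a point on the graph is a limit of points above it.\<close>
  have fr: "x \<in> frontier \<Omega> \<longleftrightarrow> \<gamma> (B1 \<bullet> x) = B2 \<bullet> x" if x: "x \<in> ball p r" for x
  proof
    assume "x \<in> frontier \<Omega>"
    then have xf: "x \<in> closure \<Omega>" "x \<notin> \<Omega>" using op by (auto simp: frontier_def interior_open)
    have "\<not> \<gamma> (B1 \<bullet> x) < B2 \<bullet> x" using xf mem[OF x] by simp
    moreover have "\<not> B2 \<bullet> x < \<gamma> (B1 \<bullet> x)"
    proof
      assume "B2 \<bullet> x < \<gamma> (B1 \<bullet> x)"
      moreover have "open {y. B2 \<bullet> y < \<gamma> (B1 \<bullet> y)}"
        by (intro open_Collect_less continuous_intros continuous_on_compose2[OF \<gamma>c[of UNIV]]) auto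
      ultimately have o: "open (ball p r \<inter> {y. B2 \<bullet> y < \<gamma> (B1 \<bullet> y)})"
        and xi: "x \<in> ball p r \<inter> {y. B2 \<bullet> y < \<gamma> (B1 \<bullet> y)}"
        using x by (simp_all add: open_Int)
      have "(ball p r \<inter> {y. B2 \<bullet> y < \<gamma> (B1 \<bullet> y)}) \<inter> \<Omega> = {}"
        using mem by fastforce
      then have "(ball p r \<inter> {y. B2 \<bullet> y < \<gamma> (B1 \<bullet> y)}) \<inter> closure \<Omega> = {}"
        using open_Int_closure_eq_empty[OF o] by simp
      then show False using xf(1) xi by blast
    qed
    ultimately show "\<gamma> (B1 \<bullet> x) = B2 \<bullet> x" by simp
  next
    assume e: "\<gamma> (B1 \<bullet> x) = B2 \<bullet> x"
    then have "x \<notin> \<Omega>" using mem[OF x] by simp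
    moreover have "x \<in> closure \<Omega>"
      unfolding closure_approachable
    proof (intro allI impI)
      fix \<epsilon> :: real assume "0 < \<epsilon>"
      \<comment> \<open>A vertical shift by t moves the point into the domain while staying
        \<epsilon>-close and inside the chart ball; halving makes both inequalities strict.\<close>
      define t where "t = min \<epsilon> (r - dist p x) / 2"
      have t: "0 < t" "t < \<epsilon>" "t < r - dist p x" using x \<open>0 < \<epsilon>\<close> by (auto simp: t_def min_def field_simps)
      have d: "dist x (x + t *\<^sub>R B2) = t" using t B by (simp add: dist_norm)
      then have "x + t *\<^sub>R B2 \<in> ball p r" using t dist_triangle[of p "x + t *\<^sub>R B2" x] by auto
      then have "x + t *\<^sub>R B2 \<in> \<Omega>" using e t n B(3) by (simp add: mem inner_add_right)
      then show "\<exists>y\<in>\<Omega>. dist y x < \<epsilon>" using d t by (metis dist_commute)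
    qed
    ultimately show "x \<in> frontier \<Omega>" using op by (auto simp: frontier_def interior_open)
  qed
  define c where "c x = x *\<^sub>R B1 + \<gamma> x *\<^sub>R B2" for x
  have Bc: "B1 \<bullet> c x = x" "B2 \<bullet> c x = \<gamma> x" for x
    using n B(3) by (simp_all add: c_def inner_add_right)
  define t0 where "t0 = B1 \<bullet> p"
  have cexp: "c (B1 \<bullet> x) = x" if "\<gamma> (B1 \<bullet> x) = B2 \<bullet> x" for x
    using real2_orthonormal_expand[OF B, of x] that by (simp add: c_def)
  have "\<gamma> (B1 \<bullet> p) = B2 \<bullet> p" using fr[of p] p r by simp
  then have ct: "c t0 = p" unfolding t0_def by (rule cexp)
  have "isCont c t0"
    using continuous_on_interior[of UNIV c t0] \<gamma>c[of UNIV]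
    by (simp add: c_def[abs_def] continuous_intros)
  then obtain d where d: "0 < d" "\<And>x. dist x t0 < d \<Longrightarrow> dist (c x) p < r"
    unfolding continuous_at_eps_delta using r ct by metis
  \<comment> \<open>With d from the continuity of c at the parameter of p, the closed interval of
    half-width d / 2 is mapped into the chart ball. Projection onto B1 does not increase distances,
    so a ball of radius at most d / 2 lands in this interval.\<close>
  define \<delta> where "\<delta> = min (d / 2) r"
  have d2: "c x \<in> ball p r" if "x \<in> {t0 - d/2..t0 + d/2}" for x
    using d that by (auto simp: dist_commute dist_real_def abs_if field_simps)
  have I: "B1 \<bullet> x \<in> {t0 - d/2..t0 + d/2}" if "x \<in> ball p \<delta>" for x
  proof -
    have "\<bar>B1 \<bullet> (x - p)\<bar> \<le> norm (x - p)"
      using Cauchy_Schwarz_ineq2[of B1 "x - p"] B by simp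
    also have "\<dots> < d / 2" using that by (simp add: \<delta>_def dist_norm norm_minus_commute)
    finally have "\<bar>B1 \<bullet> x - t0\<bar> < d / 2" by (simp add: t0_def inner_diff_right)
    then show ?thesis unfolding atLeastAtMost_iff by linarith
  qed
  show thesis
  proof (rule that[of \<delta> B1 B2 \<gamma> \<gamma>' "t0 - d/2" "t0 + d/2"])
    show "0 < \<delta>" using d r by (simp add: \<delta>_def)
    show "\<Omega> \<inter> ball p \<delta> = {x \<in> ball p \<delta>. \<gamma> (B1 \<bullet> x) < B2 \<bullet> x}"
      using mem by (auto simp: \<delta>_def)
    show "x *\<^sub>R B1 + \<gamma> x *\<^sub>R B2 \<in> frontier \<Omega>" if "x \<in> {t0 - d/2..t0 + d/2}" for x
      using fr[OF d2[OF that]] Bc[of x] by (simp add: c_def)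
    show "B1 \<bullet> x \<in> {t0 - d/2..t0 + d/2}" if "x \<in> ball p \<delta>" for x using I[OF that] .
    show "frontier \<Omega> \<inter> ball p \<delta> \<subseteq> (\<lambda>x. x *\<^sub>R B1 + \<gamma> x *\<^sub>R B2) ` {t0 - d/2..t0 + d/2}"
    proof
      fix x assume x: "x \<in> frontier \<Omega> \<inter> ball p \<delta>"
      then have "c (B1 \<bullet> x) = x" using fr[of x] by (intro cexp) (auto simp: \<delta>_def)
      then have "x = (B1 \<bullet> x) *\<^sub>R B1 + \<gamma> (B1 \<bullet> x) *\<^sub>R B2" by (simp add: c_def)
      then show "x \<in> (\<lambda>x. x *\<^sub>R B1 + \<gamma> x *\<^sub>R B2) ` {t0 - d/2..t0 + d/2}"
        by (rule image_eqI) (use I x in blast)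
    qed
  qed (use B \<gamma> \<gamma>' in auto)
qed

section \<open>Local divergence inequalities\<close>

text \<open>The Bochner integral of a non-integrable function is 0 by convention, so the estimate
  holds for every f.\<close>

lemma ennreal_abs_integral_le: "ennreal \<bar>\<integral>x. f x \<partial>M\<bar> \<le> (\<integral>\<^sup>+x. ennreal \<bar>f x\<bar> \<partial>M)"
  using integral_norm_bound_ennreal[of M f] by (cases "integrable M f") (auto simp: not_integrable_integral_eq)

text \<open>The two conjuncts belong together because both pass from small balls to the whole domain
  along the same finite cover. The boundary integral is an extended one since the total length is
  not known to be finite at this point.\<close>

definition local_divergence_bound ::
  "(real^2) set \<Rightarrow> (real^2) measure \<Rightarrow> real^2 \<Rightarrow> real \<Rightarrow> bool" where
  "local_divergence_bound \<Omega> \<Gamma> q \<rho> \<longleftrightarrow> emeasure \<Gamma> (frontier \<Omega> \<inter> ball q \<rho>) < \<infinity> \<and>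
     (\<forall>f G e. C1_grad f G \<and> (\<forall>x. x \<notin> ball q \<rho> \<longrightarrow> f x = 0) \<longrightarrow>
        ennreal \<bar>\<integral>x. indicator \<Omega> x * (e \<bullet> G x) \<partial>lborel\<bar> \<le> ennreal (norm e) * (\<integral>\<^sup>+p. ennreal \<bar>f p\<bar> \<partial>\<Gamma>))"

text \<open>The density from the graph formula is e . (\<gamma>' B1 - B2). This vector is the
  tangent B1 + \<gamma>' B2 of the graph turned by a right angle, so Cauchy-Schwarz yields |e| times
  the arc-length density.\<close>

lemma local_divergence_bound_frontier:
  assumes \<Omega>: "smooth_bounded_domain \<Omega>" and \<Gamma>: "arclength_measure (frontier \<Omega>) \<Gamma>"
    and p: "p \<in> frontier \<Omega>"
  shows "\<exists>\<rho>>0. local_divergence_bound \<Omega> \<Gamma> p \<rho>"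
proof -
  obtain \<delta> B1 B2 \<gamma> \<gamma>' a b where \<delta>: "0 < \<delta>"
    and B: "norm B1 = 1" "norm B2 = 1" "B1 \<bullet> B2 = 0"
    and \<gamma>1: "\<And>x. (\<gamma> has_real_derivative \<gamma>' x) (at x)" and \<gamma>2: "continuous_on UNIV \<gamma>'"
    and eq: "\<Omega> \<inter> ball p \<delta> = {x \<in> ball p \<delta>. \<gamma> (B1 \<bullet> x) < B2 \<bullet> x}"
    and arc: "\<And>x. x \<in> {a..b} \<Longrightarrow> x *\<^sub>R B1 + \<gamma> x *\<^sub>R B2 \<in> frontier \<Omega>"
    and I: "\<And>x. x \<in> ball p \<delta> \<Longrightarrow> B1 \<bullet> x \<in> {a..b}"
    and sub: "frontier \<Omega> \<inter> ball p \<delta> \<subseteq> (\<lambda>x. x *\<^sub>R B1 + \<gamma> x *\<^sub>R B2) ` {a..b}"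
    by (rule smooth_domain_chart[OF \<Omega> p]) (rule that; assumption)
  note \<gamma> = \<gamma>1 \<gamma>2
  define c where "c x = x *\<^sub>R B1 + \<gamma> x *\<^sub>R B2" for x
  have n: "B1 \<bullet> B1 = 1" "B2 \<bullet> B2 = 1" "B2 \<bullet> B1 = 0"
    using B by (simp_all add: norm_eq_1 inner_commute)
  have \<gamma>c: "continuous_on A \<gamma>" for A
    using \<gamma> by (meson DERIV_isCont continuous_at_imp_continuous_on)
  have inv: "B1 \<bullet> c x = x" for x
    using n B by (simp add: c_def inner_add_right)
  have cc: "continuous_on A c" for A
    unfolding c_def by (intro continuous_intros \<gamma>c)
  have sets\<Gamma>[measurable_cong]: "sets \<Gamma> = sets borel" using \<Gamma> by (simp add: arclength_measure_def)
  have K: "c ` {a..b} \<in> sets borel"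
    by (intro borel_compact compact_continuous_image cc) auto
  have "emeasure \<Gamma> (frontier \<Omega> \<inter> ball p (\<delta> / 2)) \<le> emeasure \<Gamma> (c ` {a..b})"
    using sub \<delta> K by (intro emeasure_mono) (auto simp: c_def sets\<Gamma>)
  also have "\<dots> = (\<integral>\<^sup>+x. ennreal (norm (B1 + \<gamma>' x *\<^sub>R B2)) * indicator {a..b} x \<partial>lborel)"
    using nn_integral_arclength_graph[OF \<Gamma> B \<gamma> arc, of a b "\<lambda>_. 1"] K
    by (simp add: c_def[abs_def] sets\<Gamma>)
  also have "\<dots> < \<infinity>"
  proof -
    have "integrable lborel (\<lambda>x. indicator {a..b} x *\<^sub>R norm (B1 + \<gamma>' x *\<^sub>R B2))"
      by (intro borel_integrable_compact continuous_intros continuous_on_subset[OF \<gamma>(2)]) auto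
    then have "(\<integral>\<^sup>+x. ennreal (norm (indicator {a..b} x *\<^sub>R norm (B1 + \<gamma>' x *\<^sub>R B2))) \<partial>lborel) < \<infinity>"
      by (simp add: integrable_iff_bounded)
    also have "(\<integral>\<^sup>+x. ennreal (norm (indicator {a..b} x *\<^sub>R norm (B1 + \<gamma>' x *\<^sub>R B2))) \<partial>lborel)
      = (\<integral>\<^sup>+x. ennreal (norm (B1 + \<gamma>' x *\<^sub>R B2)) * indicator {a..b} x \<partial>lborel)"
      by (intro nn_integral_cong) (auto simp: indicator_def)
    finally show ?thesis .
  qed
  finally have fin: "emeasure \<Gamma> (frontier \<Omega> \<inter> ball p (\<delta> / 2)) < \<infinity>" .
  have main: "ennreal \<bar>\<integral>x. indicator \<Omega> x * (e \<bullet> G x) \<partial>lborel\<bar> \<le> ennreal (norm e) * (\<integral>\<^sup>+p. ennreal \<bar>f p\<bar> \<partial>\<Gamma>)"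
    if f: "C1_grad f G" and z: "\<forall>x. x \<notin> ball p (\<delta> / 2) \<longrightarrow> f x = 0" for f G e
  proof -
    have z': "\<And>x. x \<notin> ball p (\<delta> / 2) \<Longrightarrow> f x = 0" using z by blast
    have [measurable]: "f \<in> borel_measurable borel"
      by (rule borel_measurable_continuous_onI[OF C1_grad_continuous_on[OF f]])
    have "(\<integral>x. indicator \<Omega> x * (e \<bullet> G x) \<partial>lborel) = (\<integral>x. indicator {x. \<gamma> (B1 \<bullet> x) < B2 \<bullet> x} x * (e \<bullet> G x) \<partial>lborel)"
    \<comment> \<open>Here the half radius matters: the closed ball of radius \<delta> / 2 still
      lies in the chart ball, where the domain is the region above the graph, and outside this
      closed ball G vanishes.\<close>
    proof (rule Bochner_Integration.integral_cong[OF refl])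
      fix x
      show "indicator \<Omega> x * (e \<bullet> G x) = indicator {x. \<gamma> (B1 \<bullet> x) < B2 \<bullet> x} x * (e \<bullet> G x)"
      proof (cases "x \<in> cball p (\<delta> / 2)")
        case True
        then have "x \<in> ball p \<delta>" using \<delta> by auto
        then show ?thesis using eqset_imp_iff[OF eq, of x] by (simp add: indicator_def)
      next
        case False
        then show ?thesis using C1_grad_zero_outside[where q=p and \<delta>="\<delta> / 2" and x=x, OF f z'] by simp
      qed
    qed
    also have "\<dots> = (\<integral>x. ((e \<bullet> B1) * \<gamma>' x - e \<bullet> B2) * f (c x) \<partial>lborel)"
      unfolding c_def by (rule divergence_above_graph[OF f B \<gamma> z'])
    finally have "ennreal \<bar>\<integral>x. indicator \<Omega> x * (e \<bullet> G x) \<partial>lborel\<bar>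
      \<le> (\<integral>\<^sup>+x. ennreal \<bar>((e \<bullet> B1) * \<gamma>' x - e \<bullet> B2) * f (c x)\<bar> \<partial>lborel)"
      using ennreal_abs_integral_le by simp
    also have "\<dots> \<le> (\<integral>\<^sup>+x. ennreal (norm e) * (ennreal \<bar>f (c x)\<bar> * ennreal (norm (B1 + \<gamma>' x *\<^sub>R B2)) * indicator {a..b} x) \<partial>lborel)"
    proof (rule nn_integral_mono)
      fix x
      have "x \<in> {a..b}" if "f (c x) \<noteq> 0"
      proof -
        have "c x \<in> ball p \<delta>" using z'[of "c x"] that \<delta> by (cases "c x \<in> ball p (\<delta> / 2)") auto
        then show ?thesis using I[of "c x"] inv by simp
      qed
      moreover have "\<bar>(e \<bullet> B1) * \<gamma>' x - e \<bullet> B2\<bar> \<le> norm e * norm (B1 + \<gamma>' x *\<^sub>R B2)"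
      proof -
        have "\<bar>e \<bullet> (\<gamma>' x *\<^sub>R B1 - B2)\<bar> \<le> norm e * norm (\<gamma>' x *\<^sub>R B1 - B2)"
          by (rule Cauchy_Schwarz_ineq2)
        \<comment> \<open>The rotation by a right angle: both vectors have squared length 1 +
          \<gamma>'^2.\<close>
        moreover have "norm (\<gamma>' x *\<^sub>R B1 - B2) = norm (B1 + \<gamma>' x *\<^sub>R B2)"
          using n B(3) by (simp add: norm_eq_sqrt_inner algebra_simps)
        ultimately show ?thesis by (simp add: inner_diff_right mult.commute)
      qed
      from mult_right_mono[OF this, of "\<bar>f (c x)\<bar>"]
      have "\<bar>((e \<bullet> B1) * \<gamma>' x - e \<bullet> B2) * f (c x)\<bar> \<le> norm e * (\<bar>f (c x)\<bar> * norm (B1 + \<gamma>' x *\<^sub>R B2))"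
        by (simp add: abs_mult mult_ac)
      ultimately show "ennreal \<bar>((e \<bullet> B1) * \<gamma>' x - e \<bullet> B2) * f (c x)\<bar>
        \<le> ennreal (norm e) * (ennreal \<bar>f (c x)\<bar> * ennreal (norm (B1 + \<gamma>' x *\<^sub>R B2)) * indicator {a..b} x)"
        by (cases "f (c x) = 0") (auto simp: ennreal_mult[symmetric] intro: ennreal_leI)
    qed
    also have "\<dots> = ennreal (norm e) * (\<integral>\<^sup>+x. ennreal \<bar>f (c x)\<bar> * ennreal (norm (B1 + \<gamma>' x *\<^sub>R B2)) * indicator {a..b} x \<partial>lborel)"
    proof (rule nn_integral_cmult)
      have [measurable]: "c \<in> borel_measurable borel" "\<gamma>' \<in> borel_measurable borel"
        using cc \<gamma>(2) by (auto intro: borel_measurable_continuous_onI)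
      show "(\<lambda>x. ennreal \<bar>f (c x)\<bar> * ennreal (norm (B1 + \<gamma>' x *\<^sub>R B2)) * indicator {a..b} x) \<in> borel_measurable lborel"
        by measurable
    qed
    also have "(\<integral>\<^sup>+x. ennreal \<bar>f (c x)\<bar> * ennreal (norm (B1 + \<gamma>' x *\<^sub>R B2)) * indicator {a..b} x \<partial>lborel)
      = (\<integral>\<^sup>+p. ennreal \<bar>f p\<bar> * indicator (c ` {a..b}) p \<partial>\<Gamma>)"
      using nn_integral_arclength_graph[OF \<Gamma> B \<gamma> arc, of a b "\<lambda>p. ennreal \<bar>f p\<bar>"]
      by (simp add: c_def[abs_def])
    also have "\<dots> \<le> (\<integral>\<^sup>+p. ennreal \<bar>f p\<bar> \<partial>\<Gamma>)"
      by (intro nn_integral_mono) (auto simp: indicator_def)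
    finally show ?thesis by (simp add: mult_left_mono)
  qed
  show ?thesis unfolding local_divergence_bound_def
    by (intro exI[of _ "\<delta> / 2"] conjI allI impI fin; (elim conjE)?) (use \<delta> in simp, rule main)
qed

text \<open>For a support inside the domain the left-hand side is zero. This is the graph formula
  again, applied to a horizontal line below the support.\<close>

lemma local_divergence_bound_interior:
  assumes op: "open \<Omega>" and q: "q \<in> \<Omega>"
  shows "\<exists>\<rho>>0. local_divergence_bound \<Omega> \<Gamma> q \<rho>"
proof -
  obtain \<delta> where \<delta>: "0 < \<delta>" "cball q \<delta> \<subseteq> \<Omega>"
    using op q open_contains_cball by blast
  have "ball q \<delta> \<subseteq> \<Omega>" using \<delta>(2) ball_subset_cball by blast
  then have "frontier \<Omega> \<inter> ball q \<delta> = {}"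
    using op by (auto simp: frontier_def interior_open)
  moreover have "(\<integral>x. indicator \<Omega> x * (e \<bullet> G x) \<partial>lborel) = 0"
    if f: "C1_grad f G" and z: "\<forall>x. x \<notin> ball q \<delta> \<longrightarrow> f x = 0" for f G e
  proof -
    \<comment> \<open>Points of the closed ball have norm at most |q| + \<delta>, hence second
      coordinate above m.\<close>
    define m where "m = - (norm q + \<delta> + 1)"
    define B1 :: "real^2" where "B1 = axis 1 1"
    define B2 :: "real^2" where "B2 = axis 2 1"
    have B: "norm B1 = 1" "norm B2 = 1" "B1 \<bullet> B2 = 0"
      by (simp_all add: B1_def B2_def inner_axis_axis)
    have z': "\<And>x. x \<notin> ball q \<delta> \<Longrightarrow> f x = 0" using z by blast
    have in_ball: "m < B2 \<bullet> x" if "x \<in> cball q \<delta>" for x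
    proof -
      have "\<bar>B2 \<bullet> x\<bar> \<le> norm x" using Cauchy_Schwarz_ineq2[of B2 x] B by simp
      also have "\<dots> \<le> norm q + \<delta>" using that norm_triangle_ineq[of q "x - q"]
        by (simp add: dist_norm norm_minus_commute)
      finally show ?thesis by (simp add: m_def)
    qed
    have "(\<integral>x. indicator \<Omega> x * (e \<bullet> G x) \<partial>lborel) = (\<integral>x. indicator {x. m < B2 \<bullet> x} x * (e \<bullet> G x) \<partial>lborel)"
    proof (rule Bochner_Integration.integral_cong[OF refl])
      fix x
      show "indicator \<Omega> x * (e \<bullet> G x) = indicator {x. m < B2 \<bullet> x} x * (e \<bullet> G x)"
        using C1_grad_zero_outside[where q=q and \<delta>=\<delta> and x=x, OF f z'] in_ball[of x] \<delta>
        by (cases "x \<in> cball q \<delta>") (auto simp: indicator_def)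
    qed
    also have "\<dots> = (\<integral>x. ((e \<bullet> B1) * 0 - e \<bullet> B2) * f (x *\<^sub>R B1 + m *\<^sub>R B2) \<partial>lborel)"
      by (rule divergence_above_graph[OF f B _ _ z', where \<gamma> = "\<lambda>_. m" and \<gamma>' = "\<lambda>_. 0"]) auto
    also have "\<dots> = 0"
    proof -
      have "f (x *\<^sub>R B1 + m *\<^sub>R B2) = 0" for x
      proof (rule z', rule notI)
        assume "x *\<^sub>R B1 + m *\<^sub>R B2 \<in> ball q \<delta>"
        then have "m < B2 \<bullet> (x *\<^sub>R B1 + m *\<^sub>R B2)" by (intro in_ball) auto
        then show False using B by (simp add: inner_add_right inner_commute norm_eq_1)
      qed
      then show ?thesis by simp
    qed
    finally show ?thesis .
  qed
  ultimately show ?thesis using \<delta> unfolding local_divergence_bound_def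
    by (intro exI[of _ \<delta>]) auto
qed

section \<open>The divergence inequality\<close>

lemma integrable_lborel_bounded_set:
  fixes g :: "'a::euclidean_space \<Rightarrow> real"
  assumes "continuous_on UNIV g" "open \<Omega>" "bounded \<Omega>"
  shows "integrable lborel (\<lambda>x. indicator \<Omega> x * g x)"
proof -
  have [measurable]: "g \<in> borel_measurable borel" "\<Omega> \<in> sets borel"
    using assms by (auto intro: borel_measurable_continuous_onI)
  have "integrable lborel (\<lambda>x. indicator (closure \<Omega>) x *\<^sub>R g x)"
    using assms by (intro borel_integrable_compact) (auto intro: continuous_on_subset)
  then show ?thesis
    by (rule Bochner_Integration.integrable_bound) (use closure_subset in \<open>auto simp: indicator_def\<close>)
qed

lemma finite_cover_local_divergence_bound:
  assumes \<Omega>: "smooth_bounded_domain \<Omega>" and \<Gamma>: "arclength_measure (frontier \<Omega>) \<Gamma>"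
  obtains D \<rho> where "finite D" "\<And>q. q \<in> D \<Longrightarrow> 0 < \<rho> q \<and> local_divergence_bound \<Omega> \<Gamma> q (\<rho> q)"
    "closure \<Omega> \<subseteq> (\<Union>q\<in>D. ball q (\<rho> q))"
proof -
  have op: "open \<Omega>" and bd: "bounded \<Omega>" using \<Omega> by (simp_all add: smooth_bounded_domain_def)
  have "\<exists>\<rho>>0. local_divergence_bound \<Omega> \<Gamma> q \<rho>" if "q \<in> closure \<Omega>" for q
    using that local_divergence_bound_frontier[OF \<Omega> \<Gamma>] local_divergence_bound_interior[OF op]
      op by (metis Diff_iff frontier_def interior_open)
  then obtain \<rho> where \<rho>: "\<And>q. q \<in> closure \<Omega> \<Longrightarrow> 0 < \<rho> q \<and> local_divergence_bound \<Omega> \<Gamma> q (\<rho> q)"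
    by metis
  have cpt: "compact (closure \<Omega>)" using bd by (simp add: compact_closure)
  have cover: "closure \<Omega> \<subseteq> (\<Union>q\<in>closure \<Omega>. ball q (\<rho> q))" using \<rho> by force
  obtain D where "D \<subseteq> closure \<Omega>" "finite D" "closure \<Omega> \<subseteq> (\<Union>q\<in>D. ball q (\<rho> q))"
    using compactE_image[OF cpt open_ball cover] by metis
  then show thesis using \<rho> that by blast
qed

text \<open>Compactness of the closure covers the frontier by finitely many balls, each containing
  boundary of finite length; the complement of the frontier is null by definition.\<close>

lemma finite_measure_arclength:
  assumes \<Omega>: "smooth_bounded_domain \<Omega>" and \<Gamma>: "arclength_measure (frontier \<Omega>) \<Gamma>"
  shows "finite_measure \<Gamma>"
proof
  obtain D \<rho> where D: "finite D" "\<And>q. q \<in> D \<Longrightarrow> 0 < \<rho> q \<and> local_divergence_bound \<Omega> \<Gamma> q (\<rho> q)"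
    "closure \<Omega> \<subseteq> (\<Union>q\<in>D. ball q (\<rho> q))"
    by (rule finite_cover_local_divergence_bound[OF \<Omega> \<Gamma>]) (rule that)
  have s: "sets \<Gamma> = sets borel" using \<Gamma> by (simp add: arclength_measure_def)
  have borel: "frontier \<Omega> \<in> sets borel" "(\<Union>q\<in>D. ball q (\<rho> q)) \<in> sets borel"
    by (auto intro: borel_closed borel_open)
  have "emeasure \<Gamma> (space \<Gamma>) \<le> emeasure \<Gamma> (- frontier \<Omega> \<union> (\<Union>q\<in>D. frontier \<Omega> \<inter> ball q (\<rho> q)))"
  proof (rule emeasure_mono)
    show "space \<Gamma> \<subseteq> - frontier \<Omega> \<union> (\<Union>q\<in>D. frontier \<Omega> \<inter> ball q (\<rho> q))"
      using D(3) by (auto simp: frontier_def)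
    show "- frontier \<Omega> \<union> (\<Union>q\<in>D. frontier \<Omega> \<inter> ball q (\<rho> q)) \<in> sets \<Gamma>"
      using borel by (auto simp: s)
  qed
  also have "\<dots> \<le> emeasure \<Gamma> (- frontier \<Omega>) + emeasure \<Gamma> (\<Union>q\<in>D. frontier \<Omega> \<inter> ball q (\<rho> q))"
    using borel by (intro emeasure_subadditive) (auto simp: s)
  also have "\<dots> \<le> 0 + (\<Sum>q\<in>D. emeasure \<Gamma> (frontier \<Omega> \<inter> ball q (\<rho> q)))"
    using \<Gamma> D(1) by (intro add_mono emeasure_subadditive_finite) (auto simp: s arclength_measure_def)
  also have "\<dots> < \<infinity>"
  proof -
    have "emeasure \<Gamma> (frontier \<Omega> \<inter> ball q (\<rho> q)) < top" if "q \<in> D" for q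
      using D(2)[OF that] by (simp add: local_divergence_bound_def)
    then show ?thesis using D(1) by simp
  qed
  finally show "emeasure \<Gamma> (space \<Gamma>) \<noteq> \<infinity>" by simp
qed

text \<open>The localised pieces of f add up to f on the domain, while the sum of their absolute
  values is at most |f| everywhere. Therefore the local inequalities add up without any loss in the
  constant.\<close>

proposition divergence_bound:
  assumes \<Omega>: "smooth_bounded_domain \<Omega>" and \<Gamma>: "arclength_measure (frontier \<Omega>) \<Gamma>"
    and f: "C1_grad f G"
  shows "ennreal \<bar>\<integral>x. indicator \<Omega> x * (e \<bullet> G x) \<partial>lborel\<bar> \<le> ennreal (norm e) * (\<integral>\<^sup>+p. ennreal \<bar>f p\<bar> \<partial>\<Gamma>)"
proof -
  have op: "open \<Omega>" and bd: "bounded \<Omega>" and ne: "\<Omega> \<noteq> {}"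
    using \<Omega> by (simp_all add: smooth_bounded_domain_def)
  have s[measurable_cong]: "sets \<Gamma> = sets borel" using \<Gamma> by (simp add: arclength_measure_def)
  obtain D \<rho> where D: "finite D" "\<And>q. q \<in> D \<Longrightarrow> 0 < \<rho> q \<and> local_divergence_bound \<Omega> \<Gamma> q (\<rho> q)"
    "closure \<Omega> \<subseteq> (\<Union>q\<in>D. ball q (\<rho> q))"
    by (rule finite_cover_local_divergence_bound[OF \<Omega> \<Gamma>]) (rule that)
  define h where "h q x = (max 0 ((\<rho> q)\<^sup>2 - (norm (x - q))\<^sup>2))\<^sup>2" for q x :: "real^2"
  have h0: "0 \<le> h q x" for q x by (simp add: h_def)
  have hpos: "0 < h q x" if "q \<in> D" "x \<in> ball q (\<rho> q)" for q x
  proof -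
    have "norm (x - q) < \<rho> q" using that by (simp add: dist_norm norm_minus_commute)
    then have "(norm (x - q))\<^sup>2 < (\<rho> q)\<^sup>2" by (intro power_strict_mono) auto
    then show ?thesis by (simp add: h_def)
  qed
  have hz: "h q x = 0" if "q \<in> D" "x \<notin> ball q (\<rho> q)" for q x
  proof -
    have "\<rho> q \<le> norm (x - q)" using that by (simp add: dist_norm norm_minus_commute)
    then have "(\<rho> q)\<^sup>2 \<le> (norm (x - q))\<^sup>2" using D(2)[OF that(1)] by (intro power_mono) auto
    then show ?thesis by (simp add: h_def)
  qed
  have "\<exists>M. C1_grad (h q) M" for q
    unfolding h_def using C1_grad_bump by blast
  then obtain h' where h': "\<And>q. C1_grad (h q) (h' q)" by metis
  define H where "H x = (\<Sum>q\<in>D. h q x)" for x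
  have H0: "0 \<le> H x" for x by (simp add: H_def h0 sum_nonneg)
  have H': "C1_grad H (\<lambda>x. \<Sum>q\<in>D. h' q x)" unfolding H_def by (intro C1_grad_sum h')
  have "\<exists>x\<in>closure \<Omega>. \<forall>y\<in>closure \<Omega>. H x \<le> H y"
    using ne bd by (intro continuous_attains_inf C1_grad_continuous_on[OF H']) (auto simp: compact_closure)
  then obtain x0 where x0: "x0 \<in> closure \<Omega>" "\<And>y. y \<in> closure \<Omega> \<Longrightarrow> H x0 \<le> H y" by blast
  define m where "m = H x0"
  have m: "0 < m"
  proof -
    obtain q where "q \<in> D" "x0 \<in> ball q (\<rho> q)" using D(3) x0(1) by blast
    then show ?thesis unfolding m_def H_def using D(1) by (intro sum_pos2[of D q] hpos) (auto simp: h0)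
  qed
  \<comment> \<open>K is positive on the whole plane and agrees with H where H is at least m, so h q / K is a C1
    partition of unity on the domain.\<close>
  define K where "K x = H x + (max 0 (m - H x))\<^sup>2" for x
  have KH: "H x \<le> K x" for x by (simp add: K_def)
  have Kpos: "0 < K x" for x
  proof (cases "H x = 0")
    case True
    then show ?thesis using m by (simp add: K_def)
  next
    case False
    then have "0 < H x" using H0[of x] by simp
    then show ?thesis using KH[of x] by linarith
  qed
  have K\<Omega>: "K x = H x" if "x \<in> \<Omega>" for x
    using x0(2)[of x] that closure_subset[of \<Omega>] by (simp add: K_def m_def subset_iff)
  have "\<exists>K'. C1_grad K K'"
  proof -
    have "C1_grad (\<lambda>x. m + (-1) * H x) (\<lambda>x. 0 + ((-1) *\<^sub>R (\<Sum>q\<in>D. h' q x) + H x *\<^sub>R 0))"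
      by (intro C1_grad_add C1_grad_mult C1_grad_const H')
    then have c: "C1_grad (\<lambda>x. m - H x) (\<lambda>x. - (\<Sum>q\<in>D. h' q x))" by simp
    have "C1_grad (\<lambda>x. (max 0 (m - H x))\<^sup>2) (\<lambda>x. (2 * max 0 (m - H x)) *\<^sub>R - (\<Sum>q\<in>D. h' q x))"
      by (rule C1_grad_compose[where p = "\<lambda>s. (max 0 s)\<^sup>2" and p' = "\<lambda>s. 2 * max 0 s", OF c])
         (intro has_real_derivative_max_0_squared continuous_intros)+
    then show ?thesis unfolding K_def using C1_grad_add[OF H'] by blast
  qed
  then obtain K' where K': "C1_grad K K'" by blast
  have I: "C1_grad (\<lambda>x. inverse (K x)) (\<lambda>x. (- (inverse (K x * K x))) *\<^sub>R K' x)"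
  proof (rule C1_grad_compose[OF K', where p' = "\<lambda>s. - (inverse (s * s))"])
    show "(inverse has_real_derivative - inverse (K x * K x)) (at (K x))" for x
      using Kpos[of x] by (auto intro!: derivative_eq_intros simp: power2_eq_square)
    \<comment> \<open>K is positive, so its range avoids the singularity at 0.\<close>
    show "continuous_on (range K) (\<lambda>s. - inverse (s * s))"
      using Kpos by (intro continuous_intros) (auto simp: less_imp_neq[symmetric])
  qed
  define F where "F q x = h q x * (f x * inverse (K x))" for q x
  have "\<exists>M. C1_grad (F q) M" for q
    unfolding F_def using C1_grad_mult[OF h' C1_grad_mult[OF f I], of q] by - (rule exI)
  then obtain F' where F: "\<And>q. C1_grad (F q) (F' q)" by metis
  have sumF: "(\<Sum>q\<in>D. F q x) = H x * (f x * inverse (K x))" for x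
    by (simp add: F_def H_def sum_distrib_right)
  \<comment> \<open>On the open domain K equals H, so the pieces sum to f near every point and
    uniqueness of derivatives identifies the gradients. Off the domain no such identity is
    available, but the indicator removes those points.\<close>
  have grad: "(\<Sum>q\<in>D. F' q x) = G x" if x: "x \<in> \<Omega>" for x
  proof -
    have "((\<lambda>x. \<Sum>q\<in>D. F q x) has_derivative (\<lambda>h. (\<Sum>q\<in>D. F' q x) \<bullet> h)) (at x)"
      by (intro C1_gradD C1_grad_sum F)
    then have "(f has_derivative (\<lambda>h. (\<Sum>q\<in>D. F' q x) \<bullet> h)) (at x)"
    proof (rule has_derivative_transform_within_open[OF _ op x])
      fix y assume "y \<in> \<Omega>"
      then show "(\<Sum>q\<in>D. F q y) = f y" using Kpos[of y] K\<Omega>[of y] by (simp add: sumF)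
    qed
    then have "(\<lambda>h. (\<Sum>q\<in>D. F' q x) \<bullet> h) = (\<lambda>h. G x \<bullet> h)"
      using has_derivative_unique C1_gradD[OF f] by blast
    then have "(\<Sum>q\<in>D. F' q x) \<bullet> h = G x \<bullet> h" for h by (rule fun_cong)
    then show ?thesis using vector_eq_rdot by blast
  qed
  have bound: "ennreal \<bar>\<integral>x. indicator \<Omega> x * (e \<bullet> F' q x) \<partial>lborel\<bar> \<le> ennreal (norm e) * (\<integral>\<^sup>+p. ennreal \<bar>F q p\<bar> \<partial>\<Gamma>)"
    if "q \<in> D" for q
  proof -
    have "\<forall>x. x \<notin> ball q (\<rho> q) \<longrightarrow> F q x = 0" using hz[OF that] by (simp add: F_def)
    then show ?thesis using D(2)[OF that] F[of q] unfolding local_divergence_bound_def by blast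
  qed
  have "(\<integral>x. indicator \<Omega> x * (e \<bullet> G x) \<partial>lborel) = (\<integral>x. (\<Sum>q\<in>D. indicator \<Omega> x * (e \<bullet> F' q x)) \<partial>lborel)"
    by (intro Bochner_Integration.integral_cong)
       (auto simp: grad[symmetric] inner_sum_right sum_distrib_left[symmetric] indicator_def)
  also have "\<dots> = (\<Sum>q\<in>D. \<integral>x. indicator \<Omega> x * (e \<bullet> F' q x) \<partial>lborel)"
    by (intro Bochner_Integration.integral_sum integrable_lborel_bounded_set op bd continuous_intros)
       (use F in \<open>auto simp: C1_grad_def\<close>)
  finally have "\<bar>\<integral>x. indicator \<Omega> x * (e \<bullet> G x) \<partial>lborel\<bar> \<le> (\<Sum>q\<in>D. \<bar>\<integral>x. indicator \<Omega> x * (e \<bullet> F' q x) \<partial>lborel\<bar>)"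
    by (simp only: sum_abs)
  then have "ennreal \<bar>\<integral>x. indicator \<Omega> x * (e \<bullet> G x) \<partial>lborel\<bar> \<le> (\<Sum>q\<in>D. ennreal \<bar>\<integral>x. indicator \<Omega> x * (e \<bullet> F' q x) \<partial>lborel\<bar>)"
    by (subst sum_ennreal) (auto intro: ennreal_leI)
  also have "\<dots> \<le> (\<Sum>q\<in>D. ennreal (norm e) * (\<integral>\<^sup>+p. ennreal \<bar>F q p\<bar> \<partial>\<Gamma>))"
    by (intro sum_mono bound)
  also have "\<dots> = ennreal (norm e) * (\<integral>\<^sup>+p. (\<Sum>q\<in>D. ennreal \<bar>F q p\<bar>) \<partial>\<Gamma>)"
  proof -
    have [measurable]: "F q \<in> borel_measurable borel" for q
      by (rule borel_measurable_continuous_onI[OF C1_grad_continuous_on[OF F]])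
    show ?thesis by (subst nn_integral_sum) (auto simp: sum_distrib_left)
  qed
  also have "\<dots> \<le> ennreal (norm e) * (\<integral>\<^sup>+p. ennreal \<bar>f p\<bar> \<partial>\<Gamma>)"
  proof (intro mult_left_mono nn_integral_mono)
    fix p
    \<comment> \<open>H \<le> K on the whole plane, so the weights \<open>h q / K\<close> are
      nonnegative with sum at most 1.\<close>
    have "(\<Sum>q\<in>D. \<bar>F q p\<bar>) = H p * inverse (K p) * \<bar>f p\<bar>"
      using h0 Kpos[of p] by (simp add: F_def H_def abs_mult sum_distrib_left mult_ac)
    also have "\<dots> \<le> 1 * \<bar>f p\<bar>"
      using KH[of p] Kpos[of p] by (intro mult_right_mono) (auto simp: field_simps)
    finally show "(\<Sum>q\<in>D. ennreal \<bar>F q p\<bar>) \<le> ennreal \<bar>f p\<bar>"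
      by (simp add: sum_ennreal ennreal_leI)
  qed simp
  finally show ?thesis .
qed

section \<open>Square-integrable functions and traces\<close>

lemma Lp_norm_nonneg: "0 \<le> Lp_norm p M f"
  by (simp add: Lp_norm_def real_root_ge_zero Bochner_Integration.integral_nonneg)

lemma Lp_norm_power: "0 < p \<Longrightarrow> (Lp_norm p M f) ^ p = (\<integral>x. norm (f x) ^ p \<partial>M)"
  by (simp add: Lp_norm_def Bochner_Integration.integral_nonneg)

lemma Lp_space_measurable [measurable_dest]: "f \<in> Lp_space p M \<Longrightarrow> f \<in> borel_measurable M"
  by (simp add: Lp_space_def)

lemma Lp_space_2_integrable: "f \<in> Lp_space 2 M \<Longrightarrow> integrable M (\<lambda>x. (norm (f x))\<^sup>2)"
  by (simp add: Lp_space_def)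

lemma Lp_space_2I:
  assumes "f \<in> borel_measurable M" "integrable M g" "\<And>x. x \<in> space M \<Longrightarrow> (norm (f x))\<^sup>2 \<le> g x"
  shows "f \<in> Lp_space 2 M"
  using assms(1) unfolding Lp_space_def
  by (auto intro!: Bochner_Integration.integrable_bound[OF assms(2)] AE_I2 order_trans[OF assms(3)])

lemma Lp_space_2_diff:
  assumes f[measurable]: "f \<in> Lp_space 2 M" and g[measurable]: "g \<in> Lp_space 2 M"
  shows "(\<lambda>x. f x - g x) \<in> Lp_space 2 M"
proof (rule Lp_space_2I)
  show "integrable M (\<lambda>x. 2 * (norm (f x))\<^sup>2 + 2 * (norm (g x))\<^sup>2)"
    using Lp_space_2_integrable[OF f] Lp_space_2_integrable[OF g] by simp
  fix x
  have "(norm (f x - g x))\<^sup>2 \<le> (norm (f x) + norm (g x))\<^sup>2"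
    by (intro power_mono norm_triangle_ineq4) auto
  also have "\<dots> \<le> 2 * (norm (f x))\<^sup>2 + 2 * (norm (g x))\<^sup>2"
    using sum_squares_bound[of "norm (f x)" "norm (g x)"] by (simp add: power2_sum)
  finally show "(norm (f x - g x))\<^sup>2 \<le> 2 * (norm (f x))\<^sup>2 + 2 * (norm (g x))\<^sup>2" .
qed measurable

lemma Lp_space_2_norm_mult:
  assumes f[measurable]: "f \<in> Lp_space 2 M" and g[measurable]: "g \<in> Lp_space 2 M"
  shows "integrable M (\<lambda>x. norm (f x) * norm (g x))"
proof (rule Bochner_Integration.integrable_bound)
  show "integrable M (\<lambda>x. (norm (f x))\<^sup>2 + (norm (g x))\<^sup>2)"
    using Lp_space_2_integrable[OF f] Lp_space_2_integrable[OF g] by simp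
  have "norm (f x) * norm (g x) \<le> (norm (f x))\<^sup>2 + (norm (g x))\<^sup>2" for x
    using sum_squares_bound[of "norm (f x)" "norm (g x)"]
      mult_nonneg_nonneg[OF norm_ge_zero[of "f x"] norm_ge_zero[of "g x"]] by linarith
  then show "AE x in M. norm (norm (f x) * norm (g x)) \<le> norm ((norm (f x))\<^sup>2 + (norm (g x))\<^sup>2)"
    by simp
qed measurable

lemma Lp_space_2_inner:
  assumes f[measurable]: "f \<in> Lp_space 2 M" and g[measurable]: "g \<in> Lp_space 2 M"
  shows "integrable M (\<lambda>x. f x \<bullet> g x)"
  by (rule Bochner_Integration.integrable_bound[OF Lp_space_2_norm_mult[OF f g]])
     (auto simp: Cauchy_Schwarz_ineq2)

lemma Lp_norm_2_Cauchy_Schwarz: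
  assumes f[measurable]: "f \<in> Lp_space 2 M" and g[measurable]: "g \<in> Lp_space 2 M"
  shows "(\<integral>x. norm (f x) * norm (g x) \<partial>M) \<le> Lp_norm 2 M f * Lp_norm 2 M g"
proof -
  have "(\<integral>\<^sup>+x. ennreal (norm (f x)) * ennreal (norm (g x)) \<partial>M)\<^sup>2
     \<le> (\<integral>\<^sup>+x. (ennreal (norm (f x)))\<^sup>2 \<partial>M) * (\<integral>\<^sup>+x. (ennreal (norm (g x)))\<^sup>2 \<partial>M)"
    by (rule Cauchy_Schwarz_nn_integral) measurable
  also have "(\<integral>\<^sup>+x. ennreal (norm (f x)) * ennreal (norm (g x)) \<partial>M) = ennreal (\<integral>x. norm (f x) * norm (g x) \<partial>M)"
    using nn_integral_eq_integral[OF Lp_space_2_norm_mult[OF f g]] by (simp add: ennreal_mult)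
  also have "(\<integral>\<^sup>+x. (ennreal (norm (f x)))\<^sup>2 \<partial>M) = ennreal ((Lp_norm 2 M f)\<^sup>2)"
    using nn_integral_eq_integral[OF Lp_space_2_integrable[OF f]] by (simp add: ennreal_power Lp_norm_power)
  also have "(\<integral>\<^sup>+x. (ennreal (norm (g x)))\<^sup>2 \<partial>M) = ennreal ((Lp_norm 2 M g)\<^sup>2)"
    using nn_integral_eq_integral[OF Lp_space_2_integrable[OF g]] by (simp add: ennreal_power Lp_norm_power)
  finally have "(\<integral>x. norm (f x) * norm (g x) \<partial>M)\<^sup>2 \<le> (Lp_norm 2 M f * Lp_norm 2 M g)\<^sup>2"
    by (simp add: ennreal_power ennreal_mult[symmetric] power_mult_distrib Bochner_Integration.integral_nonneg)
  then show ?thesis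
    by (rule power2_le_imp_le) (simp add: Lp_norm_nonneg)
qed

lemma inner_L2_Cauchy_Schwarz:
  assumes f: "f \<in> Lp_space 2 M" and g: "g \<in> Lp_space 2 M"
  shows "\<bar>inner_L2 M f g\<bar> \<le> Lp_norm 2 M f * Lp_norm 2 M g"
proof -
  have "\<bar>inner_L2 M f g\<bar> \<le> (\<integral>x. \<bar>f x \<bullet> g x\<bar> \<partial>M)"
    unfolding inner_L2_def by (rule integral_abs_bound)
  also have "\<dots> \<le> (\<integral>x. norm (f x) * norm (g x) \<partial>M)"
    using Lp_space_2_inner[OF f g] Lp_space_2_norm_mult[OF f g]
    by (intro integral_mono) (auto simp: Cauchy_Schwarz_ineq2)
  also have "\<dots> \<le> Lp_norm 2 M f * Lp_norm 2 M g" by (rule Lp_norm_2_Cauchy_Schwarz[OF f g])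
  finally show ?thesis .
qed

text \<open>Cauchy-Schwarz against the constant 1; it turns the L2 convergence in
  \<open>is_trace\<close> into L1 estimates.\<close>

lemma (in finite_measure) Lp_space_2_norm_integrable:
  assumes f: "f \<in> Lp_space 2 M"
  shows "integrable M (\<lambda>x. norm (f x))"
    and "(\<integral>x. norm (f x) \<partial>M) \<le> Lp_norm 2 M f * Lp_norm 2 M (\<lambda>_. 1 :: real)"
proof -
  have 1: "(\<lambda>_. 1 :: real) \<in> Lp_space 2 M" by (simp add: Lp_space_def)
  show "integrable M (\<lambda>x. norm (f x))" using Lp_space_2_norm_mult[OF f 1] by simp
  show "(\<integral>x. norm (f x) \<partial>M) \<le> Lp_norm 2 M f * Lp_norm 2 M (\<lambda>_. 1 :: real)"
    using Lp_norm_2_Cauchy_Schwarz[OF f 1] by simp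
qed

section \<open>Weak gradients and continuous functions in L2\<close>

text \<open>Membership in \<open>sobolev\<close> supplies the witness for the choice in
  \<open>wderiv\<close>, so the chosen function is a genuine weak derivative.\<close>

lemma wderiv_Lp_space:
  assumes "u \<in> sobolev m \<Omega>" "1 \<le> a + b" "a + b \<le> m"
  shows "wderiv \<Omega> a b u \<in> Lp_space 2 (lebesgue_on \<Omega>)"
proof -
  have "\<exists>g. g \<in> Lp_space 2 (lebesgue_on \<Omega>) \<and> weak_deriv \<Omega> a b u g"
    using assms unfolding sobolev_def by blast
  then show ?thesis unfolding wderiv_def by (rule someI2_ex) blast
qed

lemma wgrad_Lp_space:
  assumes "u \<in> sobolev 1 \<Omega>"
  shows "wgrad \<Omega> u \<in> Lp_space 2 (lebesgue_on \<Omega>)"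
proof (rule Lp_space_2I)
  note D = wderiv_Lp_space[OF assms, of 1 0] wderiv_Lp_space[OF assms, of 0 1]
  have [measurable]: "wderiv \<Omega> 1 0 u \<in> borel_measurable (lebesgue_on \<Omega>)"
    "wderiv \<Omega> 0 1 u \<in> borel_measurable (lebesgue_on \<Omega>)"
    using D by (auto intro: Lp_space_measurable)
  have "wgrad \<Omega> u = (\<lambda>x. wderiv \<Omega> 1 0 u x *\<^sub>R axis 1 1 + wderiv \<Omega> 0 1 u x *\<^sub>R axis 2 1)"
    by (auto simp: wgrad_def fun_eq_iff vec_eq_iff forall_2 axis_def)
  then show "wgrad \<Omega> u \<in> borel_measurable (lebesgue_on \<Omega>)" by (simp only:) measurable
  show "integrable (lebesgue_on \<Omega>) (\<lambda>x. (norm (wderiv \<Omega> 1 0 u x))\<^sup>2 + (norm (wderiv \<Omega> 0 1 u x))\<^sup>2)"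
    by (intro Bochner_Integration.integrable_add Lp_space_2_integrable D) auto
  show "(norm (wgrad \<Omega> u x))\<^sup>2 \<le> (norm (wderiv \<Omega> 1 0 u x))\<^sup>2 + (norm (wderiv \<Omega> 0 1 u x))\<^sup>2" for x
    by (simp add: wgrad_def norm_vec_def L2_set_def sum_2)
qed

lemma finite_measure_lebesgue_on_bounded:
  assumes "open \<Omega>" "bounded \<Omega>"
  shows "finite_measure (lebesgue_on (\<Omega> :: 'a::euclidean_space set))"
  using assms by (intro finite_measure_lebesgue_on) (simp add: lmeasurable_open)

lemma continuous_Lp_space_lebesgue_on:
  fixes f :: "'a::euclidean_space \<Rightarrow> 'b::euclidean_space"
  assumes f: "continuous_on UNIV f" and \<Omega>: "open \<Omega>" "bounded \<Omega>"
  shows "f \<in> Lp_space 2 (lebesgue_on \<Omega>)"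
proof -
  interpret finite_measure "lebesgue_on \<Omega>" by (rule finite_measure_lebesgue_on_bounded[OF \<Omega>])
  have "compact (f ` closure \<Omega>)"
    using f \<Omega> by (intro compact_continuous_image) (auto intro: continuous_on_subset simp: compact_closure)
  then obtain C where C: "\<And>x. x \<in> closure \<Omega> \<Longrightarrow> norm (f x) \<le> C"
    by (metis bounded_iff compact_imp_bounded imageI)
  have [measurable]: "f \<in> borel_measurable (lebesgue_on \<Omega>)"
    by (intro measurable_restrict_space1 measurable_completion) (use f in \<open>auto intro: borel_measurable_continuous_onI\<close>)
  show ?thesis
  proof (rule Lp_space_2I)
    show "integrable (lebesgue_on \<Omega>) (\<lambda>_. C\<^sup>2)" by simp
    show "(norm (f x))\<^sup>2 \<le> C\<^sup>2" if "x \<in> space (lebesgue_on \<Omega>)" for x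
      using that C[of x] closure_subset[of \<Omega>] by (intro power_mono) auto
  qed measurable
qed

text \<open>f may be unbounded on the plane, but \<Gamma> is finite and carried by the compact
  frontier.\<close>

lemma continuous_Lp_space_arclength:
  fixes f :: "real^2 \<Rightarrow> real"
  assumes \<Omega>: "smooth_bounded_domain \<Omega>" and \<Gamma>: "arclength_measure (frontier \<Omega>) \<Gamma>"
    and f: "continuous_on UNIV f"
  shows "f \<in> Lp_space 2 \<Gamma>"
proof -
  interpret finite_measure \<Gamma> by (rule finite_measure_arclength[OF \<Omega> \<Gamma>])
  have s[measurable_cong]: "sets \<Gamma> = sets borel" using \<Gamma> by (simp add: arclength_measure_def)
  have [measurable]: "f \<in> borel_measurable borel" using f by (rule borel_measurable_continuous_onI)
  have "compact (frontier \<Omega>)" using \<Omega> by (simp add: smooth_bounded_domain_def compact_frontier_bounded)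
  then have "compact (f ` frontier \<Omega>)"
    using f by (intro compact_continuous_image) (auto intro: continuous_on_subset)
  then obtain C where C: "\<And>x. x \<in> frontier \<Omega> \<Longrightarrow> norm (f x) \<le> C"
    by (metis bounded_iff compact_imp_bounded imageI)
  have "AE x in \<Gamma>. x \<in> frontier \<Omega>"
    using \<Gamma> by (intro AE_I[of _ _ "- frontier \<Omega>"]) (auto simp: arclength_measure_def s)
  then have "AE x in \<Gamma>. norm ((norm (f x))\<^sup>2) \<le> C\<^sup>2"
  proof eventually_elim
    case (elim x)
    then have "(norm (f x))\<^sup>2 \<le> C\<^sup>2" by (intro power_mono C) auto
    then show ?case by simp
  qed
  then have "integrable \<Gamma> (\<lambda>x. (norm (f x))\<^sup>2)"
    by (rule integrable_const_bound) measurable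
  then show ?thesis by (simp add: Lp_space_def)
qed

text \<open>Finiteness of \<Gamma> makes the boundary integral a real number, so the extended
  inequality becomes one between Bochner integrals, ready for passing to the limit.\<close>

lemma divergence_bound_lebesgue_on:
  assumes \<Omega>: "smooth_bounded_domain \<Omega>" and \<Gamma>: "arclength_measure (frontier \<Omega>) \<Gamma>"
    and f: "C1_grad f G"
  shows "\<bar>\<integral>x. e \<bullet> G x \<partial>lebesgue_on \<Omega>\<bar> \<le> norm e * (\<integral>p. \<bar>f p\<bar> \<partial>\<Gamma>)"
proof -
  have op: "open \<Omega>" using \<Omega> by (simp add: smooth_bounded_domain_def)
  interpret finite_measure \<Gamma> by (rule finite_measure_arclength[OF \<Omega> \<Gamma>])
  have [measurable]: "\<Omega> \<in> sets borel" "G \<in> borel_measurable borel"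
    using op f by (auto simp: C1_grad_def intro: borel_measurable_continuous_onI)
  have "(\<integral>x. e \<bullet> G x \<partial>lebesgue_on \<Omega>) = (\<integral>x. indicator \<Omega> x * (e \<bullet> G x) \<partial>lborel)"
    by (subst integral_restrict_space) (simp_all add: integral_completion)
  moreover have "integrable \<Gamma> (\<lambda>p. norm (f p))"
    using continuous_Lp_space_arclength[OF \<Omega> \<Gamma> C1_grad_continuous_on[OF f]]
    by (rule Lp_space_2_norm_integrable)
  ultimately show ?thesis
    using divergence_bound[OF \<Omega> \<Gamma> f, of e]
    by (simp add: nn_integral_eq_integral ennreal_mult[symmetric] Bochner_Integration.integral_nonneg)
qed

section \<open>Divergence inequality for functions of a Sobolev function\<close>

text \<open>The C1 inequality holds for p composed with the approximating functions of the trace.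
  Boundedness and Lipschitz continuity of p' make both sides converge directly from the L2 norms,
  without a subsequence that converges pointwise.\<close>

lemma trace_divergence_bound:
  assumes \<Omega>: "smooth_bounded_domain \<Omega>" and \<Gamma>: "arclength_measure (frontier \<Omega>) \<Gamma>"
    and tr: "is_trace \<Omega> \<Gamma> u g"
    and p: "\<And>s. (p has_real_derivative p' s) (at s)" and p0: "p 0 = 0"
    and K: "\<And>s. \<bar>p' s\<bar> \<le> K" and L: "\<And>s t. \<bar>p' s - p' t\<bar> \<le> L * \<bar>s - t\<bar>"
  shows "\<bar>\<integral>x. p' (u x) * (e \<bullet> wgrad \<Omega> u x) \<partial>lebesgue_on \<Omega>\<bar> \<le> norm e * (\<integral>x. \<bar>p (g x)\<bar> \<partial>\<Gamma>)"
proof -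
  have op: "open \<Omega>" and bd: "bounded \<Omega>" using \<Omega> by (simp_all add: smooth_bounded_domain_def)
  let ?M = "lebesgue_on \<Omega>"
  interpret G: finite_measure \<Gamma> by (rule finite_measure_arclength[OF \<Omega> \<Gamma>])
  interpret M: finite_measure ?M by (rule finite_measure_lebesgue_on_bounded[OF op bd])
  obtain \<phi> where u: "u \<in> sobolev 1 \<Omega>" and g: "g \<in> Lp_space 2 \<Gamma>" and sm: "\<And>k. smooth (\<phi> k)"
    and l1: "(\<lambda>k. Lp_norm 2 ?M (\<lambda>x. \<phi> k x - u x)) \<longlonglongrightarrow> 0"
    and l2: "(\<lambda>k. Lp_norm 2 ?M (\<lambda>x. grad (\<phi> k) x - wgrad \<Omega> u x)) \<longlonglongrightarrow> 0"
    and l3: "(\<lambda>k. Lp_norm 2 \<Gamma> (\<lambda>x. \<phi> k x - g x)) \<longlonglongrightarrow> 0"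
    using tr unfolding is_trace_def by blast
  have u2: "u \<in> Lp_space 2 ?M" using u by (simp add: sobolev_def)
  note [measurable] = Lp_space_measurable[OF u2] Lp_space_measurable[OF g]
  note W = wgrad_Lp_space[OF u]
  have [measurable]: "wgrad \<Omega> u \<in> borel_measurable ?M" using W by (rule Lp_space_measurable)
  have K0: "0 \<le> K" using K[of 0] by linarith
  have L0: "0 \<le> L" using order_trans[OF abs_ge_zero L[of 0 1]] by simp
  have pK: "\<bar>p s - p t\<bar> \<le> K * \<bar>s - t\<bar>" for s t
    using field_differentiable_bound[of UNIV p p' K s t] p K by auto
  have pc: "continuous_on UNIV p" using p by (meson DERIV_isCont continuous_at_imp_continuous_on)
  have p'c: "continuous_on UNIV p'"
  proof -
    have "L-lipschitz_on UNIV p'" using L L0 by (auto intro!: lipschitz_onI simp: dist_real_def)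
    then show ?thesis by (rule lipschitz_on_continuous_on)
  qed
  have [measurable]: "p \<in> borel_measurable borel" "p' \<in> borel_measurable borel"
    using pc p'c by (auto intro: borel_measurable_continuous_onI)
  have C1: "C1_grad (\<phi> k) (grad (\<phi> k))" for k by (rule smooth_C1_grad[OF sm])
  have \<phi>M: "\<phi> k \<in> Lp_space 2 ?M" and \<phi>\<Gamma>: "\<phi> k \<in> Lp_space 2 \<Gamma>" and grM: "grad (\<phi> k) \<in> Lp_space 2 ?M" for k
    using C1_grad_continuous_on[OF C1] C1[of k]
    by (auto intro!: continuous_Lp_space_lebesgue_on continuous_Lp_space_arclength[OF \<Omega> \<Gamma>] op bd simp: C1_grad_def)
  note [measurable] = Lp_space_measurable[OF \<phi>M] Lp_space_measurable[OF \<phi>\<Gamma>] Lp_space_measurable[OF grM]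
  define A where "A k = (\<integral>x. p' (\<phi> k x) * (e \<bullet> grad (\<phi> k) x) \<partial>?M)" for k
  define A' where "A' = (\<integral>x. p' (u x) * (e \<bullet> wgrad \<Omega> u x) \<partial>?M)"
  define B where "B k = (\<integral>x. \<bar>p (\<phi> k x)\<bar> \<partial>\<Gamma>)" for k
  define B' where "B' = (\<integral>x. \<bar>p (g x)\<bar> \<partial>\<Gamma>)"
  have AB: "\<bar>A k\<bar> \<le> norm e * B k" for k
  proof -
    have "C1_grad (\<lambda>x. p (\<phi> k x)) (\<lambda>x. p' (\<phi> k x) *\<^sub>R grad (\<phi> k) x)"
      by (rule C1_grad_compose[OF C1 p]) (rule continuous_on_subset[OF p'c], simp)
    from divergence_bound_lebesgue_on[OF \<Omega> \<Gamma> this, of e] show ?thesis by (simp add: A_def B_def)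
  qed
  have ieg: "integrable ?M (\<lambda>x. norm (v x))" if "v \<in> Lp_space 2 ?M" for v :: "real^2 \<Rightarrow> real^2"
    using that by (rule M.Lp_space_2_norm_integrable)
  have iM: "integrable ?M (\<lambda>x. p' (w x) * (e \<bullet> v x))"
    if [measurable]: "w \<in> borel_measurable ?M" and v: "v \<in> Lp_space 2 ?M" for w v
  proof (rule Bochner_Integration.integrable_bound)
    show "integrable ?M (\<lambda>x. (K * norm e) * norm (v x))" using ieg[OF v] by simp
    have [measurable]: "v \<in> borel_measurable ?M" using v by (rule Lp_space_measurable)
    show "(\<lambda>x. p' (w x) * (e \<bullet> v x)) \<in> borel_measurable ?M" by measurable
    show "AE x in ?M. norm (p' (w x) * (e \<bullet> v x)) \<le> norm ((K * norm e) * norm (v x))"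
    proof (rule AE_I2)
      fix x
      have "\<bar>p' (w x)\<bar> * \<bar>e \<bullet> v x\<bar> \<le> K * (norm e * norm (v x))"
        by (intro mult_mono K Cauchy_Schwarz_ineq2 K0) auto
      then show "norm (p' (w x) * (e \<bullet> v x)) \<le> norm ((K * norm e) * norm (v x))"
        using K0 by (simp add: abs_mult mult.assoc)
    qed
  qed
  have "A \<longlonglongrightarrow> A'"
  proof (rule LIM_zero_cancel, rule Lim_null_comparison)
    let ?d = "\<lambda>k x. grad (\<phi> k) x - wgrad \<Omega> u x"
    let ?b = "\<lambda>k. K * norm e * (Lp_norm 2 ?M (?d k) * Lp_norm 2 ?M (\<lambda>_. 1 :: real))
       + L * norm e * (Lp_norm 2 ?M (\<lambda>x. \<phi> k x - u x) * Lp_norm 2 ?M (wgrad \<Omega> u))"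
    show "\<forall>\<^sub>F k in sequentially. norm (A k - A') \<le> ?b k"
    proof (rule always_eventually, rule allI)
      fix k
      have d: "?d k \<in> Lp_space 2 ?M" by (intro Lp_space_2_diff grM W)
      have d': "(\<lambda>x. \<phi> k x - u x) \<in> Lp_space 2 ?M" by (intro Lp_space_2_diff \<phi>M u2)
      have i2: "integrable ?M (\<lambda>x. norm (\<phi> k x - u x) * norm (wgrad \<Omega> u x))"
        by (rule Lp_space_2_norm_mult[OF d' W])
      have "A k - A' = (\<integral>x. p' (\<phi> k x) * (e \<bullet> grad (\<phi> k) x) - p' (u x) * (e \<bullet> wgrad \<Omega> u x) \<partial>?M)"
        unfolding A_def A'_def
        by (intro Bochner_Integration.integral_diff[symmetric] iM grM W) measurable
      then have "norm (A k - A') \<le> (\<integral>x. \<bar>p' (\<phi> k x) * (e \<bullet> grad (\<phi> k) x) - p' (u x) * (e \<bullet> wgrad \<Omega> u x)\<bar> \<partial>?M)"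
        by (simp add: integral_abs_bound)
      also have "\<dots> \<le> (\<integral>x. K * norm e * norm (?d k x) + L * norm e * (norm (\<phi> k x - u x) * norm (wgrad \<Omega> u x)) \<partial>?M)"
      proof (rule integral_mono)
        show "integrable ?M (\<lambda>x. \<bar>p' (\<phi> k x) * (e \<bullet> grad (\<phi> k) x) - p' (u x) * (e \<bullet> wgrad \<Omega> u x)\<bar>)"
          by (intro integrable_abs Bochner_Integration.integrable_diff iM grM W) measurable
        show "integrable ?M (\<lambda>x. K * norm e * norm (?d k x) + L * norm e * (norm (\<phi> k x - u x) * norm (wgrad \<Omega> u x)))"
          using ieg[OF d] i2 by simp
        fix x
        \<comment> \<open>In the first product p' is bounded and the gradients converge. In the
          second, p' differs by at most L times the difference of the values, and the fixed gradient
          is square-integrable, so Cauchy-Schwarz applies.\<close>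
        have "p' (\<phi> k x) * (e \<bullet> grad (\<phi> k) x) - p' (u x) * (e \<bullet> wgrad \<Omega> u x)
          = p' (\<phi> k x) * (e \<bullet> ?d k x) + (p' (\<phi> k x) - p' (u x)) * (e \<bullet> wgrad \<Omega> u x)"
          by (simp add: algebra_simps)
        also have "\<bar>\<dots>\<bar> \<le> \<bar>p' (\<phi> k x)\<bar> * \<bar>e \<bullet> ?d k x\<bar> + \<bar>p' (\<phi> k x) - p' (u x)\<bar> * \<bar>e \<bullet> wgrad \<Omega> u x\<bar>"
          unfolding abs_mult[symmetric] by (rule abs_triangle_ineq)
        also have "\<dots> \<le> K * (norm e * norm (?d k x)) + (L * \<bar>\<phi> k x - u x\<bar>) * (norm e * norm (wgrad \<Omega> u x))"
          by (intro add_mono mult_mono K L Cauchy_Schwarz_ineq2) (auto simp: K0 L0)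
        finally show "\<bar>p' (\<phi> k x) * (e \<bullet> grad (\<phi> k) x) - p' (u x) * (e \<bullet> wgrad \<Omega> u x)\<bar>
          \<le> K * norm e * norm (?d k x) + L * norm e * (norm (\<phi> k x - u x) * norm (wgrad \<Omega> u x))"
          by (simp add: mult_ac)
      qed
      also have "\<dots> = K * norm e * (\<integral>x. norm (?d k x) \<partial>?M) + L * norm e * (\<integral>x. norm (\<phi> k x - u x) * norm (wgrad \<Omega> u x) \<partial>?M)"
        using ieg[OF d] i2 by simp
      also have "\<dots> \<le> ?b k"
        by (intro add_mono mult_left_mono M.Lp_space_2_norm_integrable d Lp_norm_2_Cauchy_Schwarz d' W)
           (auto simp: K0 L0)
      finally show "norm (A k - A') \<le> ?b k" .
    qed
    have "?b \<longlonglongrightarrow> K * norm e * (0 * Lp_norm 2 ?M (\<lambda>_. 1 :: real)) + L * norm e * (0 * Lp_norm 2 ?M (wgrad \<Omega> u))"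
      by (intro tendsto_intros l1 l2)
    then show "?b \<longlonglongrightarrow> 0" by simp
  qed
  moreover have "B \<longlonglongrightarrow> B'"
  proof (rule LIM_zero_cancel, rule Lim_null_comparison)
    let ?b = "\<lambda>k. K * (Lp_norm 2 \<Gamma> (\<lambda>x. \<phi> k x - g x) * Lp_norm 2 \<Gamma> (\<lambda>_. 1 :: real))"
    \<comment> \<open>Since p 0 = 0 and p is K-Lipschitz, |p| grows at most linearly, and L2 is
      contained in L1 for the finite measure \<Gamma>.\<close>
    have i: "integrable \<Gamma> (\<lambda>x. \<bar>p (v x)\<bar>)" if v: "v \<in> Lp_space 2 \<Gamma>" for v
    proof (rule Bochner_Integration.integrable_bound)
      show "integrable \<Gamma> (\<lambda>x. K * norm (v x))" using G.Lp_space_2_norm_integrable(1)[OF v] by simp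
      have [measurable]: "v \<in> borel_measurable \<Gamma>" using v by (rule Lp_space_measurable)
      show "(\<lambda>x. \<bar>p (v x)\<bar>) \<in> borel_measurable \<Gamma>" by measurable
      show "AE x in \<Gamma>. norm \<bar>p (v x)\<bar> \<le> norm (K * norm (v x))"
        using pK[of _ 0] p0 K0 by (simp add: abs_mult)
    qed
    show "\<forall>\<^sub>F k in sequentially. norm (B k - B') \<le> ?b k"
    proof (rule always_eventually, rule allI)
      fix k
      have d: "(\<lambda>x. \<phi> k x - g x) \<in> Lp_space 2 \<Gamma>" by (intro Lp_space_2_diff \<phi>\<Gamma> g)
      have "B k - B' = (\<integral>x. \<bar>p (\<phi> k x)\<bar> - \<bar>p (g x)\<bar> \<partial>\<Gamma>)"
        unfolding B_def B'_def by (intro Bochner_Integration.integral_diff[symmetric] i \<phi>\<Gamma> g)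
      then have "norm (B k - B') \<le> (\<integral>x. \<bar>\<bar>p (\<phi> k x)\<bar> - \<bar>p (g x)\<bar>\<bar> \<partial>\<Gamma>)"
        by (simp add: integral_abs_bound)
      also have "\<dots> \<le> (\<integral>x. K * norm (\<phi> k x - g x) \<partial>\<Gamma>)"
      proof (rule integral_mono)
        show "integrable \<Gamma> (\<lambda>x. \<bar>\<bar>p (\<phi> k x)\<bar> - \<bar>p (g x)\<bar>\<bar>)"
          by (intro integrable_abs Bochner_Integration.integrable_diff i \<phi>\<Gamma> g)
        show "integrable \<Gamma> (\<lambda>x. K * norm (\<phi> k x - g x))" using G.Lp_space_2_norm_integrable(1)[OF d] by simp
        show "\<bar>\<bar>p (\<phi> k x)\<bar> - \<bar>p (g x)\<bar>\<bar> \<le> K * norm (\<phi> k x - g x)" for x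
          using pK[of "\<phi> k x" "g x"] by simp
      qed
      also have "\<dots> \<le> ?b k"
        using G.Lp_space_2_norm_integrable(2)[OF d] K0 by (simp add: mult_left_mono)
      finally show "norm (B k - B') \<le> ?b k" .
    qed
    have "?b \<longlonglongrightarrow> K * (0 * Lp_norm 2 \<Gamma> (\<lambda>_. 1 :: real))"
      by (intro tendsto_intros l3)
    then show "?b \<longlonglongrightarrow> 0" by simp
  qed
  ultimately have "\<bar>A'\<bar> \<le> norm e * B'"
    by (intro LIMSEQ_le[OF tendsto_rabs tendsto_mult_left]) (use AB in auto)
  then show ?thesis by (simp add: A'_def B'_def)
qed

text \<open>The quotient is the difference quotient at 0 of h |-> sin (s h), whose derivative there
  is s.\<close>

lemma tendsto_sin_div: "(\<lambda>n. sin (s * inverse (real (Suc n))) / inverse (real (Suc n))) \<longlonglongrightarrow> s"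
proof -
  have "((\<lambda>h. sin (s * h)) has_real_derivative s) (at 0)"
    by (auto intro!: derivative_eq_intros)
  then have "((\<lambda>h. sin (s * h) / h) \<longlongrightarrow> s) (at 0)"
    by (simp add: DERIV_def)
  moreover have "filterlim (\<lambda>n. inverse (real (Suc n))) (at 0) sequentially"
    using LIMSEQ_inverse_real_of_nat by (simp add: filterlim_at)
  ultimately show ?thesis by (rule filterlim_compose)
qed

text \<open>For m > 0 the power Suc m has an unbounded derivative, so the previous inequality does
  not apply to it. The substitute sin (h s) / h is at most |s| in absolute value and tends to s: the
  boundary term is bounded by the target for every h, and dominated convergence handles the interior
  term.\<close>

lemma trace_divergence_bound_power:
  assumes \<Omega>: "smooth_bounded_domain \<Omega>" and \<Gamma>: "arclength_measure (frontier \<Omega>) \<Gamma>"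
    and tr: "is_trace \<Omega> \<Gamma> u g"
    and iM: "integrable (lebesgue_on \<Omega>) (\<lambda>x. (u x) ^ m * (e \<bullet> wgrad \<Omega> u x))"
    and i\<Gamma>: "integrable \<Gamma> (\<lambda>x. \<bar>g x\<bar> ^ Suc m)"
  shows "real (Suc m) * \<bar>\<integral>x. (u x) ^ m * (e \<bullet> wgrad \<Omega> u x) \<partial>lebesgue_on \<Omega>\<bar>
    \<le> norm e * (\<integral>x. \<bar>g x\<bar> ^ Suc m \<partial>\<Gamma>)"
proof -
  let ?M = "lebesgue_on \<Omega>"
  define h where "h n = inverse (real (Suc n))" for n
  have h: "0 < h n" for n by (simp add: h_def)
  define S where "S n s = sin (s * h n) / h n" for n s
  \<comment> \<open>P n is dominated by the power Suc m and has a bounded, Lipschitz continuous derivative.\<close>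
  define P where "P n s = (S n s) ^ Suc m" for n s
  define P' where "P' n s = real (Suc m) * (S n s) ^ m * cos (s * h n)" for n s
  \<comment> \<open>The second derivative, used for the Lipschitz constant. For m = 0 the exponent m
    - 1 is truncated to 0, but the factor \<open>real m\<close> cancels that term.\<close>
  define P'' where "P'' n s = real (Suc m) * (real m * (S n s) ^ (m - 1) * cos (s * h n) * cos (s * h n)
      - (S n s) ^ m * (sin (s * h n) * h n))" for n s
  have dS: "(S n has_real_derivative cos (s * h n)) (at s)" for n s
    unfolding S_def using h[of n] by (auto intro!: derivative_eq_intros)
  have dP: "(P n has_real_derivative P' n s) (at s)" for n s
    unfolding P_def P'_def using DERIV_power[OF dS[of n s], of "Suc m"] by (simp add: mult_ac del: power_Suc)
  have dP': "(P' n has_real_derivative P'' n s) (at s)" for n s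
    unfolding P'_def P''_def
    by (auto intro!: derivative_eq_intros dS simp: algebra_simps)
  have Sh: "\<bar>S n s\<bar> \<le> 1 / h n" for n s
    using h[of n] abs_sin_le_one[of "s * h n"] by (simp add: S_def divide_right_mono)
  have Ss: "\<bar>S n s\<bar> \<le> \<bar>s\<bar>" for n s
    using h[of n] abs_sin_x_le_abs_x[of "s * h n"] by (simp add: S_def abs_mult field_simps)
  have SP: "\<bar>S n s ^ k\<bar> \<le> (1 / h n) ^ k" for n s k
    unfolding power_abs by (intro power_mono Sh) auto
  have Kb: "\<bar>P' n s\<bar> \<le> real (Suc m) * (1 / h n) ^ m" for n s
  proof -
    have "\<bar>S n s ^ m\<bar> * \<bar>cos (s * h n)\<bar> \<le> (1 / h n) ^ m * 1"
      using h[of n] by (intro mult_mono SP abs_cos_le_one) auto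
    then show ?thesis by (simp add: P'_def abs_mult mult.assoc del: of_nat_Suc)
  qed
  have Lb: "\<bar>P'' n s\<bar> \<le> real (Suc m) * (real m * (1 / h n) ^ (m - 1) + (1 / h n) ^ m * h n)" for n s
  proof -
    have "\<bar>S n s ^ (m - 1)\<bar> * \<bar>cos (s * h n) * cos (s * h n)\<bar> \<le> (1 / h n) ^ (m - 1) * (1 * 1)"
      unfolding abs_mult[of "cos _" "cos _"]
      using h[of n] by (intro mult_mono SP abs_cos_le_one) auto
    then have 1: "\<bar>real m * (S n s) ^ (m - 1) * cos (s * h n) * cos (s * h n)\<bar> \<le> real m * (1 / h n) ^ (m - 1)"
      by (simp add: abs_mult mult.assoc mult_left_mono)
    have "\<bar>S n s ^ m\<bar> * \<bar>sin (s * h n) * h n\<bar> \<le> (1 / h n) ^ m * (1 * h n)"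
      unfolding abs_mult[of "sin _" "h n"]
      using h[of n] by (intro mult_mono SP abs_sin_le_one) auto
    then have 2: "\<bar>(S n s) ^ m * (sin (s * h n) * h n)\<bar> \<le> (1 / h n) ^ m * h n"
      by (simp add: abs_mult)
    have "\<bar>real m * (S n s) ^ (m - 1) * cos (s * h n) * cos (s * h n) - (S n s) ^ m * (sin (s * h n) * h n)\<bar>
      \<le> real m * (1 / h n) ^ (m - 1) + (1 / h n) ^ m * h n"
      using 1 2 by (rule order_trans[OF abs_triangle_ineq4 add_mono])
    then show ?thesis unfolding P''_def abs_mult[of "real (Suc m)"] by (simp add: mult_left_mono del: of_nat_Suc)
  qed
  have Lip: "\<bar>P' n s - P' n t\<bar> \<le> real (Suc m) * (real m * (1 / h n) ^ (m - 1) + (1 / h n) ^ m * h n) * \<bar>s - t\<bar>" for n s t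
    using field_differentiable_bound[of UNIV "P' n" "P'' n" _ s t] dP' Lb by auto
  have u2: "u \<in> Lp_space 2 ?M" and g2: "g \<in> Lp_space 2 \<Gamma>" and u1: "u \<in> sobolev 1 \<Omega>"
    using tr by (auto simp: is_trace_def sobolev_def)
  have [measurable]: "u \<in> borel_measurable ?M" "wgrad \<Omega> u \<in> borel_measurable ?M" "g \<in> borel_measurable \<Gamma>"
    using u2 g2 wgrad_Lp_space[OF u1] by (auto intro: Lp_space_measurable)
  have mP[measurable]: "P n \<in> borel_measurable borel" "P' n \<in> borel_measurable borel" for n
    unfolding P_def P'_def S_def by measurable
  have bound: "\<bar>\<integral>x. P' n (u x) * (e \<bullet> wgrad \<Omega> u x) \<partial>?M\<bar> \<le> norm e * (\<integral>x. \<bar>g x\<bar> ^ Suc m \<partial>\<Gamma>)" for n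
  proof -
    have "\<bar>\<integral>x. P' n (u x) * (e \<bullet> wgrad \<Omega> u x) \<partial>?M\<bar> \<le> norm e * (\<integral>x. \<bar>P n (g x)\<bar> \<partial>\<Gamma>)"
      by (rule trace_divergence_bound[OF \<Omega> \<Gamma> tr dP _ Kb Lip]) (simp add: P_def S_def)
    also have "\<dots> \<le> norm e * (\<integral>x. \<bar>g x\<bar> ^ Suc m \<partial>\<Gamma>)"
    proof (intro mult_left_mono integral_mono i\<Gamma>)
      have le: "\<bar>P n s\<bar> \<le> \<bar>s\<bar> ^ Suc m" for s
        unfolding P_def power_abs by (intro power_mono Ss) auto
      then show "\<bar>P n (g x)\<bar> \<le> \<bar>g x\<bar> ^ Suc m" for x .
      show "integrable \<Gamma> (\<lambda>x. \<bar>P n (g x)\<bar>)"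
        by (rule Bochner_Integration.integrable_bound[OF i\<Gamma>]) (use le in \<open>auto simp del: power_Suc\<close>)
    qed simp
    finally show ?thesis .
  qed
  have "(\<lambda>n. \<integral>x. P' n (u x) * (e \<bullet> wgrad \<Omega> u x) \<partial>?M)
     \<longlonglongrightarrow> (\<integral>x. real (Suc m) * ((u x) ^ m * (e \<bullet> wgrad \<Omega> u x)) \<partial>?M)"
  proof (rule integral_dominated_convergence[where w = "\<lambda>x. real (Suc m) * \<bar>(u x) ^ m * (e \<bullet> wgrad \<Omega> u x)\<bar>"])
    show "integrable ?M (\<lambda>x. real (Suc m) * \<bar>(u x) ^ m * (e \<bullet> wgrad \<Omega> u x)\<bar>)"
      using iM by (intro integrable_mult_right integrable_abs)
    show "AE x in ?M. (\<lambda>n. P' n (u x) * (e \<bullet> wgrad \<Omega> u x)) \<longlonglongrightarrow> real (Suc m) * ((u x) ^ m * (e \<bullet> wgrad \<Omega> u x))"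
    proof (rule AE_I2)
      fix x
      have h0: "h \<longlonglongrightarrow> 0" unfolding h_def by (rule LIMSEQ_inverse_real_of_nat)
      have "(\<lambda>n. S n (u x)) \<longlonglongrightarrow> u x" unfolding S_def h_def by (rule tendsto_sin_div)
      then have "(\<lambda>n. P' n (u x) * (e \<bullet> wgrad \<Omega> u x))
        \<longlonglongrightarrow> real (Suc m) * (u x) ^ m * cos (u x * 0) * (e \<bullet> wgrad \<Omega> u x)"
        unfolding P'_def by (intro tendsto_intros h0)
      then show "(\<lambda>n. P' n (u x) * (e \<bullet> wgrad \<Omega> u x)) \<longlonglongrightarrow> real (Suc m) * ((u x) ^ m * (e \<bullet> wgrad \<Omega> u x))"
        by (simp add: mult.assoc del: of_nat_Suc)
    qed
    show "AE x in ?M. norm (P' n (u x) * (e \<bullet> wgrad \<Omega> u x)) \<le> real (Suc m) * \<bar>(u x) ^ m * (e \<bullet> wgrad \<Omega> u x)\<bar>" for n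
    proof (rule AE_I2)
      fix x
      have "\<bar>S n (u x)\<bar> ^ m * \<bar>cos (u x * h n)\<bar> \<le> \<bar>u x\<bar> ^ m * 1"
        by (intro mult_mono power_mono Ss abs_cos_le_one) auto
      then have "real (Suc m) * (\<bar>S n (u x)\<bar> ^ m * \<bar>cos (u x * h n)\<bar>) * \<bar>e \<bullet> wgrad \<Omega> u x\<bar>
        \<le> real (Suc m) * \<bar>u x\<bar> ^ m * \<bar>e \<bullet> wgrad \<Omega> u x\<bar>"
        by (intro mult_right_mono mult_left_mono) auto
      then show "norm (P' n (u x) * (e \<bullet> wgrad \<Omega> u x)) \<le> real (Suc m) * \<bar>(u x) ^ m * (e \<bullet> wgrad \<Omega> u x)\<bar>"
        by (simp add: P'_def abs_mult power_abs mult.assoc del: of_nat_Suc)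
    qed
  qed measurable
  then have "\<bar>\<integral>x. real (Suc m) * ((u x) ^ m * (e \<bullet> wgrad \<Omega> u x)) \<partial>?M\<bar> \<le> norm e * (\<integral>x. \<bar>g x\<bar> ^ Suc m \<partial>\<Gamma>)"
    by (intro LIMSEQ_le_const2[OF tendsto_rabs]) (use bound in auto)
  then show ?thesis by (simp add: abs_mult del: of_nat_Suc)
qed

section \<open>The energy in time\<close>

lemma inner_L2_commute: "inner_L2 M f g = inner_L2 M g f"
  by (simp add: inner_L2_def inner_commute)

lemma inner_L2_self: "inner_L2 M f f = (Lp_norm 2 M f)\<^sup>2"
  by (simp add: inner_L2_def Lp_norm_power power2_norm_eq_inner)

lemma inner_L2_diff_right:
  assumes "f \<in> Lp_space 2 M" "g \<in> Lp_space 2 M" "h \<in> Lp_space 2 M"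
  shows "inner_L2 M f (\<lambda>x. g x - h x) = inner_L2 M f g - inner_L2 M f h"
  using Lp_space_2_inner[OF assms(1,2)] Lp_space_2_inner[OF assms(1,3)]
  by (simp add: inner_L2_def inner_diff_right)

lemma AE_lebesgue_neq: "AE x in lebesgue. x \<noteq> (c :: real)"
  by (rule AE_completion[OF AE_lborel_singleton])

lemma set_integral_Icc_combine:
  fixes f :: "real \<Rightarrow> real"
  assumes "a \<le> b" "b \<le> c" "set_integrable lebesgue {a..c} f"
  shows "(LINT s:{a..c}|lebesgue. f s) = (LINT s:{a..b}|lebesgue. f s) + (LINT s:{b..c}|lebesgue. f s)"
proof -
  have i: "set_integrable lebesgue {a..b} f" "set_integrable lebesgue {b..c} f"
    using assms by (auto intro: set_integrable_subset)
  show ?thesis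
    using Henstock_Kurzweil_Integration.integral_combine[of a b c f] assms
      set_lebesgue_integral_eq_integral[OF i(1)] set_lebesgue_integral_eq_integral[OF i(2)]
      set_lebesgue_integral_eq_integral[OF assms(3)]
    by simp
qed

lemma set_integral_Icc_abs_bound:
  fixes f :: "real \<Rightarrow> real"
  assumes "a \<le> b" and i: "set_integrable lebesgue {a..b} f"
    and C: "AE s in lebesgue. s \<in> {a..b} \<longrightarrow> \<bar>f s\<bar> \<le> C"
  shows "\<bar>LINT s:{a..b}|lebesgue. f s\<bar> \<le> C * (b - a)"
proof -
  have "\<bar>LINT s:{a..b}|lebesgue. f s\<bar> \<le> (LINT s:{a..b}|lebesgue. \<bar>f s\<bar>)"
    using set_integral_norm_bound[OF i] by simp
  also have "\<dots> \<le> (LINT s:{a..b}|lebesgue. C)"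
    using C by (intro set_integral_mono_AE set_integrable_abs[OF i]
      absolutely_integrable_continuous_real continuous_on_const) auto
  also have "\<dots> = C * (b - a)"
    using assms(1) by (simp add: set_lebesgue_integral_def)
  finally show ?thesis .
qed

text \<open>On a division into n + 1 equal pieces the quadratic errors add up to K T^2 / (n + 1).
  This replaces a chain rule for \<Phi>, which need not be known to be differentiable.\<close>

lemma increment_eq_integral:
  fixes \<Phi> h :: "real \<Rightarrow> real"
  assumes T: "0 \<le> T" and i: "set_integrable lebesgue {0..T} h"
    and q: "\<And>a b. 0 \<le> a \<Longrightarrow> a \<le> b \<Longrightarrow> b \<le> T \<Longrightarrow> \<bar>\<Phi> b - \<Phi> a - (LINT s:{a..b}|lebesgue. h s)\<bar> \<le> K * (b - a)\<^sup>2"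
  shows "\<Phi> T - \<Phi> 0 = (LINT s:{0..T}|lebesgue. h s)"
proof -
  have le: "\<bar>\<Phi> T - \<Phi> 0 - (LINT s:{0..T}|lebesgue. h s)\<bar> \<le> K * T\<^sup>2 * inverse (real (Suc n))" for n
  proof -
    define d where "d = T / real (Suc n)"
    have d: "0 \<le> d" "real (Suc n) * d = T" using T by (simp_all add: d_def)
    have "\<bar>\<Phi> (real k * d) - \<Phi> 0 - (LINT s:{0..real k * d}|lebesgue. h s)\<bar> \<le> real k * (K * d\<^sup>2)"
      if "k \<le> Suc n" for k
      using that
    proof (induction k)
      case 0
      have "(LINT s:{0..0}|lebesgue. h s) = integral {0..0} h"
        using T by (intro set_lebesgue_integral_eq_integral set_integrable_subset[OF i]) auto
      then show ?case by simp
    next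
      case (Suc k)
      have kd: "0 \<le> real k * d" "real k * d \<le> real (Suc k) * d" "real (Suc k) * d \<le> T"
        using d Suc.prems mult_right_mono[of "real (Suc k)" "real (Suc n)" d] by (auto simp: algebra_simps)
      have "(LINT s:{0..real (Suc k) * d}|lebesgue. h s)
        = (LINT s:{0..real k * d}|lebesgue. h s) + (LINT s:{real k * d..real (Suc k) * d}|lebesgue. h s)"
        using kd by (intro set_integral_Icc_combine set_integrable_subset[OF i]) auto
      moreover have "real (Suc k) * d - real k * d = d" by (simp add: algebra_simps)
      ultimately show ?case
        using q[OF kd] Suc by (simp add: algebra_simps)
    qed
    from this[of "Suc n"] have "\<bar>\<Phi> T - \<Phi> 0 - (LINT s:{0..T}|lebesgue. h s)\<bar> \<le> real (Suc n) * (K * d\<^sup>2)"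
      unfolding d(2) by simp
    also have "\<dots> = K * T\<^sup>2 * inverse (real (Suc n))"
      by (simp add: d_def power2_eq_square field_simps del: of_nat_Suc)
    finally show ?thesis .
  qed
  have "(\<lambda>n. K * T\<^sup>2 * inverse (real (Suc n))) \<longlonglongrightarrow> K * T\<^sup>2 * 0"
    by (intro tendsto_intros LIMSEQ_inverse_real_of_nat)
  then have "\<bar>\<Phi> T - \<Phi> 0 - (LINT s:{0..T}|lebesgue. h s)\<bar> \<le> 0"
    using le by (intro LIMSEQ_le_const) auto
  then show ?thesis by simp
qed

lemma exp_diff_le: "x \<le> y \<Longrightarrow> \<bar>exp x - exp y\<bar> \<le> (y - x) * exp (y :: real)"
proof -
  assume "x \<le> y"
  have "1 - exp (x - y) \<le> y - x"
    using exp_ge_add_one_self[of "x - y"] by linarith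
  then have "exp y * (1 - exp (x - y)) \<le> exp y * (y - x)" by (rule mult_left_mono) simp
  moreover have "exp y * (1 - exp (x - y)) = exp y - exp x"
    by (simp add: right_diff_distrib exp_add[symmetric])
  moreover have "\<bar>exp x - exp y\<bar> = exp y - exp x" using \<open>x \<le> y\<close> by simp
  ultimately show ?thesis by (metis mult.commute)
qed

text \<open>On a short interval [a, b] the increment of the squared norm is obtained by testing with
  the fixed functions w a and w b. Replacing them by w t costs O(b - a) under the integral, since w
  is Lipschitz in L2, so the total error is quadratic. H is a function of its own because the
  desired integrand is controlled only at almost every time.\<close>

lemma time_derivative_energy:
  assumes td: "time_derivative \<Omega> w wt"
    and w: "\<And>t. 0 \<le> t \<Longrightarrow> w t \<in> Lp_space 2 (lebesgue_on \<Omega>)"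
    and wt: "AE t in lebesgue. 0 < t \<longrightarrow> wt t \<in> Lp_space 2 (lebesgue_on \<Omega>) \<and> Lp_norm 2 (lebesgue_on \<Omega>) (wt t) \<le> C"
    and T: "0 \<le> T" and \<alpha>: "0 \<le> \<alpha>"
  obtains H where "set_integrable lebesgue {0..T} H"
    "AE t in lebesgue. t \<in> {0..T} \<longrightarrow> H t = exp (2 * \<alpha> * t) *
       (2 * \<alpha> * (Lp_norm 2 (lebesgue_on \<Omega>) (w t))\<^sup>2 + 2 * inner_L2 (lebesgue_on \<Omega>) (wt t) (w t))"
    "exp (2 * \<alpha> * T) * (Lp_norm 2 (lebesgue_on \<Omega>) (w T))\<^sup>2 - (Lp_norm 2 (lebesgue_on \<Omega>) (w 0))\<^sup>2
       = (LINT t:{0..T}|lebesgue. H t)"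
proof -
  let ?M = "lebesgue_on \<Omega>"
  let ?n = "Lp_norm 2 ?M"
  let ?i = "inner_L2 ?M"
  obtain N where N: "N \<in> null_sets lebesgue"
    and good: "\<And>t. 0 < t \<Longrightarrow> t \<notin> N \<Longrightarrow> wt t \<in> Lp_space 2 ?M \<and> ?n (wt t) \<le> C"
    by (rule AE_E3[OF wt], rule that) auto
  have wt': "AE t in lebesgue. 0 \<le> t \<longrightarrow> 0 < t \<and> t \<notin> N"
    using AE_not_in[OF N] AE_lebesgue_neq[of 0] by eventually_elim auto
  have C: "0 \<le> C"
  proof -
    \<comment> \<open>The bound C is attached to almost every positive time; as [0, 1] is not null,
      at least one such time exists, and a norm there is at most C.\<close>
    have "\<not> (AE t in lebesgue. \<not> (0 \<le> t \<and> t \<le> (1::real)))"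
    proof
      assume "AE t in lebesgue. \<not> (0 \<le> t \<and> t \<le> (1::real))"
      then have "emeasure lebesgue {0..1::real} = 0"
        by (subst (asm) AE_iff_measurable[of "{0..1}"]) auto
      then show False by simp
    qed
    then obtain t where "0 < t" "t \<notin> N"
      using eventually_mono[OF wt', of "\<lambda>t. \<not> (0 \<le> t \<and> t \<le> 1)"] by blast
    then show ?thesis using good[of t] Lp_norm_nonneg[of 2 ?M "wt t"] by linarith
  qed
  have inc: "?i (w t) v - ?i (w s) v = (LINT \<tau>:{s..t}|lebesgue. ?i (wt \<tau>) v)"
    and int: "set_integrable lebesgue {s..t} (\<lambda>\<tau>. ?i (wt \<tau>) v)"
    if "0 \<le> s" "s \<le> t" "v \<in> Lp_space 2 ?M" for s t v
    using td that unfolding time_derivative_def by auto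
  have CS: "\<bar>?i (wt \<tau>) v\<bar> \<le> C * ?n v" if "0 < \<tau>" "\<tau> \<notin> N" "v \<in> Lp_space 2 ?M" for \<tau> v
    using good[OF that(1,2)] inner_L2_Cauchy_Schwarz[of "wt \<tau>" ?M v] that(3)
    by (meson Lp_norm_nonneg mult_right_mono order_trans)
  have lip: "?n (\<lambda>x. w t x - w s x) \<le> C * (t - s)" if st: "0 \<le> s" "s \<le> t" for s t
  proof -
    let ?v = "\<lambda>x. w t x - w s x"
    have v: "?v \<in> Lp_space 2 ?M" using w st by (intro Lp_space_2_diff) auto
    \<comment> \<open>The increment is tested with itself, so that one factor of its norm cancels at
      the end.\<close>
    have "(?n ?v)\<^sup>2 = ?i (w t) ?v - ?i (w s) ?v"
      using inner_L2_diff_right[OF v w[of t] w[of s]] st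
      by (simp add: inner_L2_self[symmetric] inner_L2_commute)
    also have "\<dots> \<le> \<bar>LINT \<tau>:{s..t}|lebesgue. ?i (wt \<tau>) ?v\<bar>"
      using inc[OF st v] by simp
    also have "\<dots> \<le> (C * ?n ?v) * (t - s)"
    proof (rule set_integral_Icc_abs_bound[OF st(2) int[OF st v]])
      show "AE \<tau> in lebesgue. \<tau> \<in> {s..t} \<longrightarrow> \<bar>?i (wt \<tau>) ?v\<bar> \<le> C * ?n ?v"
        using wt' by eventually_elim (use CS v st in auto)
    qed
    finally have "?n ?v * ?n ?v \<le> ?n ?v * (C * (t - s))" by (simp add: power2_eq_square mult_ac)
    then show ?thesis
      using C st Lp_norm_nonneg[of 2 ?M ?v] by (cases "?n ?v = 0") auto
  qed
  have lip': "?n (\<lambda>x. w t x - w s x) \<le> C * d" if "0 \<le> s" "0 \<le> t" "\<bar>t - s\<bar> \<le> d" for s t d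
  proof -
    have "?n (\<lambda>x. w t x - w s x) \<le> C * \<bar>t - s\<bar>"
    proof (cases "s \<le> t")
      case False
      have "?n (\<lambda>x. w t x - w s x) = ?n (\<lambda>x. w s x - w t x)"
        by (simp add: Lp_norm_def abs_minus_commute power2_commute)
      then show ?thesis using lip[of t s] False that by simp
    qed (use lip that in auto)
    also have "\<dots> \<le> C * d" using that C by (intro mult_left_mono) auto
    finally show ?thesis .
  qed
  \<comment> \<open>A bound for the norm of w on [0, T], from the Lipschitz estimate starting at
    time 0.\<close>
  define R where "R = C * T + ?n (w 0)"
  have R0: "0 \<le> R" using C T by (simp add: R_def Lp_norm_nonneg)
  have R: "?n (w t) \<le> R" if t: "t \<in> {0..T}" for t
  proof -
    have wL: "w t \<in> Lp_space 2 ?M" "w 0 \<in> Lp_space 2 ?M" using w t by auto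
    have "(?n (w t))\<^sup>2 = ?i (w t) (\<lambda>x. w t x - w 0 x) + ?i (w t) (w 0)"
      using inner_L2_diff_right[OF wL(1,1,2)] by (simp add: inner_L2_self)
    also have "\<dots> \<le> ?n (w t) * ?n (\<lambda>x. w t x - w 0 x) + ?n (w t) * ?n (w 0)"
      using inner_L2_Cauchy_Schwarz[OF wL(1) Lp_space_2_diff[OF wL]] inner_L2_Cauchy_Schwarz[OF wL] by linarith
    also have "\<dots> \<le> ?n (w t) * (C * T) + ?n (w t) * ?n (w 0)"
      using t by (intro add_right_mono mult_left_mono lip' Lp_norm_nonneg) auto
    finally have "?n (w t) * ?n (w t) \<le> ?n (w t) * R" by (simp add: R_def power2_eq_square algebra_simps)
    then show ?thesis
      using R0 Lp_norm_nonneg[of 2 ?M "w t"] by (cases "?n (w t) = 0") auto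
  qed
  define E where "E t = (?n (w t))\<^sup>2" for t
  have Elip: "\<bar>E t - E s\<bar> \<le> 2 * R * C * d" if st: "s \<in> {0..T}" "t \<in> {0..T}" "\<bar>t - s\<bar> \<le> d" for s t d
  proof -
    have wL: "w t \<in> Lp_space 2 ?M" "w s \<in> Lp_space 2 ?M" using w st by auto
    have d: "(\<lambda>x. w t x - w s x) \<in> Lp_space 2 ?M" by (rule Lp_space_2_diff[OF wL])
    have "E t - E s = ?i (w t) (\<lambda>x. w t x - w s x) + ?i (w s) (\<lambda>x. w t x - w s x)"
      using inner_L2_diff_right[OF wL(1,1,2)] inner_L2_diff_right[OF wL(2,1,2)]
      by (simp add: E_def inner_L2_self[symmetric] inner_L2_commute)
    then have "\<bar>E t - E s\<bar> \<le> ?n (w t) * ?n (\<lambda>x. w t x - w s x) + ?n (w s) * ?n (\<lambda>x. w t x - w s x)"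
      using inner_L2_Cauchy_Schwarz[OF wL(1) d] inner_L2_Cauchy_Schwarz[OF wL(2) d] by linarith
    also have "\<dots> \<le> R * (C * d) + R * (C * d)"
      using st R0 by (intro add_mono mult_mono R lip' Lp_norm_nonneg) auto
    finally show ?thesis by (simp add: algebra_simps)
  qed
  have Ec: "continuous_on {0..T} E"
  proof -
    have "(2 * R * C)-lipschitz_on {0..T} E"
      using Elip R0 C by (intro lipschitz_onI) (auto simp: dist_real_def)
    then show ?thesis by (rule lipschitz_on_continuous_on)
  qed
  define G where "G = {0<..T} - N"
  have [measurable]: "G \<in> sets lebesgue" using N by (auto simp: G_def null_sets_def)
  have AEG: "AE t in lebesgue. t \<in> {0..T} \<longrightarrow> t \<in> G"
    using wt' by eventually_elim (auto simp: G_def)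
  \<comment> \<open>Outside \<open>G\<close> the behaviour of \<open>wt\<close> is not controlled;
    the value 0 makes the bound on P and its measurability hold at every time.\<close>
  define P where "P t = (if t \<in> G then ?i (wt t) (w t) else 0)" for t
  have Pm: "P \<in> borel_measurable lebesgue"
  proof (rule borel_measurable_LIMSEQ_metric)
  \<comment> \<open>The pairing is only known to be measurable for fixed second argument: freeze w on a grid.\<close>
    define k where "k n t = nat \<lfloor>t * real (Suc n)\<rfloor>" for n t
    define Q where "Q n t = (if t \<in> G then ?i (wt t) (w (real (k n t) / real (Suc n))) else 0)" for n t
    show "Q n \<in> borel_measurable lebesgue" for n
    proof -
      have "(\<lambda>t. if t \<in> G then ?i (wt t) (w (real j / real (Suc n))) else 0) \<in> borel_measurable lebesgue" for j
      proof -
        have "set_integrable lebesgue {0..T} (\<lambda>t. ?i (wt t) (w (real j / real (Suc n))))"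
          using T by (intro int w) auto
        then have [measurable]: "(\<lambda>t. indicator {0..T} t *\<^sub>R ?i (wt t) (w (real j / real (Suc n)))) \<in> borel_measurable lebesgue"
          by (simp add: set_integrable_def)
        have "(\<lambda>t. indicator G t * (indicator {0..T} t *\<^sub>R ?i (wt t) (w (real j / real (Suc n))))) \<in> borel_measurable lebesgue"
          by measurable
        also have "(\<lambda>t. indicator G t * (indicator {0..T} t *\<^sub>R ?i (wt t) (w (real j / real (Suc n)))))
          = (\<lambda>t. if t \<in> G then ?i (wt t) (w (real j / real (Suc n))) else 0)"
          by (auto simp: G_def indicator_def)
        finally show ?thesis .
      qed
      moreover have "k n \<in> measurable lebesgue (count_space UNIV)"
        unfolding k_def by (rule measurable_completion) measurable
      ultimately show ?thesis
        unfolding Q_def by (rule measurable_compose_countable)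
    qed
    show "(\<lambda>n. Q n t) \<longlonglongrightarrow> P t" for t
    proof (cases "t \<in> G")
      case True
      then have t: "0 < t" "t \<notin> N" by (auto simp: G_def)
      show ?thesis
      proof (rule LIM_zero_cancel, rule Lim_null_comparison)
        show "\<forall>\<^sub>F n in sequentially. norm (Q n t - P t) \<le> C * (C * inverse (real (Suc n)))"
        proof (rule always_eventually, rule allI)
          fix n
          let ?s = "real (k n t) / real (Suc n)"
          have "real (k n t) = of_int \<lfloor>t * real (Suc n)\<rfloor>" using t by (simp add: k_def)
          then have "real (k n t) \<le> t * real (Suc n)" "t * real (Suc n) \<le> real (k n t) + 1" by linarith+
          then have "\<bar>real (k n t) - t * real (Suc n)\<bar> / real (Suc n) \<le> 1 / real (Suc n)"
            by (intro divide_right_mono) auto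
          moreover have "?s - t = (real (k n t) - t * real (Suc n)) / real (Suc n)"
            by (simp add: field_simps del: of_nat_Suc)
          ultimately have "\<bar>?s - t\<bar> \<le> inverse (real (Suc n))"
            by (simp add: inverse_eq_divide del: of_nat_Suc)
          then have f1: "?n (\<lambda>x. w ?s x - w t x) \<le> C * inverse (real (Suc n))"
            using t by (intro lip') auto
          have f2: "Q n t - P t = ?i (wt t) (\<lambda>x. w ?s x - w t x)"
            using True t good[OF t] w[of ?s] w[of t] by (simp add: Q_def P_def inner_L2_diff_right)
          have f3: "\<bar>?i (wt t) (\<lambda>x. w ?s x - w t x)\<bar> \<le> C * ?n (\<lambda>x. w ?s x - w t x)"
            using t w[of ?s] w[of t] by (intro CS Lp_space_2_diff) auto
          show "norm (Q n t - P t) \<le> C * (C * inverse (real (Suc n)))"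
            using order_trans[OF f3 mult_left_mono[OF f1 C]] by (simp only: f2 real_norm_def)
        qed
        have "(\<lambda>n. C * (C * inverse (real (Suc n)))) \<longlonglongrightarrow> C * (C * 0)"
          by (intro tendsto_intros LIMSEQ_inverse_real_of_nat)
        then show "(\<lambda>n. C * (C * inverse (real (Suc n)))) \<longlonglongrightarrow> 0" by simp
      qed
    qed (simp add: Q_def P_def)
  qed
  have Pb: "\<bar>P t\<bar> \<le> C * R" for t
  proof (cases "t \<in> G")
    case True
    then have "\<bar>?i (wt t) (w t)\<bar> \<le> C * ?n (w t)" by (intro CS w) (auto simp: G_def)
    also have "\<dots> \<le> C * R" using True C by (intro mult_left_mono R) (auto simp: G_def)
    finally show ?thesis using True by (simp add: P_def)
  qed (use C R0 in \<open>simp add: P_def\<close>)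
  define H where "H t = exp (2 * \<alpha> * t) * (2 * \<alpha> * E t + 2 * P t)" for t
  have icont: "set_integrable lebesgue {a..b} f" if "continuous_on {a..b} f" for f :: "real \<Rightarrow> real" and a b
    using that by (intro absolutely_integrable_continuous_real)
  have iP: "set_integrable lebesgue {a..b} P" for a b
    unfolding set_integrable_def
  proof (rule Bochner_Integration.integrable_bound)
    show "integrable lebesgue (\<lambda>t. indicator {a..b} t *\<^sub>R (C * R))"
      using icont[OF continuous_on_const] by (simp only: set_integrable_def)
    show "(\<lambda>t. indicator {a..b} t *\<^sub>R P t) \<in> borel_measurable lebesgue"
      by (intro borel_measurable_scaleR borel_measurable_indicator Pm) auto
    show "AE t in lebesgue. norm (indicator {a..b} t *\<^sub>R P t) \<le> norm (indicator {a..b} t *\<^sub>R (C * R))"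
      using Pb by (intro AE_I2) (auto simp: indicator_def intro: order_trans[OF _ abs_ge_self])
  qed
  have iH: "set_integrable lebesgue {0..T} H"
  proof -
    have "set_integrable lebesgue {0..T} (\<lambda>t. exp (2 * \<alpha> * t) * (2 * \<alpha> * E t))"
      by (intro icont continuous_intros Ec)
    moreover have "set_integrable lebesgue {0..T} (\<lambda>t. exp (2 * \<alpha> * t) * (2 * P t))"
      unfolding set_integrable_def
    proof (rule Bochner_Integration.integrable_bound)
      show "integrable lebesgue (\<lambda>t. indicator {0..T} t *\<^sub>R (exp (2 * \<alpha> * t) * (2 * (C * R))))"
        unfolding set_integrable_def[symmetric] by (intro icont continuous_intros)
      have "(\<lambda>t. exp (2 * \<alpha> * t)) \<in> borel_measurable lebesgue"
        by (rule measurable_completion) measurable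
      then show "(\<lambda>t. indicator {0..T} t *\<^sub>R (exp (2 * \<alpha> * t) * (2 * P t))) \<in> borel_measurable lebesgue"
        by (intro borel_measurable_scaleR borel_measurable_indicator borel_measurable_times
            borel_measurable_const Pm) auto
      show "AE t in lebesgue. norm (indicator {0..T} t *\<^sub>R (exp (2 * \<alpha> * t) * (2 * P t)))
        \<le> norm (indicator {0..T} t *\<^sub>R (exp (2 * \<alpha> * t) * (2 * (C * R))))"
        using Pb C R0 by (intro AE_I2) (auto simp: indicator_def abs_mult)
    qed
    ultimately show ?thesis
      unfolding H_def distrib_left[of "exp _"] by (rule set_integral_add)
  qed
  \<comment> \<open>The largest weight on [0, T], because \<alpha> is nonnegative.\<close>
  define X where "X = exp (2 * \<alpha> * T)"
  have X: "exp (2 * \<alpha> * t) \<le> X" if "t \<le> T" for t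
    using that \<alpha> by (simp add: X_def mult_left_mono)
  \<comment> \<open>The summands account, in this order, for the change of E between t and b, for
    replacing w a and w b by w t in the pairing, and for the change of the weight between a and
    t.\<close>
  define K where "K = 2 * \<alpha> * X * (2 * R * C) + X * (C * C + C * C) + 2 * (2 * \<alpha> * X) * (C * R)"
  have "X * E T - E 0 = (LINT t:{0..T}|lebesgue. H t)"
  proof -
    have "exp (2 * \<alpha> * T) * E T - exp (2 * \<alpha> * 0) * E 0 = (LINT t:{0..T}|lebesgue. H t)"
    proof (rule increment_eq_integral[OF T iH, where K = K])
      fix a b assume ab: "0 \<le> a" "a \<le> b" "b \<le> T"
      have wL: "w a \<in> Lp_space 2 ?M" "w b \<in> Lp_space 2 ?M" using w ab by auto
      note ib = int[OF ab(1,2) wL(2)] and ia = int[OF ab(1,2) wL(1)]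
      have iHab: "set_integrable lebesgue {a..b} H"
        using ab by (intro set_integrable_subset[OF iH]) auto
      \<comment> \<open>The error density. Its terms before H integrate to the exact increment of
        the weighted energy, split as (exp (2 \<alpha> b) - exp (2 \<alpha> a)) E b + exp (2
        \<alpha> a) (E b - E a).\<close>
      define J where "J t = 2 * \<alpha> * exp (2 * \<alpha> * t) * E b + exp (2 * \<alpha> * a) * ?i (wt t) (w b)
        + exp (2 * \<alpha> * a) * ?i (wt t) (w a) - H t" for t
      have ie: "set_integrable lebesgue {a..b} (\<lambda>t. 2 * \<alpha> * exp (2 * \<alpha> * t))"
        by (intro icont continuous_intros)
      have e: "(LINT t:{a..b}|lebesgue. 2 * \<alpha> * exp (2 * \<alpha> * t)) = exp (2 * \<alpha> * b) - exp (2 * \<alpha> * a)"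
      proof -
        have "((\<lambda>t. 2 * \<alpha> * exp (2 * \<alpha> * t)) has_integral exp (2 * \<alpha> * b) - exp (2 * \<alpha> * a)) {a..b}"
          using ab by (intro fundamental_theorem_of_calculus)
            (auto intro!: derivative_eq_intros simp: has_real_derivative_iff_has_vector_derivative[symmetric])
        then show ?thesis using set_lebesgue_integral_eq_integral(2)[OF ie] by (simp only: integral_unique)
      qed
      \<comment> \<open>Inserting the mixed product of w a and w b gives two increments, each
        against a test function that is fixed in time.\<close>
      have "E b - E a = (?i (w b) (w b) - ?i (w a) (w b)) + (?i (w b) (w a) - ?i (w a) (w a))"
        by (simp add: E_def inner_L2_self inner_L2_commute)
      also have "\<dots> = (LINT t:{a..b}|lebesgue. ?i (wt t) (w b)) + (LINT t:{a..b}|lebesgue. ?i (wt t) (w a))"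
        using inc[OF ab(1,2) wL(2)] inc[OF ab(1,2) wL(1)] by simp
      finally have Eab: "E b - E a = (LINT t:{a..b}|lebesgue. ?i (wt t) (w b)) + (LINT t:{a..b}|lebesgue. ?i (wt t) (w a))" .
      have iJ: "set_integrable lebesgue {a..b} J"
        unfolding J_def by (intro set_integral_add set_integral_diff set_integrable_mult_left set_integrable_mult_right ie ia ib iHab)
      have "(LINT t:{a..b}|lebesgue. J t) = (exp (2 * \<alpha> * b) - exp (2 * \<alpha> * a)) * E b
          + exp (2 * \<alpha> * a) * (LINT t:{a..b}|lebesgue. ?i (wt t) (w b))
          + exp (2 * \<alpha> * a) * (LINT t:{a..b}|lebesgue. ?i (wt t) (w a)) - (LINT t:{a..b}|lebesgue. H t)"
        unfolding J_def e[symmetric]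
        by (subst set_integral_diff set_integral_add
            | intro set_integral_add set_integral_diff set_integrable_mult_left set_integrable_mult_right ie ia ib iHab
            | simp)+
      also have "\<dots> = exp (2 * \<alpha> * b) * E b - exp (2 * \<alpha> * a) * E a - (LINT t:{a..b}|lebesgue. H t)"
        using Eab by (simp add: algebra_simps)
      finally have eq: "exp (2 * \<alpha> * b) * E b - exp (2 * \<alpha> * a) * E a - (LINT t:{a..b}|lebesgue. H t)
        = (LINT t:{a..b}|lebesgue. J t)" by simp
      have "\<bar>LINT t:{a..b}|lebesgue. J t\<bar> \<le> (K * (b - a)) * (b - a)"
      proof (rule set_integral_Icc_abs_bound[OF ab(2) iJ])
        show "AE t in lebesgue. t \<in> {a..b} \<longrightarrow> \<bar>J t\<bar> \<le> K * (b - a)"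
          using AEG
        proof (eventually_elim, intro impI)
          fix t assume "t \<in> {0..T} \<longrightarrow> t \<in> G" and t: "t \<in> {a..b}"
          then have tG: "t \<in> G" and tT: "t \<in> {0..T}" using ab by auto
          then have tN: "0 < t" "t \<notin> N" by (auto simp: G_def)
          have wt2: "w t \<in> Lp_space 2 ?M" using w tN by auto
          define Y where "Y c = ?i (wt t) (\<lambda>x. w c x - w t x)" for c
          have Y: "Y c = ?i (wt t) (w c) - P t" if "c \<in> {a, b}" for c
            using good[OF tN] wL wt2 tG that by (auto simp: Y_def P_def inner_L2_diff_right)
          have Yb: "\<bar>Y c\<bar> \<le> C * (C * (b - a))" if "c \<in> {a, b}" for c
          proof -
            have "\<bar>Y c\<bar> \<le> C * ?n (\<lambda>x. w c x - w t x)"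
              unfolding Y_def using that wL wt2 by (intro CS tN Lp_space_2_diff) auto
            also have "\<dots> \<le> C * (C * (b - a))"
              using that t ab C by (intro mult_left_mono lip') auto
            finally show ?thesis .
          qed
          have "J t = 2 * \<alpha> * exp (2 * \<alpha> * t) * (E b - E t) + exp (2 * \<alpha> * a) * (Y b + Y a)
            + 2 * ((exp (2 * \<alpha> * a) - exp (2 * \<alpha> * t)) * P t)"
            by (simp add: J_def Y H_def algebra_simps)
          also have "\<bar>\<dots>\<bar> \<le> \<bar>2 * \<alpha> * exp (2 * \<alpha> * t) * (E b - E t)\<bar> + \<bar>exp (2 * \<alpha> * a) * (Y b + Y a)\<bar>
            + \<bar>2 * ((exp (2 * \<alpha> * a) - exp (2 * \<alpha> * t)) * P t)\<bar>"
            by linarith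
          also have "\<dots> \<le> 2 * \<alpha> * X * (2 * R * C * (b - a)) + X * (C * (C * (b - a)) + C * (C * (b - a)))
            + 2 * ((2 * \<alpha> * X * (b - a)) * (C * R))"
          proof (intro add_mono)
            have "exp (2 * \<alpha> * t) * \<bar>E b - E t\<bar> \<le> X * (2 * R * C * (b - a))"
              using t ab tT by (intro mult_mono X Elip) (auto simp: X_def)
            then have "(2 * \<alpha>) * (exp (2 * \<alpha> * t) * \<bar>E b - E t\<bar>) \<le> (2 * \<alpha>) * (X * (2 * R * C * (b - a)))"
              using \<alpha> by (intro mult_left_mono) auto
            then show "\<bar>2 * \<alpha> * exp (2 * \<alpha> * t) * (E b - E t)\<bar> \<le> 2 * \<alpha> * X * (2 * R * C * (b - a))"
              using \<alpha> by (simp add: abs_mult mult_ac)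
            have "exp (2 * \<alpha> * a) * \<bar>Y b + Y a\<bar> \<le> X * (C * (C * (b - a)) + C * (C * (b - a)))"
              using Yb[of a] Yb[of b] ab by (intro mult_mono X) (auto simp: X_def)
            then show "\<bar>exp (2 * \<alpha> * a) * (Y b + Y a)\<bar> \<le> X * (C * (C * (b - a)) + C * (C * (b - a)))"
              by (simp add: abs_mult)
            have "\<bar>exp (2 * \<alpha> * a) - exp (2 * \<alpha> * t)\<bar> \<le> (2 * \<alpha> * t - 2 * \<alpha> * a) * exp (2 * \<alpha> * t)"
              using t \<alpha> by (intro exp_diff_le) (simp add: mult_left_mono)
            also have "\<dots> = 2 * \<alpha> * (t - a) * exp (2 * \<alpha> * t)" by (simp add: algebra_simps)
            also have "\<dots> \<le> 2 * \<alpha> * (b - a) * X"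
              using t tT \<alpha> by (intro mult_mono X) auto
            finally have "\<bar>exp (2 * \<alpha> * a) - exp (2 * \<alpha> * t)\<bar> * \<bar>P t\<bar> \<le> 2 * \<alpha> * (b - a) * X * (C * R)"
              using ab \<alpha> by (intro mult_mono Pb) (auto simp: X_def)
            moreover have "\<bar>2 * ((exp (2 * \<alpha> * a) - exp (2 * \<alpha> * t)) * P t)\<bar>
              = 2 * (\<bar>exp (2 * \<alpha> * a) - exp (2 * \<alpha> * t)\<bar> * \<bar>P t\<bar>)"
              by (simp only: abs_mult abs_numeral)
            moreover have "(2 * \<alpha> * X * (b - a)) * (C * R) = 2 * \<alpha> * (b - a) * X * (C * R)"
              by (simp only: mult_ac)
            ultimately show "\<bar>2 * ((exp (2 * \<alpha> * a) - exp (2 * \<alpha> * t)) * P t)\<bar> \<le> 2 * ((2 * \<alpha> * X * (b - a)) * (C * R))"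
              by linarith
          qed
          also have "\<dots> = K * (b - a)" by (simp add: K_def algebra_simps)
          finally show "\<bar>J t\<bar> \<le> K * (b - a)" .
        qed
      qed
      then show "\<bar>exp (2 * \<alpha> * b) * E b - exp (2 * \<alpha> * a) * E a - (LINT s:{a..b}|lebesgue. H s)\<bar> \<le> K * (b - a)\<^sup>2"
        unfolding eq by (simp add: power2_eq_square mult.assoc)
    qed
    then show ?thesis by (simp add: X_def)
  qed
  moreover have "AE t in lebesgue. t \<in> {0..T} \<longrightarrow> H t = exp (2 * \<alpha> * t) * (2 * \<alpha> * (?n (w t))\<^sup>2 + 2 * ?i (wt t) (w t))"
    using AEG by eventually_elim (simp add: H_def P_def E_def)
  ultimately show thesis using that[OF iH] by (simp add: X_def E_def)
qed

section \<open>The energy inequality at a fixed time\<close>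

lemma is_trace_btrace: "\<exists>g. is_trace \<Omega> \<Gamma> u g \<Longrightarrow> is_trace \<Omega> \<Gamma> u (btrace \<Omega> \<Gamma> u)"
  unfolding btrace_def by (erule someI_ex)

lemma sobolev_mono: "m \<le> n \<Longrightarrow> sobolev n \<Omega> \<subseteq> sobolev m \<Omega>"
  unfolding sobolev_def by (auto intro: order_trans)

lemma Lp_norm_le_sobolev_norm: "Lp_norm 2 (lebesgue_on \<Omega>) u \<le> sobolev_norm m \<Omega> u"
  unfolding sobolev_norm_def by (rule real_le_rsqrt) (simp add: sum_nonneg case_prod_beta)

text \<open>The difference of the two sides is a complete square whose root 3 sqrt 2 c is dictated
  by the cubic coefficient; for c = c0 the quartic coefficient is a quarter of the 2 / (9 c0) in the
  feedback.\<close>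

lemma cubic_le_quadratic_quartic:
  fixes s c :: real
  assumes "0 < c" "0 \<le> s"
  shows "sqrt 2 / 3 * s ^ 3 \<le> c * s ^ 2 + 1 / (18 * c) * s ^ 4"
proof -
  have "0 \<le> 1 / (18 * c) * (s * (s - 3 * sqrt 2 * c))\<^sup>2" using assms by simp
  also have "\<dots> = c * s ^ 2 + 1 / (18 * c) * s ^ 4 - sqrt 2 / 3 * s ^ 3"
    using assms by (simp add: power_mult_distrib power2_diff power2_eq_square power4_eq_xxxx power3_eq_cube field_simps)
  finally show ?thesis by simp
qed

text \<open>The weak form is tested with u itself and both convection terms are charged to the
  boundary. Half of each quadratic feedback coefficient and three quarters of the quartic one
  survive; the factor 2 on the pairing doubles what is left.\<close>

lemma weak_form_energy_inequality:
  assumes \<Omega>: "smooth_bounded_domain \<Omega>" and \<Gamma>: "arclength_measure (frontier \<Omega>) \<Gamma>"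
    and c0: "0 < c0" and wd: "0 \<le> wd"
    and u1: "u \<in> sobolev 1 \<Omega>" and tr: "is_trace \<Omega> \<Gamma> u (btrace \<Omega> \<Gamma> u)"
    and wf: "weak_form \<Omega> \<Gamma> \<nu> c0 wd u ut"
  shows "2 * inner_L2 (lebesgue_on \<Omega>) ut u + 2 * \<nu> * (Lp_norm 2 (lebesgue_on \<Omega>) (wgrad \<Omega> u))\<^sup>2
    + 2 * (c0 + wd) * (Lp_norm 2 \<Gamma> (btrace \<Omega> \<Gamma> u))\<^sup>2 + 1 / (3 * c0) * (Lp_norm 4 \<Gamma> (btrace \<Omega> \<Gamma> u)) ^ 4 \<le> 0"
proof -
  let ?M = "lebesgue_on \<Omega>"
  define g where "g = btrace \<Omega> \<Gamma> u"
  have u2: "u \<in> Lp_space 2 ?M" using u1 by (simp add: sobolev_def)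
  have g2: "g \<in> Lp_space 2 \<Gamma>" using tr by (simp add: is_trace_def g_def)
  note W = wgrad_Lp_space[OF u1]
  have [measurable]: "g \<in> borel_measurable \<Gamma>" "wgrad \<Omega> u \<in> borel_measurable ?M"
    using g2 W by (auto intro: Lp_space_measurable)
  have n1: "norm (1 :: real^2) = sqrt 2" by (simp add: norm_vec_def L2_set_def sum_2)
  have W1: "(\<lambda>x. wgrad \<Omega> u x \<bullet> 1) \<in> Lp_space 2 ?M"
  proof (rule Lp_space_2I)
    show "integrable ?M (\<lambda>x. 2 * (norm (wgrad \<Omega> u x))\<^sup>2)" using Lp_space_2_integrable[OF W] by simp
    fix x
    have "\<bar>wgrad \<Omega> u x \<bullet> 1\<bar>\<^sup>2 \<le> (norm (wgrad \<Omega> u x) * sqrt 2)\<^sup>2"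
      using Cauchy_Schwarz_ineq2[of "wgrad \<Omega> u x" 1] by (intro power_mono) (auto simp: n1)
    then show "(norm (wgrad \<Omega> u x \<bullet> 1))\<^sup>2 \<le> 2 * (norm (wgrad \<Omega> u x))\<^sup>2"
      by (simp add: power_mult_distrib)
  qed measurable
  \<comment> \<open>With v = u the integrability clauses of \<open>weak_form\<close> say that u^2
    times the derivative is integrable and that the trace has an integrable fourth power.\<close>
  have "integrable ?M (\<lambda>x. u x * (wgrad \<Omega> u x \<bullet> 1) * u x)" and i4: "integrable \<Gamma> (\<lambda>x. g x ^ 3 * g x)"
    and eq: "inner_L2 ?M ut u + \<nu> * inner_L2 ?M (wgrad \<Omega> u) (wgrad \<Omega> u)
        + wd * inner_L2 ?M (\<lambda>x. wgrad \<Omega> u x \<bullet> 1) u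
        + inner_L2 ?M (\<lambda>x. u x * (wgrad \<Omega> u x \<bullet> 1)) u
        + (\<integral>x. (2 * (c0 + wd) * g x + 2 / (9 * c0) * g x ^ 3) * g x \<partial>\<Gamma>) = 0"
    using wf u1 unfolding weak_form_def g_def by auto
  then have iA2: "integrable ?M (\<lambda>x. u x ^ 2 * (1 \<bullet> wgrad \<Omega> u x))"
    by (simp add: power2_eq_square inner_commute mult_ac)
  have iA1: "integrable ?M (\<lambda>x. u x ^ 1 * (1 \<bullet> wgrad \<Omega> u x))"
    using Lp_space_2_inner[OF u2 W1] by (simp add: inner_commute)
  have i2: "integrable \<Gamma> (\<lambda>x. (g x)\<^sup>2)" using Lp_space_2_integrable[OF g2] by simp
  have i4': "integrable \<Gamma> (\<lambda>x. g x ^ 4)" using i4 by (simp add: power3_eq_cube power4_eq_xxxx mult.assoc)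
  have i3: "integrable \<Gamma> (\<lambda>x. \<bar>g x\<bar> ^ 3)"
  proof (rule Bochner_Integration.integrable_bound)
    show "integrable \<Gamma> (\<lambda>x. (g x)\<^sup>2 + g x ^ 4)" using i2 i4' by simp
    have "\<bar>s\<bar> ^ 3 \<le> s\<^sup>2 + s ^ 4" for s :: real
    proof -
      \<comment> \<open>The second factor is |s|^2 - |s| + 1 after completing the square, so the
        cube is dominated by the square plus the fourth power.\<close>
      have "0 \<le> \<bar>s\<bar>\<^sup>2 * ((\<bar>s\<bar> - 1 / 2)\<^sup>2 + 3 / 4)" by simp
      also have "\<dots> = s\<^sup>2 + s ^ 4 - \<bar>s\<bar> ^ 3"
        by (simp add: power2_eq_square power3_eq_cube power4_eq_xxxx algebra_simps abs_mult[symmetric])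
      finally show ?thesis by simp
    qed
    then show "AE x in \<Gamma>. norm (\<bar>g x\<bar> ^ 3) \<le> norm ((g x)\<^sup>2 + g x ^ 4)" by simp
  qed measurable
  define A1 where "A1 = (\<integral>x. u x ^ 1 * (1 \<bullet> wgrad \<Omega> u x) \<partial>?M)"
  define A2 where "A2 = (\<integral>x. u x ^ 2 * (1 \<bullet> wgrad \<Omega> u x) \<partial>?M)"
  define I2 where "I2 = (\<integral>x. (g x)\<^sup>2 \<partial>\<Gamma>)"
  define I3 where "I3 = (\<integral>x. \<bar>g x\<bar> ^ 3 \<partial>\<Gamma>)"
  define I4 where "I4 = (\<integral>x. g x ^ 4 \<partial>\<Gamma>)"
  have I2n: "0 \<le> I2" by (simp add: I2_def Bochner_Integration.integral_nonneg)
  have b1: "2 * \<bar>A1\<bar> \<le> sqrt 2 * I2"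
    using trace_divergence_bound_power[OF \<Omega> \<Gamma> tr iA1] i2
    by (simp add: n1 A1_def I2_def g_def numeral_2_eq_2[symmetric])
  have b2: "3 * \<bar>A2\<bar> \<le> sqrt 2 * I3"
    using trace_divergence_bound_power[OF \<Omega> \<Gamma> tr iA2] i3
    by (simp add: n1 A2_def I3_def g_def eval_nat_numeral)
  have b3: "sqrt 2 / 3 * I3 \<le> c0 * I2 + 1 / (18 * c0) * I4"
  proof -
    have "sqrt 2 / 3 * I3 = (\<integral>x. sqrt 2 / 3 * \<bar>g x\<bar> ^ 3 \<partial>\<Gamma>)" by (simp add: I3_def)
    also have "\<dots> \<le> (\<integral>x. c0 * (g x)\<^sup>2 + 1 / (18 * c0) * g x ^ 4 \<partial>\<Gamma>)"
    proof (rule integral_mono)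
      show "sqrt 2 / 3 * \<bar>g x\<bar> ^ 3 \<le> c0 * (g x)\<^sup>2 + 1 / (18 * c0) * g x ^ 4" for x
        using cubic_le_quadratic_quartic[OF c0, of "\<bar>g x\<bar>"] by simp
    qed (use i2 i3 i4' in auto)
    also have "\<dots> = c0 * I2 + 1 / (18 * c0) * I4" using i2 i4' by (simp add: I2_def I4_def)
    finally show ?thesis .
  qed
  have b4: "wd * \<bar>A1\<bar> \<le> wd * I2"
  proof (rule mult_left_mono[OF _ wd])
    \<comment> \<open>The crude sqrt 2 \<le> 2 is enough: of the feedback 2 wd, the amount wd is
      reserved for this term.\<close>
    have "sqrt 2 * I2 \<le> 2 * I2" using I2n sqrt2_less_2 by (intro mult_right_mono) auto
    then show "\<bar>A1\<bar> \<le> I2" using b1 by linarith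
  qed
  have e1: "inner_L2 ?M (\<lambda>x. wgrad \<Omega> u x \<bullet> 1) u = A1"
    by (simp add: inner_L2_def A1_def inner_commute mult.commute)
  have e2: "inner_L2 ?M (\<lambda>x. u x * (wgrad \<Omega> u x \<bullet> 1)) u = A2"
    by (simp add: inner_L2_def A2_def inner_commute power2_eq_square mult_ac)
  have e3: "inner_L2 ?M (wgrad \<Omega> u) (wgrad \<Omega> u) = (Lp_norm 2 ?M (wgrad \<Omega> u))\<^sup>2"
    by (simp add: inner_L2_def Lp_norm_power power2_norm_eq_inner)
  have e4: "(\<integral>x. (2 * (c0 + wd) * g x + 2 / (9 * c0) * g x ^ 3) * g x \<partial>\<Gamma>) = 2 * (c0 + wd) * I2 + 2 / (9 * c0) * I4"
  proof -
    have "(\<lambda>x. (2 * (c0 + wd) * g x + 2 / (9 * c0) * g x ^ 3) * g x)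
      = (\<lambda>x. 2 * (c0 + wd) * (g x)\<^sup>2 + 2 / (9 * c0) * g x ^ 4)"
      by (simp add: fun_eq_iff power2_eq_square power3_eq_cube power4_eq_xxxx algebra_simps)
    then show ?thesis using i2 i4' by (simp add: I2_def I4_def)
  qed
  have G2: "(Lp_norm 2 \<Gamma> g)\<^sup>2 = I2" by (simp add: Lp_norm_power I2_def)
  have G4: "(Lp_norm 4 \<Gamma> g) ^ 4 = I4" by (simp add: Lp_norm_power I4_def)
  have r1: "- (wd * A1) \<le> wd * I2"
    using b4 abs_ge_minus_self[of "wd * A1"] wd by (simp add: abs_mult)
  have r2: "- A2 \<le> c0 * I2 + 1 / (18 * c0) * I4"
    using b2 b3 by linarith
  \<comment> \<open>All coefficients become numerical multiples of the same few products, which the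
    linear arithmetic treats as atoms.\<close>
  have d: "2 * (c0 + wd) * I2 = 2 * (c0 * I2) + 2 * (wd * I2)"
    "2 / (9 * c0) * I4 = 4 * (1 / (18 * c0) * I4)" "1 / (3 * c0) * I4 = 6 * (1 / (18 * c0) * I4)"
    "2 * \<nu> * (Lp_norm 2 ?M (wgrad \<Omega> u))\<^sup>2 = 2 * (\<nu> * (Lp_norm 2 ?M (wgrad \<Omega> u))\<^sup>2)"
    using c0 by (simp_all add: field_simps)
  show ?thesis
    using eq[unfolded e1 e2 e3 e4] r1 r2 unfolding g_def[symmetric] G2 G4 d by linarith
qed

section \<open>Exponential decay of the energy\<close>

text \<open>With the time integral taken in \<open>ennreal\<close>, its finiteness is part of the
  assertion; a Bochner integral would be 0 by convention for a non-integrable integrand.\<close>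

theorem lemma3p1:
  fixes \<Omega> :: "(real^2) set" and \<Gamma> :: "(real^2) measure"
    and \<nu> c0 wd CF \<alpha> \<beta> :: real
    and w0 :: "real^2 \<Rightarrow> real" and w :: "real \<Rightarrow> real^2 \<Rightarrow> real"
  assumes "smooth_bounded_domain \<Omega>"
    and "arclength_measure (frontier \<Omega>) \<Gamma>"
    and "0 < \<nu>" and "0 < c0" and "0 \<le> wd"
    and "friedrichs_constant \<Omega> \<Gamma> CF"
    and "w0 \<in> Lp_space 2 (lebesgue_on \<Omega>)"
    and "closed_loop_solution \<Omega> \<Gamma> \<nu> c0 wd w0 w"
    and "0 \<le> \<alpha>" and "\<alpha> < 1 / CF * min \<nu> (c0 + wd)"
    and "\<beta> = 2 * min (\<nu> - \<alpha> * CF) (c0 + wd - \<alpha> * CF)"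
  shows "0 < \<beta> \<and>
    (\<forall>t>0.
      ennreal ((Lp_norm 2 (lebesgue_on \<Omega>) (w t))\<^sup>2)
      + ennreal (\<beta> * exp (- 2 * \<alpha> * t)) *
          (\<integral>\<^sup>+ s \<in> {0..t}. ennreal (exp (2 * \<alpha> * s) *
             ((Lp_norm 2 (lebesgue_on \<Omega>) (wgrad \<Omega> (w s)))\<^sup>2
              + (Lp_norm 2 \<Gamma> (btrace \<Omega> \<Gamma> (w s)))\<^sup>2
              + 1 / (3 * \<beta> * c0) * (Lp_norm 4 \<Gamma> (btrace \<Omega> \<Gamma> (w s))) ^ 4)) \<partial>lebesgue)
      \<le> ennreal (exp (- 2 * \<alpha> * t) * (Lp_norm 2 (lebesgue_on \<Omega>) w0)\<^sup>2))"
proof (intro conjI allI impI)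
  let ?M = "lebesgue_on \<Omega>"
  have CF: "0 < CF" using assms(6) by (simp add: friedrichs_constant_def)
  then have "\<alpha> * CF < min \<nu> (c0 + wd)" using assms(10) by (simp add: field_simps)
  then show \<beta>: "0 < \<beta>" using assms(11) by simp
  \<comment> \<open>What remains of the gradient and boundary dissipation after Friedrichs'
    inequality has paid for the derivative 2 \<alpha> of the exponential weight.\<close>
  have \<beta>1: "\<beta> \<le> 2 * \<nu> - 2 * \<alpha> * CF" and \<beta>2: "\<beta> \<le> 2 * (c0 + wd) - 2 * \<alpha> * CF"
    using assms(11) by (auto simp: min_def)
  obtain wt C where w00: "AE x in ?M. w 0 x = w0 x"
    and w2: "\<And>t. 0 \<le> t \<Longrightarrow> w t \<in> Lp_space 2 ?M"
    and td: "time_derivative \<Omega> w wt"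
    and ae: "AE t in lebesgue_on {0<..}.
           w t \<in> sobolev 2 \<Omega> \<and> wt t \<in> sobolev 2 \<Omega> \<and>
           (\<exists>g. is_trace \<Omega> \<Gamma> (w t) g) \<and>
           weak_form \<Omega> \<Gamma> \<nu> c0 wd (w t) (wt t) \<and>
           set_integrable lebesgue {0..t} (\<lambda>s. (sobolev_norm 2 \<Omega> (wt s))\<^sup>2) \<and>
           (sobolev_norm 2 \<Omega> (w t))\<^sup>2 + (sobolev_norm 1 \<Omega> (wt t))\<^sup>2
             + (LINT s:{0..t}|lebesgue. (sobolev_norm 2 \<Omega> (wt s))\<^sup>2) \<le> C"
    using assms(8) unfolding closed_loop_solution_def by blast
  define good where "good t \<longleftrightarrow> w t \<in> sobolev 1 \<Omega> \<and> is_trace \<Omega> \<Gamma> (w t) (btrace \<Omega> \<Gamma> (w t))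
      \<and> weak_form \<Omega> \<Gamma> \<nu> c0 wd (w t) (wt t)
      \<and> wt t \<in> Lp_space 2 ?M \<and> Lp_norm 2 ?M (wt t) \<le> sqrt C" for t
  have "AE t in lebesgue_on {0<..}. good t"
    using ae
  proof eventually_elim
    case (elim t)
    \<comment> \<open>The other summands of the regularity bound are nonnegative, so C alone bounds
      the squared H1 norm of the time derivative.\<close>
    have "0 \<le> (LINT s:{0..t}|lebesgue. (sobolev_norm 2 \<Omega> (wt s))\<^sup>2)"
      unfolding set_lebesgue_integral_def by (intro Bochner_Integration.integral_nonneg) auto
    then have "(sobolev_norm 1 \<Omega> (wt t))\<^sup>2 \<le> C"
      using elim zero_le_power2[of "sobolev_norm 2 \<Omega> (w t)"] by linarith
    then have "Lp_norm 2 ?M (wt t) \<le> sqrt C"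
      using Lp_norm_le_sobolev_norm[of \<Omega> "wt t" 1] by (meson real_le_rsqrt order_trans)
    moreover have "w t \<in> sobolev 1 \<Omega>" using elim sobolev_mono[of 1 2 \<Omega>] by auto
    moreover have "wt t \<in> Lp_space 2 ?M" using elim by (simp add: sobolev_def)
    ultimately show ?case using elim is_trace_btrace[of \<Omega> \<Gamma> "w t"] by (simp add: good_def)
  qed
  then have good: "AE t in lebesgue. 0 < t \<longrightarrow> good t"
    by (simp add: AE_restrict_space_iff)
  fix t :: real assume t: "0 < t"
  define D where "D s = (Lp_norm 2 ?M (wgrad \<Omega> (w s)))\<^sup>2 + (Lp_norm 2 \<Gamma> (btrace \<Omega> \<Gamma> (w s)))\<^sup>2
              + 1 / (3 * \<beta> * c0) * (Lp_norm 4 \<Gamma> (btrace \<Omega> \<Gamma> (w s))) ^ 4" for s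
  have D0: "0 \<le> D s" for s
    using \<beta> assms(4) by (simp add: D_def)
  have "AE t in lebesgue. 0 < t \<longrightarrow> wt t \<in> Lp_space 2 ?M \<and> Lp_norm 2 ?M (wt t) \<le> sqrt C"
    using good by eventually_elim (simp add: good_def)
  from time_derivative_energy[OF td w2 this less_imp_le[OF t] assms(9)]
  obtain H where iH: "set_integrable lebesgue {0..t} H"
    and H: "AE s in lebesgue. s \<in> {0..t} \<longrightarrow> H s = exp (2 * \<alpha> * s) *
       (2 * \<alpha> * (Lp_norm 2 ?M (w s))\<^sup>2 + 2 * inner_L2 ?M (wt s) (w s))"
    and E: "exp (2 * \<alpha> * t) * (Lp_norm 2 ?M (w t))\<^sup>2 - (Lp_norm 2 ?M (w 0))\<^sup>2 = (LINT s:{0..t}|lebesgue. H s)"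
    by blast
  have HD: "AE s in lebesgue. s \<in> {0..t} \<longrightarrow> \<beta> * (exp (2 * \<alpha> * s) * D s) \<le> - H s"
    using H good AE_lebesgue_neq[of 0]
  proof (eventually_elim, intro impI)
    fix s assume Hs: "s \<in> {0..t} \<longrightarrow> H s = exp (2 * \<alpha> * s) *
       (2 * \<alpha> * (Lp_norm 2 ?M (w s))\<^sup>2 + 2 * inner_L2 ?M (wt s) (w s))"
      and gs: "0 < s \<longrightarrow> good s" and s0: "s \<noteq> 0" and s: "s \<in> {0..t}"
    then have gd: "good s" by auto
    define A where "A = (Lp_norm 2 ?M (wgrad \<Omega> (w s)))\<^sup>2"
    define B where "B = (Lp_norm 2 \<Gamma> (btrace \<Omega> \<Gamma> (w s)))\<^sup>2"
    define Q where "Q = (Lp_norm 4 \<Gamma> (btrace \<Omega> \<Gamma> (w s))) ^ 4"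
    have AB: "0 \<le> A" "0 \<le> B" by (simp_all add: A_def B_def)
    have e: "2 * inner_L2 ?M (wt s) (w s) + 2 * \<nu> * A + 2 * (c0 + wd) * B + 1 / (3 * c0) * Q \<le> 0"
      using gd weak_form_energy_inequality[OF assms(1,2,4,5), of "w s" \<nu> "wt s"]
      by (simp add: good_def A_def B_def Q_def)
    have "(Lp_norm 2 ?M (w s))\<^sup>2 \<le> CF * (A + B)"
      using assms(6) gd by (simp add: friedrichs_constant_def good_def A_def B_def)
    then have f: "2 * \<alpha> * (Lp_norm 2 ?M (w s))\<^sup>2 \<le> 2 * \<alpha> * (CF * (A + B))"
      using assms(9) by (intro mult_left_mono) auto
    have "\<beta> * A \<le> (2 * \<nu> - 2 * \<alpha> * CF) * A" "\<beta> * B \<le> (2 * (c0 + wd) - 2 * \<alpha> * CF) * B"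
      using \<beta>1 \<beta>2 AB by (auto intro: mult_right_mono)
    \<comment> \<open>The coefficient of the quartic term in the claim contains 1 / \<beta>, so that
      this term enters with its full dissipation rate 1 / (3 c0).\<close>
    moreover have "\<beta> * (1 / (3 * \<beta> * c0) * Q) = 1 / (3 * c0) * Q"
      using \<beta> by simp
    ultimately have "\<beta> * D s \<le> - (2 * \<alpha> * (Lp_norm 2 ?M (w s))\<^sup>2 + 2 * inner_L2 ?M (wt s) (w s))"
      using e f unfolding D_def A_def[symmetric] B_def[symmetric] Q_def[symmetric] distrib_left
      by (simp add: algebra_simps)
    then have "exp (2 * \<alpha> * s) * (\<beta> * D s) \<le> exp (2 * \<alpha> * s) * - (2 * \<alpha> * (Lp_norm 2 ?M (w s))\<^sup>2 + 2 * inner_L2 ?M (wt s) (w s))"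
      by (rule mult_left_mono) simp
    moreover have "H s = exp (2 * \<alpha> * s) * (2 * \<alpha> * (Lp_norm 2 ?M (w s))\<^sup>2 + 2 * inner_L2 ?M (wt s) (w s))"
      using Hs s by blast
    ultimately show "\<beta> * (exp (2 * \<alpha> * s) * D s) \<le> - H s"
      by (simp only: mult_minus_right mult.left_commute[of \<beta>])
  qed
  define I where "I = - (LINT s:{0..t}|lebesgue. H s)"
  have "(\<integral>\<^sup>+ s \<in> {0..t}. ennreal (exp (2 * \<alpha> * s) * D s) \<partial>lebesgue)
    \<le> (\<integral>\<^sup>+ s. ennreal (indicator {0..t} s *\<^sub>R H s * (- 1 / \<beta>)) \<partial>lebesgue)"
  \<comment> \<open>Monotonicity applies to functions not known to be measurable. This matters since
    only the majorant, a multiple of H, has been shown to be integrable in time; traces and weak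
    gradients are chosen separately at each time.\<close>
  proof (rule nn_integral_mono_AE)
    show "AE s in lebesgue. ennreal (exp (2 * \<alpha> * s) * D s) * indicator {0..t} s
      \<le> ennreal (indicator {0..t} s *\<^sub>R H s * (- 1 / \<beta>))"
      using HD
    proof eventually_elim
      case (elim s)
      show ?case
      proof (cases "s \<in> {0..t}")
        case True
        then have "exp (2 * \<alpha> * s) * D s \<le> - H s / \<beta>"
          using divide_right_mono[OF elim[rule_format, OF True], of \<beta>] \<beta> by simp
        then show ?thesis using True by (simp add: ennreal_leI)
      qed simp
    qed
  qed
  also have "\<dots> = ennreal (\<integral>s. indicator {0..t} s *\<^sub>R H s * (- 1 / \<beta>) \<partial>lebesgue)"
  proof (rule nn_integral_eq_integral)
    show "integrable lebesgue (\<lambda>s. indicator {0..t} s *\<^sub>R H s * (- 1 / \<beta>))"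
      using iH unfolding set_integrable_def by (rule integrable_mult_left)
    show "AE s in lebesgue. 0 \<le> indicator {0..t} s *\<^sub>R H s * (- 1 / \<beta>)"
      using HD
    proof eventually_elim
      case (elim s)
      have "0 \<le> \<beta> * (exp (2 * \<alpha> * s) * D s)" using \<beta> D0[of s] by simp
      then show ?case using elim \<beta> by (cases "s \<in> {0..t}") (auto simp: divide_nonpos_pos)
    qed
  qed
  also have "(\<integral>s. indicator {0..t} s *\<^sub>R H s * (- 1 / \<beta>) \<partial>lebesgue) = I / \<beta>"
    by (subst integral_mult_left_zero) (simp add: I_def set_lebesgue_integral_def)
  finally have J: "(\<integral>\<^sup>+ s \<in> {0..t}. ennreal (exp (2 * \<alpha> * s) * D s) \<partial>lebesgue) \<le> ennreal (I / \<beta>)" .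
  \<comment> \<open>\<open>ennreal\<close> sends negative numbers to 0, so the sign is needed before
    products and sums can be computed in the reals.\<close>
  have I0: "0 \<le> I"
  proof -
    have "0 \<le> (\<integral>s. indicator {0..t} s *\<^sub>R - H s \<partial>lebesgue)"
    proof (rule integral_nonneg_AE)
      show "AE s in lebesgue. 0 \<le> indicator {0..t} s *\<^sub>R - H s"
        using HD
      proof eventually_elim
        case (elim s)
        have "0 \<le> \<beta> * (exp (2 * \<alpha> * s) * D s)" using \<beta> D0[of s] by simp
        then show ?case using elim by (cases "s \<in> {0..t}") auto
      qed
    qed
    then show ?thesis by (simp add: I_def set_lebesgue_integral_def)
  qed
  have w0: "(Lp_norm 2 ?M (w 0))\<^sup>2 = (Lp_norm 2 ?M w0)\<^sup>2"
  proof -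
    have "w 0 \<in> borel_measurable ?M" "w0 \<in> borel_measurable ?M"
      using w2[of 0] assms(7) by (auto intro: Lp_space_measurable)
    then have "(\<integral>x. norm (w 0 x) ^ 2 \<partial>?M) = (\<integral>x. norm (w0 x) ^ 2 \<partial>?M)"
      using w00 by (intro integral_cong_AE) auto
    then show ?thesis by (simp add: Lp_norm_power)
  qed
  have "ennreal ((Lp_norm 2 ?M (w t))\<^sup>2)
      + ennreal (\<beta> * exp (- 2 * \<alpha> * t)) * (\<integral>\<^sup>+ s \<in> {0..t}. ennreal (exp (2 * \<alpha> * s) * D s) \<partial>lebesgue)
    \<le> ennreal ((Lp_norm 2 ?M (w t))\<^sup>2) + ennreal (\<beta> * exp (- 2 * \<alpha> * t)) * ennreal (I / \<beta>)"
    using J by (intro add_left_mono mult_left_mono) auto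
  also have "\<dots> = ennreal ((Lp_norm 2 ?M (w t))\<^sup>2 + exp (- 2 * \<alpha> * t) * I)"
    using \<beta> I0 by (simp add: ennreal_mult[symmetric] ennreal_plus[symmetric] del: ennreal_plus)
  \<comment> \<open>The integrated energy identity multiplied by exp (-2 \<alpha> t); this step is
    an equality, all estimates having been made under the time integral.\<close>
  also have "(Lp_norm 2 ?M (w t))\<^sup>2 + exp (- 2 * \<alpha> * t) * I = exp (- 2 * \<alpha> * t) * (Lp_norm 2 ?M w0)\<^sup>2"
  proof -
    have "I = (Lp_norm 2 ?M w0)\<^sup>2 - exp (2 * \<alpha> * t) * (Lp_norm 2 ?M (w t))\<^sup>2"
      using E by (simp add: I_def w0)
    moreover have "exp (- 2 * \<alpha> * t) * exp (2 * \<alpha> * t) = 1" by (simp add: exp_add[symmetric])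
    ultimately show ?thesis by (simp add: right_diff_distrib mult.assoc[symmetric])
  qed
  finally show "ennreal ((Lp_norm 2 (lebesgue_on \<Omega>) (w t))\<^sup>2)
      + ennreal (\<beta> * exp (- 2 * \<alpha> * t)) *
          (\<integral>\<^sup>+ s \<in> {0..t}. ennreal (exp (2 * \<alpha> * s) *
             ((Lp_norm 2 (lebesgue_on \<Omega>) (wgrad \<Omega> (w s)))\<^sup>2
              + (Lp_norm 2 \<Gamma> (btrace \<Omega> \<Gamma> (w s)))\<^sup>2
              + 1 / (3 * \<beta> * c0) * (Lp_norm 4 \<Gamma> (btrace \<Omega> \<Gamma> (w s))) ^ 4)) \<partial>lebesgue)
      \<le> ennreal (exp (- 2 * \<alpha> * t) * (Lp_norm 2 (lebesgue_on \<Omega>) w0)\<^sup>2)"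
    unfolding D_def .
qed

end
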